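(* Let $f(\tau)=\prod_{n\mid N}\eta(n\tau)^{r_n}=\sum_{n\ge0}c_f(n)q^n$ be a weakly admissible eta-quotient of level $N$ and weight $k=\frac12\sum_nr_n$ with $\sum_{n\mid N}nr_n=0$. Let $\varpi=\prod_{n\mid N}(N/n)^{|r_n|}$ and $\delta=0$ (resp. $\delta=1$) if $\varpi=2^\alpha(4m+1)$ (resp. $2^\alpha(4m+3)$), $\alpha,m\in\mathbb{Z}_{\ge0}$. Let $l\in L_f$ be such that for every prime $p$, $p\nmid N$ implies $p^2\nmid l$, and suppose that at least one of $l,N$ is odd. Then $$c_f(l)=\begin{cases}-r_1\displaystyle\sum_{a\mid l,\,(a,N)=1}\Big(\frac a\varpi\Big)a^{k-1}&\text{if }2\mid l,\ 2\nmid N,\\[2mm]-r_1\displaystyle\sum_{a\mid l,\,(a,N)=1}\Big(\frac a\varpi\Big)a^{k-1}e\Big(\frac{(k+\delta)(l-l/a)}4\Big)&\text{if }2\nmid l.\end{cases}$$ In particular, if $\operatorname{rad}(l)\mid\operatorname{rad}(N)$, then $c_f(l)=-r_1$.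
   Context: $e(x)=\exp(2\pi ix)$, $q=e(\tau)$, $\eta(\tau)=q^{1/24}\prod(1-q^n)$, $r_n\in\mathbb{Z}$, level $N=\operatorname{lcm}\{n:r_n\ne0\}$; $r_1$ is the exponent of $\eta(\tau)$. $\widetilde{\Gamma_0(N)}$: pairs $(\gamma,\varepsilon(c\tau+d)^{1/2})$, $\gamma=\begin{pmatrix}a&b\\c&d\end{pmatrix}\in\Gamma_0(N)$, $\varepsilon=\pm1$, principal square root, product $(\gamma_1,\phi_1)(\gamma_2,\phi_2)=(\gamma_1\gamma_2,\phi_1(\gamma_2\tau)\phi_2(\tau))$; $(g|_k(\gamma,\phi))(\tau)=\phi(\tau)^{-2k}g(\gamma\tau)$, $\widetilde\gamma=(\gamma,(c\tau+d)^{1/2})$. Character of $f$: $\chi(\gamma,\varepsilon(c\tau+d)^{1/2})=\varepsilon^{-2k}e(\frac1{24}\sum r_n\Psi\begin{pmatrix}a&bn\\c/n&d\end{pmatrix})$ with $\Psi\begin{pmatrix}a&b\\c&d\end{pmatrix}=\frac{a+d}c+12s(-d,c)-3$ ($c>0$), $\frac{a+d}c+12s(d,-c)+3$ ($c<0$), $b$ ($c=0,a>0$), $-b-6$ ($c=0,a<0$), Dedekind sum $s$. $M_k,S_k$ as usual (holomorphic $g$ with $g|_k\gamma=\chi(\gamma)g$ and all $q$-expansions at cusps having only nonnegative, resp. positive, exponents). Weakly admissible: $f\in M_k(\Gamma_0(N),\chi)$ and either $\dim M_k(\Gamma_0(N),\chi)=1$ or ($\dim M_k\ge2$, $\dim S_k(\Gamma_0(N),\chi)=1$,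 $f$ cusp form). $m_f=24/\gcd(24,\sum(N/n)r_n,\sum nr_n)$; $L_f=\{l\ge1:l\equiv1\bmod m_f\}$ if $k\in\mathbb{Z}$, additionally $l$ a perfect square if $k\in\frac12+\mathbb{Z}$. $(\frac a\varpi)$: Kronecker–Jacobi symbol; $\operatorname{rad}$ = product of distinct prime divisors. *)

theory Defs
  imports "HOL-Analysis.Analysis" "HOL-Number_Theory.Number_Theory" "HOL-Library.Function_Algebras"
begin

definition upper :: "complex set" where
  "upper = {\<tau>. Im \<tau> > 0}"

definition ee :: "complex \<Rightarrow> complex" where
  "ee z = exp (2 * of_real pi * \<i> * z)"

definition eta :: "complex \<Rightarrow> complex" where
  "eta \<tau> = ee (\<tau> / 24) * (\<Prod>n. (1 - ee \<tau> ^ Suc n))"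

definition eta_quotient :: "(nat \<Rightarrow> int) \<Rightarrow> nat \<Rightarrow> complex \<Rightarrow> complex" where
  "eta_quotient r N \<tau> = (\<Prod>n\<in>{n. n dvd N}. eta (of_nat n * \<tau>) powi r n)"

text \<open>Coefficients c_f(n) of the q-expansion f = sum c_f(n) q^n (valid when sum n r_n = 0)\<close>
definition eta_coeff :: "(nat \<Rightarrow> int) \<Rightarrow> nat \<Rightarrow> nat \<Rightarrow> complex" where
  "eta_coeff r N = (THE c. \<forall>\<tau>\<in>upper. (\<lambda>n. c n * ee \<tau> ^ n) sums eta_quotient r N \<tau>)"

text \<open>twice the weight: 2k = sum r_n\<close>
definition wt2 :: "(nat \<Rightarrow> int) \<Rightarrow> nat \<Rightarrow> int" where
  "wt2 r N = (\<Sum>n\<in>{n. n dvd N}. r n)"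

type_synonym mat2 = "int \<times> int \<times> int \<times> int"

definition Gamma0 :: "nat \<Rightarrow> mat2 set" where
  "Gamma0 N = {(a, b, c, d). a * d - b * c = 1 \<and> int N dvd c}"

definition moeb :: "mat2 \<Rightarrow> complex \<Rightarrow> complex" where
  "moeb \<gamma> \<tau> = (case \<gamma> of (a, b, c, d) \<Rightarrow>
      (of_int a * \<tau> + of_int b) / (of_int c * \<tau> + of_int d))"

text \<open>(g |_k (gamma, eps (c tau + d)^(1/2)))(tau) = (eps sqrt(c tau+d))^(-2k) g(gamma tau),
  principal square root; w = 2k\<close>
definition slash :: "int \<Rightarrow> mat2 \<Rightarrow> int \<Rightarrow> (complex \<Rightarrow> complex) \<Rightarrow> complex \<Rightarrow> complex" where
  "slash w \<gamma> \<epsilon> g \<tau> = (case \<gamma> of (a, b, c, d) \<Rightarrow>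
      (of_int \<epsilon> * csqrt (of_int c * \<tau> + of_int d)) powi (- w) * g (moeb \<gamma> \<tau>))"

definition sawtooth :: "real \<Rightarrow> real" where
  "sawtooth x = (if x \<in> \<int> then 0 else x - of_int \<lfloor>x\<rfloor> - 1 / 2)"

definition dedekind_sum :: "int \<Rightarrow> int \<Rightarrow> real" where
  "dedekind_sum h k = (\<Sum>r\<in>{1..k - 1}. sawtooth (of_int r / of_int k) * sawtooth (of_int (h * r) / of_int k))"

definition Psi :: "mat2 \<Rightarrow> real" where
  "Psi \<gamma> = (case \<gamma> of (a, b, c, d) \<Rightarrow>
     (if c > 0 then (of_int (a + d)) / of_int c + 12 * dedekind_sum (- d) c - 3
      else if c < 0 then (of_int (a + d)) / of_int c + 12 * dedekind_sum d (- c) + 3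
      else if a > 0 then of_int b
      else of_int (- b - 6)))"

text \<open>character chi(gamma, eps (c tau+d)^(1/2)) of the eta-quotient\<close>
definition eta_char :: "(nat \<Rightarrow> int) \<Rightarrow> nat \<Rightarrow> mat2 \<Rightarrow> int \<Rightarrow> complex" where
  "eta_char r N \<gamma> \<epsilon> = (case \<gamma> of (a, b, c, d) \<Rightarrow>
     of_int \<epsilon> powi (- wt2 r N) *
     ee (of_real ((1 / 24) * (\<Sum>n\<in>{n. n dvd N}.
            of_int (r n) * Psi (a, b * int n, c div int n, d)))))"

definition qexp_nonneg :: "(complex \<Rightarrow> complex) \<Rightarrow> bool" where
  "qexp_nonneg g \<longleftrightarrow> (\<exists>h::real. \<exists>\<kappa>::real. \<exists>c::nat \<Rightarrow> complex. h > 0 \<and> \<kappa> \<ge> 0 \<and>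
      (\<forall>\<tau>\<in>upper. (\<lambda>n. c n * ee (of_real ((of_nat n + \<kappa>) / h) * \<tau>)) sums g \<tau>))"

definition qexp_pos :: "(complex \<Rightarrow> complex) \<Rightarrow> bool" where
  "qexp_pos g \<longleftrightarrow> (\<exists>h::real. \<exists>\<kappa>::real. \<exists>c::nat \<Rightarrow> complex. h > 0 \<and> \<kappa> \<ge> 0 \<and>
      (\<forall>n. c n \<noteq> 0 \<longrightarrow> of_nat n + \<kappa> > 0) \<and>
      (\<forall>\<tau>\<in>upper. (\<lambda>n. c n * ee (of_real ((of_nat n + \<kappa>) / h) * \<tau>)) sums g \<tau>))"

text \<open>Functions are normalised to vanish off the upper half plane so that the spaces
  are genuine spaces of functions on H.\<close>
definition on_upper :: "(complex \<Rightarrow> complex) \<Rightarrow> complex \<Rightarrow> complex" where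
  "on_upper g \<tau> = (if \<tau> \<in> upper then g \<tau> else 0)"

definition modular_invariant :: "int \<Rightarrow> nat \<Rightarrow> (mat2 \<Rightarrow> int \<Rightarrow> complex) \<Rightarrow> (complex \<Rightarrow> complex) \<Rightarrow> bool" where
  "modular_invariant w N chi g \<longleftrightarrow> g holomorphic_on upper \<and> (\<forall>\<tau>. \<tau> \<notin> upper \<longrightarrow> g \<tau> = 0) \<and>
     (\<forall>\<gamma>\<in>Gamma0 N. \<forall>\<epsilon>\<in>{1, -1}. \<forall>\<tau>\<in>upper. slash w \<gamma> \<epsilon> g \<tau> = chi \<gamma> \<epsilon> * g \<tau>)"

definition Mk :: "int \<Rightarrow> nat \<Rightarrow> (mat2 \<Rightarrow> int \<Rightarrow> complex) \<Rightarrow> (complex \<Rightarrow> complex) set" where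
  "Mk w N chi = {g. modular_invariant w N chi g \<and> (\<forall>\<sigma>\<in>Gamma0 1. qexp_nonneg (slash w \<sigma> 1 g))}"

definition Sk :: "int \<Rightarrow> nat \<Rightarrow> (mat2 \<Rightarrow> int \<Rightarrow> complex) \<Rightarrow> (complex \<Rightarrow> complex) set" where
  "Sk w N chi = {g. modular_invariant w N chi g \<and> (\<forall>\<sigma>\<in>Gamma0 1. qexp_pos (slash w \<sigma> 1 g))}"

definition cdim :: "(complex \<Rightarrow> complex) set \<Rightarrow> nat" where
  "cdim V = vector_space.dim (\<lambda>c (f :: complex \<Rightarrow> complex) x. c * f x) V"

definition weakly_admissible :: "(nat \<Rightarrow> int) \<Rightarrow> nat \<Rightarrow> bool" where
  "weakly_admissible r N \<longleftrightarrow>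
     (let w = wt2 r N; chi = eta_char r N; f = on_upper (eta_quotient r N) in
       f \<in> Mk w N chi \<and>
       (cdim (Mk w N chi) = 1 \<or>
        (cdim (Mk w N chi) \<ge> 2 \<and> cdim (Sk w N chi) = 1 \<and> f \<in> Sk w N chi)))"

definition m_f :: "(nat \<Rightarrow> int) \<Rightarrow> nat \<Rightarrow> int" where
  "m_f r N = 24 div gcd 24 (gcd (\<Sum>n\<in>{n. n dvd N}. int (N div n) * r n)
                                 (\<Sum>n\<in>{n. n dvd N}. int n * r n))"

definition L_f :: "(nat \<Rightarrow> int) \<Rightarrow> nat \<Rightarrow> nat set" where
  "L_f r N = {l. l \<ge> 1 \<and> [int l = 1] (mod m_f r N) \<and>
                (odd (wt2 r N) \<longrightarrow> (\<exists>t. l = t ^ 2))}"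

definition kronecker_prime :: "int \<Rightarrow> nat \<Rightarrow> int" where
  "kronecker_prime a p = (if p = 2 then
        (if even a then 0 else if a mod 8 \<in> {1, 7} then 1 else -1)
      else Legendre a (int p))"

definition kronecker :: "int \<Rightarrow> nat \<Rightarrow> int" where
  "kronecker a n = (\<Prod>p\<in>prime_factors n. kronecker_prime a p ^ multiplicity p n)"

definition rad :: "nat \<Rightarrow> nat" where
  "rad n = \<Prod>(prime_factors n)"

definition varpi :: "(nat \<Rightarrow> int) \<Rightarrow> nat \<Rightarrow> nat" where
  "varpi r N = (\<Prod>n\<in>{n. n dvd N}. (N div n) ^ nat \<bar>r n\<bar>)"

definition delta_of :: "nat \<Rightarrow> nat" where
  "delta_of v = (if (v div 2 ^ multiplicity 2 v) mod 4 = 1 then 0 else 1)"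

end

theory Submission
  imports Defs "HOL-Complex_Analysis.Complex_Analysis"
begin

text \<open>
  The condition \<open>\<Sum> n r\<^sub>n = 0\<close> gives \<open>f = 1 - r\<^sub>1 q + \<dots>\<close>, so \<open>f\<close> is not a cusp form and weak admissibility forces
  \<open>M\<^sub>k(\<Gamma>\<^sub>0(N), \<chi>)\<close> to be the line spanned by \<open>f\<close>. Hence \<open>f\<close> is an eigenfunction of every Hecke operator that
  preserves this space, and comparing the coefficients of \<open>1\<close> and \<open>q\<close> in
  \<open>T\<^sub>l f = l\<^sup>-\<^sup>1 \<Sum> \<psi>(a) a\<^sup>k f((a\<tau> + b)/d)\<close>, summed over \<open>ad = l\<close>, \<open>(a, N) = 1\<close>, \<open>b mod d\<close>, yields the formula.

  That \<open>T\<^sub>l\<close> preserves \<open>\<chi>\<close> requires \<open>\<chi>\<close> explicitly. Dedekind reciprocity turns \<open>\<Psi>\<close> into \<open>(b - c)/d + 12 s(c, d)\<close>,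
  and \<open>12 d s(c, d)\<close> is known modulo 3 and, through the Jacobi symbol, modulo 8; this evaluates \<open>\<chi>\<close> at all
  matrices with \<open>c > 0\<close> and \<open>d > 0\<close> prime to 6. It suffices to treat these, because \<open>T\<^sub>l f / f\<close> is a function of weight 0 and the
  matrices in question generate \<open>\<Gamma>\<^sub>0(N)\<close> together with the translations.
\<close>

section \<open>Dedekind sums\<close>

text \<open>The Hecke operator is studied through
  \<open>\<beta> \<gamma> = \<gamma>' \<beta>'\<close>, where \<open>\<beta>\<close> and
  \<open>\<beta>'\<close> are upper triangular of determinant \<open>l\<close>, and
  \<open>\<psi>\<close> is the weight that turns \<open>\<psi>(a) \<chi>(\<gamma>')\<close> into
  \<open>\<chi>(\<gamma>) \<psi>(a')\<close>. Since \<open>f\<close> has period 1, \<open>b'\<close>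
  may be changed by multiples of \<open>d'\<close>; it is made divisible by a modulus prime to
  \<open>l\<close>, after which the values of \<open>\<chi>\<close> at \<open>\<gamma>\<close> and
  \<open>\<gamma>'\<close> can be compared.

  The obstacle is the prime 2. For odd \<open>l\<close> the modulus may contain 8. For even
  \<open>l\<close> it may not, but then \<open>N\<close> and \<open>\<varpi>\<close> are odd, and
  \<open>l \<equiv> 1\<close> modulo \<open>m_f\<close> forces \<open>k + \<delta>\<close> to be
  even, so that the phase modulo 4 is trivial. This is the origin of the two cases of the formula.

  In half-integral weight \<open>l\<close> is a square and the hypothesis on \<open>p^2\<close>
  leaves only \<open>a = 1\<close>. The Jacobi symbol of \<open>c\<close> over \<open>D\<close> then
  survives in \<open>\<chi>\<close>; it is compared by quadratic reciprocity, which asks for odd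
  \<open>c\<close> as well. The multiplier of \<open>f\<close> itself is read off from
  \<open>f \<in> M_k\<close>.\<close>

definition ds12 :: "int \<Rightarrow> int \<Rightarrow> int" where
  "ds12 h k = 2 * h * (k - 1) * (2 * k - 1) - 12 * (\<Sum>r\<in>{1..k-1}. r * (h * r div k)) - 3 * k * (k - 1)"

lemma sum_atLeastAtMost_int:
  fixes k :: int
  assumes "k > 0"
  shows "2 * (\<Sum>r\<in>{1..k-1}. r) = k * (k - 1)"
    and "6 * (\<Sum>r\<in>{1..k-1}. r * r) = (k - 1) * k * (2 * k - 1)"
proof -
  have "2 * (\<Sum>r\<in>{1..k-1}. r) = k * (k - 1) \<and>
        6 * (\<Sum>r\<in>{1..k-1}. r * r) = (k - 1) * k * (2 * k - 1)"
    using assms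
  proof (induction k rule: int_gr_induct)
    case base
    show ?case by simp
  next
    case (step i)
    have "{1..i + 1 - 1} = insert i {1..i-1}" using step(1) by auto
    with step(2) show ?case by (simp add: algebra_simps)
  qed
  then show "2 * (\<Sum>r\<in>{1..k-1}. r) = k * (k - 1)"
    and "6 * (\<Sum>r\<in>{1..k-1}. r * r) = (k - 1) * k * (2 * k - 1)" by auto
qed

lemma not_dvd_mult_interval:
  fixes h k r :: int
  assumes "coprime h k" "r \<in> {1..k-1}"
  shows "\<not> k dvd h * r"
proof
  assume "k dvd h * r"
  then have "k dvd r" using assms(1) by (simp add: coprime_commute coprime_dvd_mult_right_iff)
  with assms(2) show False by (auto dest: zdvd_imp_le)
qed

lemma bij_betw_reflect_interval: "bij_betw (\<lambda>r. k - r) {1..k-1} {1..k-(1::int)}"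
  by (rule bij_betwI[where g = "\<lambda>r. k - r"]) auto

text \<open>The reflection \<open>r \<mapsto> k - r\<close> pairs floors with sum
  \<open>h - 1\<close>, since \<open>k\<close> never divides \<open>h r\<close> in this
  range.\<close>

lemma sum_div_interval:
  fixes h k :: int
  assumes "coprime h k" "k > 0"
  shows "2 * (\<Sum>r\<in>{1..k-1}. h * r div k) = (h - 1) * (k - 1)"
proof -
  have "h * (k - r) div k = h - 1 - h * r div k" if "r \<in> {1..k-1}" for r
  proof -
    have nd: "\<not> k dvd h * r" using not_dvd_mult_interval[OF assms(1) that] .
    have "h * (k - r) = - (h * r) + h * k" by (simp add: algebra_simps)
    then have "h * (k - r) div k = (- (h * r)) div k + h" 
      using assms(2) by (simp only: div_mult_self1)
    also have "(- (h * r)) div k = - (h * r div k) - 1"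
      using nd assms(2) by (simp add: zdiv_zminus1_eq_if dvd_eq_mod_eq_0)
    finally show ?thesis by simp
  qed
  then have "(\<Sum>r\<in>{1..k-1}. h * (k - r) div k) = (\<Sum>r\<in>{1..k-1}. h - 1 - h * r div k)"
    by (intro sum.cong) auto
  moreover have "(\<Sum>r\<in>{1..k-1}. h * (k - r) div k) = (\<Sum>r\<in>{1..k-1}. h * r div k)"
    by (rule sum.reindex_bij_betw[OF bij_betw_reflect_interval])
  ultimately show ?thesis using assms(2) by (simp only: sum_subtractf) (simp add: algebra_simps)
qed

text \<open>Away from multiples of \<open>k\<close> each sawtooth value is linear in
  \<open>r\<close> apart from a floor. Hence \<open>12 k s(h, k)\<close> is an integer whose only
  part without a closed form is the sum of \<open>r (h r div k)\<close>. This integer carries the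
  congruences modulo 3 and 8.\<close>

lemma dedekind_sum_ds12:
  assumes "coprime h k" "k > 0"
  shows "12 * of_int k * dedekind_sum h k = of_int (ds12 h k)"
proof -
  have s1: "sawtooth (of_int r / of_int k) = of_int r / of_int k - 1/2" if "r \<in> {1..k-1}" for r
  proof -
    have "\<not> k dvd r" using that by (auto dest: zdvd_imp_le)
    then have "of_int r / of_int k \<notin> (\<int> :: real set)"
      using assms(2) by (simp add: of_int_div_of_int_in_Ints_iff)
    moreover have "\<lfloor>of_int r / of_int k :: real\<rfloor> = 0"
      using that by (simp add: floor_divide_of_int_eq)
    ultimately show ?thesis by (simp add: sawtooth_def)
  qed
  have s2: "sawtooth (of_int (h * r) / of_int k) = of_int (h * r) / of_int k - of_int (h * r div k) - 1/2"
    if "r \<in> {1..k-1}" for r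
  proof -
    have "of_int (h * r) / of_int k \<notin> (\<int> :: real set)"
      using assms(2) not_dvd_mult_interval[OF assms(1) that]
      by (subst of_int_div_of_int_in_Ints_iff) auto
    then show ?thesis by (simp add: sawtooth_def floor_divide_of_int_eq del: of_int_mult)
  qed
  let ?I = "{1..k-1}"
  define A B C D :: real where
    "A = of_int (\<Sum>r\<in>?I. r * (h * r div k))" and "B = of_int (\<Sum>r\<in>?I. h * r div k)" and
    "C = of_int (\<Sum>r\<in>?I. r)" and "D = of_int (\<Sum>r\<in>?I. r * r)"
  define K where "K = real_of_int k"
  have K: "K > 0" using assms(2) by (simp add: K_def)
  have card: "real (nat (k - 1)) = K - 1" using assms(2) by (simp add: K_def)
  have "K\<^sup>2 * dedekind_sum h k = (\<Sum>r\<in>?I. of_int h * of_int (r*r) - K * of_int (r * (h * r div k))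
        - (K * (1 + of_int h) / 2) * of_int r + K\<^sup>2 / 2 * of_int (h * r div k) + K\<^sup>2 / 4)"
    unfolding dedekind_sum_def sum_distrib_left
    by (intro sum.cong refl, subst s1, assumption, subst s2, assumption)
       (use K in \<open>simp add: K_def field_simps power2_eq_square\<close>)
  also have "\<dots> = of_int h * D - K * A - (K * (1 + of_int h) / 2) * C + K\<^sup>2 / 2 * B + (K - 1) * K\<^sup>2 / 4"
    by (simp only: sum.distrib sum_subtractf sum_distrib_left[symmetric] of_int_sum A_def B_def C_def D_def)
       (simp add: card)
  finally have eq: "K\<^sup>2 * dedekind_sum h k = of_int h * D - K * A - (K * (1 + of_int h) / 2) * C + K\<^sup>2 / 2 * B + (K - 1) * K\<^sup>2 / 4" .
  have C: "C = K * (K - 1) / 2" and D: "D = (K - 1) * K * (2 * K - 1) / 6"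
    using sum_atLeastAtMost_int[OF assms(2), THEN arg_cong[where f = real_of_int]]
    by (simp_all add: C_def D_def K_def field_simps)
  have B: "B = (of_int h - 1) * (K - 1) / 2"
    using sum_div_interval[OF assms, THEN arg_cong[where f = real_of_int]]
    by (simp add: B_def K_def field_simps)
  have "K * (12 * K * dedekind_sum h k) = K * (2 * of_int h * (K - 1) * (2 * K - 1) - 12 * A - 3 * K * (K - 1))"
    using eq unfolding B C D by (simp add: field_simps power2_eq_square)
  then have "12 * K * dedekind_sum h k = 2 * of_int h * (K - 1) * (2 * K - 1) - 12 * A - 3 * K * (K - 1)"
    using K by simp
  then show ?thesis unfolding ds12_def A_def K_def by simp
qed

lemma le_div_iff_mult_le_int:
  fixes k :: int
  assumes "k > 0"
  shows "v \<le> x div k \<longleftrightarrow> v * k \<le> x"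
proof
  assume "v \<le> x div k"
  then have "v * k \<le> (x div k) * k" using assms by simp
  also have "\<dots> \<le> x" using assms by (metis div_mult_mod_eq le_add_same_cancel1 pos_mod_sign)
  finally show "v * k \<le> x" .
next
  assume "v * k \<le> x"
  then have "v * k div k \<le> x div k" using assms by (rule zdiv_mono1)
  then show "v \<le> x div k" using assms by simp
qed

lemma div_less_iff_less_mult_int:
  fixes k :: int
  assumes "k > 0"
  shows "x div k < v \<longleftrightarrow> x < v * k"
  using le_div_iff_mult_le_int[OF assms, of v x] by linarith

text \<open>Both sides add up the heights \<open>v\<close> of the lattice points below a line of
  slope \<open>h / k\<close>, once by columns \<open>r\<close> and once by rows \<open>v\<close>.
  Coprimality keeps lattice points off the line itself.\<close>

lemma double_count_floor:
  fixes h k :: int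
  assumes "coprime h k" "h > 0" "k > 0"
  shows "(\<Sum>r\<in>{1..k-1}. \<Sum>v\<in>{1..h * r div k}. v) = (\<Sum>v\<in>{1..h-1}. v * (k - 1 - k * v div h))"
proof -
  have le: "h * r div k \<le> h - 1" if "r \<in> {1..k-1}" for r
  proof -
    have "h * r < h * k" using that assms by simp
    then have "h * r div k < h" using assms by (simp add: div_less_iff_less_mult_int)
    then show ?thesis by simp
  qed
  have "(\<Sum>r\<in>{1..k-1}. \<Sum>v\<in>{1..h * r div k}. v) = (\<Sum>r\<in>{1..k-1}. \<Sum>v\<in>{1..h-1}. if v \<le> h * r div k then v else 0)"
  proof (rule sum.cong[OF refl])
    fix r assume r: "r \<in> {1..k-1}"
    have "{1..h * r div k} = {v \<in> {1..h-1}. v \<le> h * r div k}" using le[OF r] by auto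
    then show "(\<Sum>v\<in>{1..h * r div k}. v) = (\<Sum>v\<in>{1..h-1}. if v \<le> h * r div k then v else 0)"
      by (simp only: sum.inter_filter finite_atLeastAtMost_int)
  qed
  also have "\<dots> = (\<Sum>v\<in>{1..h-1}. \<Sum>r\<in>{1..k-1}. if v \<le> h * r div k then v else 0)"
    by (rule sum.swap)
  also have "\<dots> = (\<Sum>v\<in>{1..h-1}. v * (k - 1 - k * v div h))"
  proof (rule sum.cong[OF refl])
    fix v assume v: "v \<in> {1..h-1}"
    have nd: "\<not> h dvd k * v" using not_dvd_mult_interval[of k h v] assms v by (simp add: coprime_commute)
    have "(v \<le> h * r div k) = (k * v div h < r)" if "r \<in> {1..k-1}" for r
    proof -
      have "(v \<le> h * r div k) = (k * v \<le> h * r)" using assms by (simp add: le_div_iff_mult_le_int mult.commute)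
      also have "\<dots> = (k * v < r * h)" using nd by (metis dvd_triv_left mult.commute order_le_less)
      also have "\<dots> = (k * v div h < r)" using assms by (simp add: div_less_iff_less_mult_int)
      finally show ?thesis .
    qed
    then have "{r \<in> {1..k-1}. v \<le> h * r div k} = {r \<in> {1..k-1}. k * v div h < r}" by auto
    also have "\<dots> = {k * v div h + 1..k-1}"
    proof -
      have "0 \<le> k * v div h" using assms v by (simp add: pos_imp_zdiv_nonneg_iff)
      then show ?thesis by auto
    qed
    finally have *: "{r \<in> {1..k-1}. v \<le> h * r div k} = {k * v div h + 1..k-1}" .
    have "k * v < k * h" using v assms by simp
    then have "k * v div h < k" using assms by (simp add: div_less_iff_less_mult_int)
    moreover have "(\<Sum>r\<in>{1..k-1}. if v \<le> h * r div k then v else 0) = (\<Sum>r\<in>{k * v div h + 1..k-1}. v)"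
      unfolding *[symmetric] by (rule sum.inter_filter[symmetric]) simp
    ultimately show "(\<Sum>r\<in>{1..k-1}. if v \<le> h * r div k then v else 0) = v * (k - 1 - k * v div h)"
      by simp
  qed
  finally show ?thesis .
qed

text \<open>Dedekind reciprocity, multiplied by \<open>12 h k\<close>. The sum \<open>Q2\<close> of
  squared floors is evaluated twice: through \<open>A\<close>, because multiplication by
  \<open>h\<close> permutes the nonzero residues modulo \<open>k\<close>, and through
  \<open>B\<close>, by counting lattice points.\<close>

lemma ds12_reciprocity:
  assumes "coprime h k" "h > 0" "k > 0"
  shows "h * ds12 h k + k * ds12 k h = h\<^sup>2 + k\<^sup>2 + 1 - 3 * h * k"
proof -
  let ?q = "\<lambda>r. h * r div k" and ?q' = "\<lambda>v. k * v div h"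
  define A B Q Q2 R2 S :: int where
    "A = (\<Sum>r\<in>{1..k-1}. r * ?q r)" and "B = (\<Sum>v\<in>{1..h-1}. v * ?q' v)" and
    "Q = (\<Sum>r\<in>{1..k-1}. ?q r)" and "Q2 = (\<Sum>r\<in>{1..k-1}. ?q r * ?q r)" and
    "R2 = (\<Sum>r\<in>{1..k-1}. r * r)" and "S = (\<Sum>v\<in>{1..h-1}. v)"
  have "bij_betw (\<lambda>r. h * r mod k) {1..k-1} {1..k-1}"
  proof -
    have "inj_on (\<lambda>r. h * r mod k) {1..k-1}"
    proof (rule inj_onI)
      fix x y assume xy: "x \<in> {1..k-1}" "y \<in> {1..k-1}" "h * x mod k = h * y mod k"
      then have "[x = y] (mod k)" using assms(1) by (auto simp: cong_def[symmetric] cong_mult_lcancel)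
      then show "x = y" using xy by (auto simp: cong_def)
    qed
    moreover have "(\<lambda>r. h * r mod k) ` {1..k-1} \<subseteq> {1..k-1}"
    proof safe
      fix r assume r: "r \<in> {1..k-1}"
      have "h * r mod k \<noteq> 0" using not_dvd_mult_interval[OF assms(1) r] by (simp add: dvd_eq_mod_eq_0)
      moreover have "0 \<le> h * r mod k" "h * r mod k < k" using assms by auto
      ultimately show "h * r mod k \<in> {1..k-1}" by simp
    qed
    ultimately show ?thesis by (simp add: bij_betw_def endo_inj_surj)
  qed
  from sum.reindex_bij_betw[OF this, of "\<lambda>r. r * r"]
  have "R2 = (\<Sum>r\<in>{1..k-1}. (h * r mod k) * (h * r mod k))" by (simp add: R2_def)
  also have "\<dots> = (\<Sum>r\<in>{1..k-1}. h * h * (r * r) - 2 * h * k * (r * ?q r) + k * k * (?q r * ?q r))"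
    by (intro sum.cong refl) (simp add: minus_div_mult_eq_mod[symmetric] algebra_simps)
  also have "\<dots> = h * h * R2 - 2 * h * k * A + k * k * Q2"
    by (simp only: A_def Q2_def R2_def sum.distrib sum_subtractf sum_distrib_left)
  finally have e1: "R2 = h * h * R2 - 2 * h * k * A + k * k * Q2" .
  have tri: "2 * (\<Sum>v\<in>{1..m}. v) = m * m + m" if "m \<ge> 0" for m :: int
    using sum_atLeastAtMost_int(1)[of "m + 1"] that by (simp add: algebra_simps)
  \<comment> \<open>\<open>q^2 + q\<close> is twice the sum of the heights \<open>1, ..., q\<close>,
    so the squares become a height-weighted count of lattice points.\<close>
  have "Q2 + Q = (\<Sum>r\<in>{1..k-1}. 2 * (\<Sum>v\<in>{1..?q r}. v))"
    unfolding Q2_def Q_def sum.distrib[symmetric]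
    using assms by (intro sum.cong refl) (subst tri, auto simp: pos_imp_zdiv_nonneg_iff)
  also have "\<dots> = 2 * (\<Sum>v\<in>{1..h-1}. v * (k - 1 - ?q' v))"
    using double_count_floor[OF assms] by (simp add: sum_distrib_left[symmetric])
  also have "(\<Sum>v\<in>{1..h-1}. v * (k - 1 - ?q' v)) = (\<Sum>v\<in>{1..h-1}. (k - 1) * v - v * ?q' v)"
    by (intro sum.cong refl) (simp add: algebra_simps)
  also have "\<dots> = (k - 1) * S - B" by (simp only: S_def B_def sum_subtractf sum_distrib_left)
  finally have e2: "Q2 + Q = 2 * ((k - 1) * S - B)" .
  have Q: "2 * Q = (h - 1) * (k - 1)" using sum_div_interval assms by (simp add: Q_def)
  have S: "2 * S = h * (h - 1)" using sum_atLeastAtMost_int(1) assms by (simp add: S_def)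
  have R2: "6 * R2 = (k - 1) * k * (2 * k - 1)" using sum_atLeastAtMost_int(2) assms by (simp add: R2_def)
  have "k * (h * ds12 h k + k * ds12 k h) = k * (h\<^sup>2 + k\<^sup>2 + 1 - 3 * h * k)"
  proof -
    have eA: "12 * h * k * A = (h * h - 1) * (6 * R2) + k * k * (6 * Q2)"
      using e1 by (simp add: algebra_simps)
    have eQ: "6 * Q2 = 6 * (k - 1) * (2 * S) - 12 * B - 3 * (2 * Q)"
      using e2 by (simp add: algebra_simps)
    have *: "12 * h * k * A + 12 * k * k * B =
        (h * h - 1) * ((k - 1) * k * (2 * k - 1)) + k * k * (6 * (k - 1) * (h * (h - 1)) - 3 * ((h - 1) * (k - 1)))"
      unfolding eA eQ Q S R2 by (simp add: algebra_simps)
    have "k * (h * ds12 h k + k * ds12 k h) = k * (h * (2 * h * (k - 1) * (2 * k - 1) - 3 * k * (k - 1)) +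
        k * (2 * k * (h - 1) * (2 * h - 1) - 3 * h * (h - 1))) - (12 * h * k * A + 12 * k * k * B)"
      unfolding ds12_def A_def[symmetric] B_def[symmetric] by (simp add: algebra_simps)
    then show ?thesis unfolding * by (simp add: algebra_simps power2_eq_square)
  qed
  then show ?thesis using assms by simp
qed

lemma ds12_mod_3:
  assumes "\<not> 3 dvd k"
  shows "3 dvd ds12 h k"
proof -
  have "3 dvd (k - 1) * (2 * k - 1)"
  proof -
    have "k mod 3 = 1 \<or> k mod 3 = 2" using assms by presburger
    then have "3 dvd k - 1 \<or> 3 dvd 2 * k - 1" by presburger
    then show ?thesis by auto
  qed
  then have "3 dvd 2 * h * ((k - 1) * (2 * k - 1))" by (rule dvd_mult)
  then show ?thesis unfolding ds12_def by (intro dvd_diff) (auto simp: mult.assoc)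
qed

section \<open>The Jacobi symbol\<close>

text \<open>By Eisenstein's form of Gauss' lemma this is the Jacobi symbol of \<open>h\<close> over the odd number \<open>k\<close>.\<close>
definition jsign :: "int \<Rightarrow> int \<Rightarrow> int" where
  "jsign h k = (\<Prod>r\<in>{r\<in>{1..k-1}. even r}. (-1) ^ nat (h * r mod k))"

lemma jsign_values: "jsign h k = 1 \<or> jsign h k = -1"
proof -
  have "\<bar>jsign h k\<bar> = 1" unfolding jsign_def abs_prod by (simp add: power_abs)
  then show ?thesis by linarith
qed

lemma jsign_cong: "[h = h'] (mod k) \<Longrightarrow> jsign h k = jsign h' k"
  unfolding jsign_def by (metis (no_types, lifting) cong_def mod_mult_left_eq)

lemma jsign_1: "jsign 1 k = 1"
  unfolding jsign_def by (intro prod.neutral ballI) (auto simp: even_nat_iff)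

text \<open>The floor sum has coefficient 12, so only its parity matters, and only odd
  \<open>r\<close> contribute to that. The floors at even \<open>r\<close> add up to
  \<open>U\<close>, whose parity is recorded by \<open>jsign\<close>; the floors at odd
  \<open>r\<close> then follow from the total in \<open>sum_div_interval\<close>.\<close>

lemma ds12_mod_8:
  assumes "coprime h k" "k > 0" "odd k"
  shows "[ds12 h k = k + 1 - 2 * jsign h k] (mod 8)"
proof -
  let ?q = "\<lambda>r. h * r div k"
  let ?E = "{r\<in>{1..k-1}. even r}" and ?O = "{r\<in>{1..k-1}. odd r}"
  define U where "U = (\<Sum>r\<in>?E. ?q r)"
  define W where "W = (\<Sum>r\<in>?O. ?q r)"
  have split: "sum g {1..k-1} = sum g ?E + sum g ?O" for g :: "int \<Rightarrow> int"
  proof -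
    have "finite ?E" "finite ?O" by (rule finite_subset[of _ "{1..k-1}"], auto)+
    then show ?thesis by (subst sum.union_disjoint[symmetric]) (auto intro!: sum.cong)
  qed
  \<comment> \<open>For even \<open>r\<close> the number \<open>h r\<close> is even, and
    \<open>k\<close> is odd, so quotient and remainder of \<open>h r\<close> by \<open>k\<close>
    have equal parity.\<close>
  have "jsign h k = (\<Prod>r\<in>?E. if even (?q r) then 1 else -1)"
    unfolding jsign_def
  proof (rule prod.cong[OF refl])
    fix r assume r: "r \<in> ?E"
    have nn: "h * r mod k \<ge> 0" using assms by simp
    have "even (h * r)" using r by simp
    then have "even (h * r div k * k + h * r mod k)" by (simp only: div_mult_mod_eq)
    then have "even (h * r mod k) = even (?q r)" using assms(3) by (simp only: even_add even_mult_iff) simp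
    then show "(-1) ^ nat (h * r mod k) = (if even (?q r) then 1 else - 1 :: int)"
      using nn by (auto simp: even_nat_iff)
  qed
  also have "\<dots> = (if even U then 1 else -1)"
  proof -
    have "(\<Prod>r\<in>X. if even (?q r) then 1 else -1 :: int) = (if even (\<Sum>r\<in>X. ?q r) then 1 else -1)" if "finite X" for X
      using that by (induction X) auto
    moreover have "finite ?E" by (rule finite_subset[of _ "{1..k-1}"]) auto
    ultimately show ?thesis unfolding U_def .
  qed
  finally have J: "jsign h k = (if even U then 1 else -1)" .
  have UW: "2 * (U + W) = (h - 1) * (k - 1)"
    using sum_div_interval[OF assms(1,2)] split[of ?q] by (simp add: U_def W_def)
  have A: "[(\<Sum>r\<in>{1..k-1}. r * ?q r) = W] (mod 2)"
  proof -
    have "even (\<Sum>r\<in>?E. r * ?q r)" by (intro dvd_sum) auto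
    moreover have "even ((\<Sum>r\<in>?O. r * ?q r) - W)"
      unfolding W_def sum_subtractf[symmetric] by (intro dvd_sum) auto
    ultimately show ?thesis unfolding split cong_iff_dvd_diff by presburger
  qed
  then obtain x where x: "(\<Sum>r\<in>{1..k-1}. r * ?q r) = W + 2 * x"
    by (metis cong_iff_lin cong_sym)
  obtain j where j: "k = 2 * j + 1" using assms(3) by (elim oddE)
  have W: "W = (h - 1) * j - U" using UW j by simp
  have par: "even (j * j + j)" by simp
  then obtain y where y: "j * j = 2 * y - j" by (metis add_diff_cancel_right' dvdE)
  have "ds12 h k = 2 * h * (2*j) * (4 * j + 1) - 12 * ((h - 1) * j - U + 2 * x) - 3 * (2 * j + 1) * (2 * j)"
    unfolding ds12_def x W unfolding j by (simp add: algebra_simps)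
  also have "\<dots> = 16 * h * (j * j) + 4 * h * j - 12 * h * j + 12 * j + 12 * U - 24 * x - 12 * (j * j) - 6 * j"
    by (simp add: algebra_simps)
  also have "\<dots> = 8 * (4 * h * y - 2 * h * j - h * j - 3 * x - 3 * y + 2 * j + U) + 2 * j + 4 * U"
    unfolding y by (simp add: algebra_simps)
  finally have "[ds12 h k = 2 * j + 4 * U] (mod 8)"
    by (simp add: cong_iff_dvd_diff)
  moreover have "[2 * j + 4 * U = k + 1 - 2 * jsign h k] (mod 8)"
    unfolding J unfolding j cong_iff_dvd_diff by (auto elim!: evenE oddE simp: algebra_simps)
  ultimately show ?thesis by (rule cong_trans)
qed

text \<open>Eisenstein's permutation of the even residues. As \<open>k\<close> is odd, exactly one
  of \<open>g r\<close> and \<open>- g r\<close> has an even remainder unless \<open>k\<close>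
  divides \<open>g r\<close>; the sign that leads to it is the factor of \<open>jsign\<close> at
  \<open>r\<close>.\<close>

definition even_rep :: "int \<Rightarrow> int \<Rightarrow> int \<Rightarrow> int" where
  "even_rep g k r = (if even (g * r mod k) then g * r mod k else k - g * r mod k)"

lemma even_rep_cong: "[even_rep g k r = (-1) ^ nat (g * r mod k) * (g * r)] (mod k)" if "k > 0"
proof -
  have "g * r mod k \<ge> 0" using that by simp
  then show ?thesis by (auto simp: even_rep_def cong_def mod_simps even_nat_iff)
qed

lemma finite_even_interval: "finite {r\<in>{1..k-(1::int)}. even r}"
  by (rule finite_subset[of _ "{1..k-1}"]) auto

lemma bij_betw_even_rep:
  assumes "coprime g k" "k > 0" "odd k"
  shows "bij_betw (even_rep g k) {r\<in>{1..k-1}. even r} {r\<in>{1..k-1}. even r}"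
proof -
  let ?E = "{r\<in>{1..k-1}. even r}"
  have \<phi>E: "even_rep g k r \<in> ?E" if "r \<in> ?E" for r
  proof -
    have "g * r mod k \<noteq> 0" using not_dvd_mult_interval[OF assms(1)] that by (auto simp: dvd_eq_mod_eq_0)
    moreover have "0 \<le> g * r mod k" "g * r mod k < k" using assms by auto
    ultimately show ?thesis using assms(3) by (auto simp: even_rep_def)
  qed
  have inj: "inj_on (even_rep g k) ?E"
  proof (rule inj_onI)
    fix x y assume xy: "x \<in> ?E" "y \<in> ?E" "even_rep g k x = even_rep g k y"
    define s t :: int where "s = (-1) ^ nat (g * x mod k)" and "t = (-1) ^ nat (g * y mod k)"
    have st: "s = 1 \<or> s = -1" "t = 1 \<or> t = -1" unfolding s_def t_def by (simp_all add: minus_one_power_iff)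
    have "[s * (g * x) = t * (g * y)] (mod k)"
      using even_rep_cong[OF assms(2), of g x] even_rep_cong[OF assms(2), of g y] xy(3)
      by (metis cong_sym cong_trans s_def t_def)
    then have "[g * (s * x) = g * (t * y)] (mod k)" by (simp add: algebra_simps)
    then have "[s * x = t * y] (mod k)" using assms(1) by (simp add: cong_mult_lcancel)
    then have "k dvd x - y \<or> k dvd x + y"
      using st by (auto simp: cong_iff_dvd_diff dvd_diff_commute) (metis dvd_minus_iff minus_add_distrib uminus_add_conv_diff diff_conv_add_uminus add.commute)+
    then show "x = y"
    proof
      assume "k dvd x - y"
      then have "x mod k = y mod k" by (simp add: mod_eq_dvd_iff)
      then show ?thesis using xy by auto
    next
      \<comment> \<open>An even multiple of the odd number \<open>k\<close> strictly between 0 and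
        \<open>2 k\<close> does not exist.\<close>
      assume "k dvd x + y"
      then obtain t where t: "x + y = k * t" by auto
      have "even (k * t)" using xy t[symmetric] by simp
      then have "even t" using assms(3) by simp
      then obtain s where s: "t = 2 * s" by (elim evenE)
      have "0 < k * t" "k * t < k * 2" using xy unfolding t[symmetric] by auto
      then have "0 < t" "t < 2" using assms(2) by (auto simp: zero_less_mult_iff)
      then show ?thesis using s by presburger
    qed
  qed
  have "even_rep g k ` ?E \<subseteq> ?E" using \<phi>E by blast
  then show ?thesis
    unfolding bij_betw_def using inj endo_inj_surj[OF finite_even_interval] by blast
qed

text \<open>The product for \<open>h\<close> is reindexed by the permutation
  \<open>even_rep g k\<close>. Replacing \<open>g r\<close> by its negative flips the parity of the
  remainder of \<open>h g r\<close>, because \<open>k\<close> is odd, and the sign lost in this way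
  is the factor of \<open>jsign g k\<close>.\<close>

lemma jsign_mult:
  assumes "coprime h k" "coprime g k" "k > 0" "odd k"
  shows "jsign (h * g) k = jsign h k * jsign g k"
proof -
  let ?E = "{r\<in>{1..k-1}. even r}"
  note bij = bij_betw_even_rep[OF assms(2-4)]
  have "(-1) ^ nat (h * g * r mod k) = (-1) ^ nat (h * even_rep g k r mod k) * (-1 :: int) ^ nat (g * r mod k)"
    if r: "r \<in> ?E" for r
  proof -
    have nn: "0 \<le> x mod k" for x using assms by simp
    have nd: "\<not> k dvd h * even_rep g k r"
      using not_dvd_mult_interval[OF assms(1)] bij_betwE[OF bij] r by auto
    show ?thesis
    proof (cases "even (g * r mod k)")
      case True
      then have "h * g * r mod k = h * even_rep g k r mod k"
        by (simp add: even_rep_def mod_mult_right_eq mult.assoc)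
      then show ?thesis using True nn[of "g * r"] by (simp add: even_nat_iff)
    next
      case False
      then have "[h * even_rep g k r = h * (- (g * r))] (mod k)"
        using even_rep_cong[OF assms(3), of g r] nn[of "g * r"] by (intro cong_mult) (auto simp: even_nat_iff)
      then have "[h * g * r = - (h * even_rep g k r)] (mod k)"
        by (metis (no_types, lifting) cong_minus_minus_iff cong_sym minus_mult_right mult.assoc add.inverse_inverse)
      then have "h * g * r mod k = k - h * even_rep g k r mod k"
        using nd by (simp add: cong_def zmod_zminus1_eq_if dvd_eq_mod_eq_0)
      then have "even (h * g * r mod k) = odd (h * even_rep g k r mod k)"
        using assms(4) by simp
      then show ?thesis using False nn[of "g * r"] nn[of "h * g * r"] nn[of "h * even_rep g k r"]
        by (cases "even (h * even_rep g k r mod k)") (auto simp: even_nat_iff)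
    qed
  qed
  then have "jsign (h * g) k = (\<Prod>r\<in>?E. (-1) ^ nat (h * even_rep g k r mod k) * (-1) ^ nat (g * r mod k))"
    unfolding jsign_def by (intro prod.cong) auto
  also have "\<dots> = (\<Prod>r\<in>?E. (-1) ^ nat (h * even_rep g k r mod k)) * jsign g k"
    by (simp only: prod.distrib jsign_def)
  also have "(\<Prod>r\<in>?E. (-1) ^ nat (h * even_rep g k r mod k)) = jsign h k"
    unfolding jsign_def by (rule prod.reindex_bij_betw[OF bij])
  finally show ?thesis .
qed

lemma jsign_power:
  assumes "coprime h k" "k > 0" "odd k"
  shows "jsign (h ^ n) k = jsign h k ^ n"
  using assms by (induction n) (simp_all add: jsign_1 jsign_mult)

lemma jsign_prod:
  assumes "finite X" "\<And>x. x \<in> X \<Longrightarrow> coprime (g x) k" "k > 0" "odd k"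
  shows "jsign (\<Prod>x\<in>X. g x) k = (\<Prod>x\<in>X. jsign (g x) k)"
  using assms(1,2)
proof (induction X)
  case (insert x X)
  then show ?case using assms(3,4) by (simp add: jsign_mult prod_coprime_left)
qed (simp add: jsign_1)

text \<open>The product of all even residues is unchanged by the permutation
  \<open>even_rep h p\<close>. Cancelling it leaves \<open>jsign h p\<close> times
  \<open>h ^ ((p - 1) / 2)\<close> congruent to 1, and Euler's criterion identifies the
  power.\<close>

lemma jsign_Legendre:
  assumes p: "prime p" "odd p" and cp: "coprime h p"
  shows "jsign h p = Legendre h p"
proof -
  let ?E = "{r\<in>{1..p-1}. even r}"
  have p2: "p > 2" using p prime_ge_2_int[of p] by (cases "p = 2") auto
  have card: "card ?E = nat ((p - 1) div 2)"
  proof -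
    have "bij_betw (\<lambda>i. 2 * i) {1..(p-1) div 2} ?E"
    proof (rule bij_betwI[where g = "\<lambda>i. i div 2"])
      show "(*) 2 \<in> {1..(p - 1) div 2} \<rightarrow> ?E" by auto
      show "(\<lambda>i. i div 2) \<in> ?E \<rightarrow> {1..(p - 1) div 2}" using p2 by (auto elim!: evenE)
      show "2 * i div 2 = i" for i :: int by simp
      show "2 * (i div 2) = i" if "i \<in> ?E" for i using that by simp
    qed
    from bij_betw_same_card[OF this] show ?thesis by simp
  qed
  have e1: "(\<Prod>r\<in>?E. even_rep h p r) = \<Prod>?E"
    by (rule prod.reindex_bij_betw[OF bij_betw_even_rep[OF cp _ p(2)]]) (use p2 in simp)
  have e2: "[(\<Prod>r\<in>?E. even_rep h p r) = (\<Prod>r\<in>?E. (-1) ^ nat (h * r mod p) * (h * r))] (mod p)"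
    by (intro cong_prod even_rep_cong) (use p2 in simp)
  have e3: "(\<Prod>r\<in>?E. (-1) ^ nat (h * r mod p) * (h * r)) = jsign h p * h ^ card ?E * \<Prod>?E"
    unfolding prod.distrib jsign_def prod_constant by (simp only: mult.assoc)
  have "[1 * \<Prod>?E = jsign h p * h ^ card ?E * \<Prod>?E] (mod p)"
    using e2 unfolding e1 e3 by (simp only: mult_1)
  moreover have "coprime (\<Prod>?E) p"
  proof (rule prod_coprime_left)
    fix r assume "r \<in> ?E"
    then have "\<not> p dvd r" by (auto dest: zdvd_imp_le)
    then show "coprime r p" using p by (metis coprime_commute prime_imp_coprime)
  qed
  ultimately have "[1 = jsign h p * h ^ card ?E] (mod p)" by (simp only: cong_mult_rcancel)
  moreover have "[Legendre h p = h ^ card ?E] (mod p)"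
  proof -
    have "card ?E = (nat p - 1) div 2" using card p2 by (simp add: nat_div_distrib nat_diff_distrib)
    moreover have "[Legendre h (int (nat p)) = h ^ ((nat p - 1) div 2)] (mod (int (nat p)))"
    proof (rule euler_criterion)
      show "prime (nat p)" by (metis p(1) prime_int_nat_transfer)
      show "2 < nat p" using p2 by linarith
    qed
    ultimately show ?thesis using p2 by simp
  qed
  ultimately have "[1 = jsign h p * Legendre h p] (mod p)"
    by (metis cong_scalar_left cong_sym cong_trans)
  moreover have "Legendre h p = 1 \<or> Legendre h p = -1"
  proof -
    have "\<not> [h = 0] (mod p)" using cp p by (metis cong_0_iff coprime_absorb_right coprime_commute not_prime_unit)
    then show ?thesis by (auto simp: Legendre_def)
  qed
  ultimately show ?thesis using jsign_values[of h p] p2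
    by (auto simp: cong_iff_dvd_diff dest: zdvd_imp_le)
qed

text \<open>Quadratic reciprocity is Dedekind reciprocity read modulo 8, with both values of
  \<open>ds12\<close> replaced by the right-hand side of \<open>ds12_mod_8\<close>.\<close>

lemma jsign_reciprocity:
  assumes "coprime h k" "h > 0" "k > 0" "odd h" "odd k"
  shows "jsign h k = jsign k h * (if h mod 4 = 3 \<and> k mod 4 = 3 then -1 else 1)"
proof -
  have k: "[ds12 h k = k + 1 - 2 * jsign h k] (mod 8)"
    using assms by (intro ds12_mod_8)
  have h: "[ds12 k h = h + 1 - 2 * jsign k h] (mod 8)"
    using assms by (intro ds12_mod_8) (simp_all add: coprime_commute)
  have "[h * ds12 h k + k * ds12 k h = h * (k + 1 - 2 * jsign h k) + k * (h + 1 - 2 * jsign k h)] (mod 8)"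
    by (intro cong_add cong_mult cong_refl k h)
  then have *: "8 dvd h * h + k * k + 1 - 3 * (h * k) - (h * (k + 1 - 2 * jsign h k) + k * (h + 1 - 2 * jsign k h))"
    unfolding ds12_reciprocity[OF assms(1-3)] cong_iff_dvd_diff by (simp add: power2_eq_square algebra_simps)
  obtain i where i: "h = 2 * i + 1" using assms(4) by (elim oddE)
  obtain j where j: "k = 2 * j + 1" using assms(5) by (elim oddE)
  have "even (i * i + i)" "even (j * j + j)" by simp_all
  then obtain y z where yz: "i * i = 2 * y - i" "j * j = 2 * z - j" by (metis add_diff_cancel_right' dvdE)
  have "h * h + k * k + 1 - 3 * (h * k) - (h * (k + 1 - 2 * s) + k * (h + 1 - 2 * t)) =
     8 * (y + z - 3 * (i * j) - 2 * i - 2 * j - 1) + (4 * (i * j) + 4 * i + 4 * j + 4 + 4 * (i * s) + 2 * s + 4 * (j * t) + 2 * t)" for s t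
    using yz by (simp add: i j algebra_simps)
  then have **: "8 dvd 4 * (i * j) + 4 * i + 4 * j + 4 + 4 * (i * jsign h k) + 2 * jsign h k + 4 * (j * jsign k h) + 2 * jsign k h"
    using * by (simp only: dvd_add_right_iff[OF dvd_triv_left])
  have ij: "even (i * j) \<longleftrightarrow> \<not> (odd i \<and> odd j)" by simp
  have "(jsign h k = jsign k h) \<longleftrightarrow> even (i * j)"
  proof -
    have "8 dvd 4 * P + 4 * i + 4 * j + 4 + 4 * (i * s) + 2 * s + 4 * (j * t) + 2 * t \<Longrightarrow>
        s = 1 \<or> s = -1 \<Longrightarrow> t = 1 \<or> t = -1 \<Longrightarrow> s = t \<longleftrightarrow> even P" for P s t
      by (elim disjE; hypsubst; simp; presburger)
    from this[OF **] show ?thesis using jsign_values by blast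
  qed
  moreover have "h mod 4 = 3 \<longleftrightarrow> odd i" "k mod 4 = 3 \<longleftrightarrow> odd j" unfolding i j by presburger+
  ultimately show ?thesis using ij jsign_values[of h k] jsign_values[of k h] by auto
qed

text \<open>The same argument for the pair \<open>2\<close>, \<open>k\<close>, where the term
  \<open>ds12 k 2\<close> vanishes and \<open>ds12 2 k\<close> is explicit.\<close>

lemma jsign_two:
  assumes "k > 0" "odd k"
  shows "jsign 2 k = kronecker_prime k 2"
proof -
  have cp: "coprime 2 k" using assms by simp
  have k: "[ds12 2 k = k + 1 - 2 * jsign 2 k] (mod 8)"
    using assms cp by (intro ds12_mod_8)
  \<comment> \<open>The sum \<open>s(k, 2)\<close> has the single term \<open>r = 1\<close>, and the
    sawtooth vanishes at \<open>1/2\<close>.\<close>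
  have "k div 2 * 2 = k - 1" using assms by presburger
  moreover have "{1..2-1} = {1::int}" by auto
  ultimately have "ds12 k 2 = 0" by (simp add: ds12_def)
  then have e: "2 * ds12 2 k = 4 + k * k + 1 - 6 * k"
    using ds12_reciprocity[of 2 k] assms cp by (simp add: power2_eq_square)
  obtain j where j: "k = 2 * j + 1" using assms by (elim oddE)
  have "even (j * j + j)" by simp
  then obtain y where y: "j * j = 2 * y - j" by (metis add_diff_cancel_right' dvdE)
  have ds: "ds12 2 k = 4 * y - 6 * j" using e y by (simp add: j algebra_simps)
  have j4: "j mod 4 = 0 \<or> j mod 4 = 1 \<or> j mod 4 = 2 \<or> j mod 4 = 3" by presburger
  have km: "k mod 8 = 2 * (j mod 4) + 1" unfolding j by presburger
  \<comment> \<open>\<open>y\<close> is the triangular number \<open>j (j + 1) / 2\<close>, whose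
    parity has period 4 in \<open>j\<close>.\<close>
  have ye: "even y \<longleftrightarrow> j mod 4 = 0 \<or> j mod 4 = 3"
  proof -
    define t s where "t = j div 4" and "s = j mod 4"
    have t: "j = 4 * t + s" by (simp add: t_def s_def)
    have *: "2 * y = 4 * (4 * (t * t) + (2 * s + 1) * t) + s * (s + 1)"
      using y unfolding t by (simp add: algebra_simps)
    have "2 * y = 4 * z + s * (s + 1) \<Longrightarrow> s = 0 \<or> s = 3 \<Longrightarrow> even y"
      "2 * y = 4 * z + s * (s + 1) \<Longrightarrow> s = 1 \<or> s = 2 \<Longrightarrow> odd y" for z
      by (elim disjE; hypsubst; simp; presburger)+
    from this[OF *] show ?thesis using j4 unfolding s_def by auto
  qed
  have J: "jsign 2 k = 1 \<longleftrightarrow> even y"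
  proof -
    have "8 dvd 4 * y - 6 * j - (2 * j + 1 + 1 - 2 * jsign 2 k)"
      using k ds unfolding cong_iff_dvd_diff by (simp add: j)
    moreover have "8 dvd 4 * y - 6 * j - (2 * j + 1 + 1 - 2 * s) \<Longrightarrow> s = 1 \<or> s = -1 \<Longrightarrow> s = 1 \<longleftrightarrow> even y" for s
      by presburger
    ultimately show ?thesis using jsign_values[of 2 k] by blast
  qed
  show ?thesis using J jsign_values[of 2 k] j4 assms(2) ye
    by (auto simp: kronecker_prime_def km)
qed

section \<open>The Kronecker symbol and its relation to the Jacobi symbol\<close>

lemma kronecker_1: "kronecker a 1 = 1"
  by (simp add: kronecker_def)

lemma kronecker_prime_mult_right:
  assumes "prime p" "v > 0"
  shows "kronecker a (p * v) = kronecker_prime a p * kronecker a v"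
proof -
  have *: "kronecker a n = prod_mset (image_mset (kronecker_prime a) (prime_factorization n))" for n
    unfolding kronecker_def image_prod_mset_multiplicity
    by (intro prod.cong refl) (metis count_prime_factorization_prime in_prime_factors_imp_prime)
  show ?thesis unfolding * using assms by (simp add: prime_factorization_mult prime_factorization_prime)
qed

lemma kronecker_prime_jsign:
  assumes "prime p" "odd p" "coprime a (int p)"
  shows "kronecker_prime a p = jsign a (int p)"
proof -
  have "jsign a (int p) = Legendre a (int p)"
    by (rule jsign_Legendre) (use assms in simp_all)
  moreover have "p \<noteq> 2" using assms(2) by auto
  ultimately show ?thesis by (simp add: kronecker_prime_def)
qed

lemma kronecker_prime_2_cong:
  assumes "[a = b] (mod 8)"
  shows "kronecker_prime a 2 = kronecker_prime b 2"
proof -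
  have "even a = even b" using assms unfolding cong_def by presburger
  then show ?thesis using assms by (simp add: kronecker_prime_def cong_def)
qed

lemma kronecker_prime_mult:
  assumes p: "prime p" and cp: "coprime a (int p)" "coprime b (int p)"
  shows "kronecker_prime (a * b) p = kronecker_prime a p * kronecker_prime b p"
proof (cases "p = 2")
  case True
  have ab: "odd a" "odd b" using cp True by simp_all
  have 8: "x mod 8 = 1 \<or> x mod 8 = 3 \<or> x mod 8 = 5 \<or> x mod 8 = 7" if "odd x" for x :: int
    using that by presburger
  have m: "a * b mod 8 = (a mod 8) * (b mod 8) mod 8" by (simp add: mod_mult_eq)
  show ?thesis unfolding kronecker_prime_def m using 8[OF ab(1)] 8[OF ab(2)]
    by (elim disjE; simp add: ab True)
next
  case False
  then have "odd p" using p by (metis prime_odd_nat prime_ge_2_nat le_neq_implies_less)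
  note J = kronecker_prime_jsign[OF p this]
  have "coprime (a * b) (int p)" using cp by (rule coprime_mult_left_iff[THEN iffD2, OF conjI])
  moreover have "jsign (a * b) (int p) = jsign a (int p) * jsign b (int p)"
    by (rule jsign_mult[OF cp]) (use prime_gt_0_nat[OF p] \<open>odd p\<close> in simp_all)
  ultimately show ?thesis using J cp by metis
qed

lemma kronecker_mult:
  assumes "coprime a (int v)" "coprime b (int v)" 
  shows "kronecker (a * b) v = kronecker a v * kronecker b v"
  unfolding kronecker_def prod.distrib[symmetric] power_mult_distrib[symmetric]
proof (intro prod.cong refl arg_cong2[where f = "(^)"])
  fix p assume "p \<in> prime_factors v"
  then have p: "prime p" "int p dvd int v" by auto
  show "kronecker_prime (a * b) p = kronecker_prime a p * kronecker_prime b p"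
    using kronecker_prime_mult[OF p(1) coprime_divisors[OF dvd_refl p(2) assms(1)]
      coprime_divisors[OF dvd_refl p(2) assms(2)]] .
qed

text \<open>The symbol is local at the primes of \<open>v\<close>: an odd prime sees residues modulo
  \<open>p\<close>, the prime 2 sees residues modulo 8. This is one reason for the factor 8 in
  \<open>shift_modulus\<close>.\<close>

lemma kronecker_cong:
  assumes "\<And>p. prime p \<Longrightarrow> p dvd v \<Longrightarrow> [a = b] (mod int p)" "even v \<Longrightarrow> [a = b] (mod 8)"
  shows "kronecker a v = kronecker b v"
  unfolding kronecker_def
proof (intro prod.cong refl arg_cong2[where f = "(^)"])
  fix p assume "p \<in> prime_factors v"
  then have p: "prime p" "p dvd v" by auto
  show "kronecker_prime a p = kronecker_prime b p"
  proof (cases "p = 2")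
    case True
    then show ?thesis using assms(2) p by (simp add: kronecker_prime_2_cong)
  next
    case False
    have c: "[a = b] (mod int p)" using assms(1) p .
    then have "[a = 0] (mod int p) = [b = 0] (mod int p)" "QuadRes (int p) a = QuadRes (int p) b"
      unfolding QuadRes_def cong_def by simp_all
    then show ?thesis using False by (simp add: kronecker_prime_def Legendre_def)
  qed
qed

lemma delta_of_two_mult: "v > 0 \<Longrightarrow> delta_of (2 * v) = delta_of v"
  by (simp add: delta_of_def multiplicity_times_same)

lemma delta_of_odd_prime_mult:
  assumes "v > 0" "prime p" "odd p"
  shows "delta_of (p * v) = (if p mod 4 = 3 then 1 - delta_of v else delta_of v)"
proof -
  define u where "u = v div 2 ^ multiplicity 2 v"
  have v: "v = 2 ^ multiplicity 2 v * u" unfolding u_def by (simp add: multiplicity_dvd)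
  have "multiplicity 2 p = 0" using assms by (simp add: not_dvd_imp_multiplicity_0)
  then have "multiplicity 2 (p * v) = multiplicity 2 v"
    using assms by (subst prime_elem_multiplicity_mult_distrib) auto
  then have "p * v div 2 ^ multiplicity 2 (p * v) = p * u"
    by (subst v, simp)
  moreover have "odd u" unfolding u_def using multiplicity_decompose[of v 2] assms(1) by simp
  then have "u mod 4 = 1 \<or> u mod 4 = 3" by presburger
  moreover have "p mod 4 = 1 \<or> p mod 4 = 3" using assms(3) by presburger
  moreover have "p * u mod 4 = (p mod 4) * (u mod 4) mod 4" by (simp add: mod_mult_eq)
  ultimately show ?thesis unfolding delta_of_def u_def[symmetric] by (elim disjE) simp_all
qed

text \<open>Induction over the prime factors of \<open>v\<close>: the factor 2 is covered by
  \<open>jsign_two\<close>, odd primes by reciprocity. For \<open>D \<equiv> 3\<close> modulo 4 each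
  prime \<open>p \<equiv> 3\<close> contributes a sign, and \<open>delta_of\<close> counts these
  primes modulo 2.\<close>

lemma jsign_kronecker:
  assumes "v > 0" "D > 0" "odd D" "coprime D (int v)"
  shows "jsign (int v) D = kronecker D v * (if D mod 4 = 3 \<and> delta_of v = 1 then -1 else 1)"
  using assms(1,4)
proof (induction v rule: prime_divisors_induct)
  case (unit x)
  then have "x = 1" by simp
  moreover have "delta_of 1 = 0" by (simp add: delta_of_def)
  ultimately show ?case by (simp only: of_nat_1 jsign_1 kronecker_1) simp
next
  case (factor p x)
  have x: "x > 0" using factor(3) by (cases x) simp_all
  have cx: "coprime D (int x)" and cpp: "coprime D (int p)"
    using factor(4) by (simp_all only: of_nat_mult coprime_mult_right_iff)
  have IH: "jsign (int x) D = kronecker D x * (if D mod 4 = 3 \<and> delta_of x = 1 then -1 else 1)"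
    using factor(2) x cx by simp
  have J: "jsign (int (p * x)) D = jsign (int p) D * jsign (int x) D"
    unfolding of_nat_mult
    by (rule jsign_mult[OF coprime_commute[THEN iffD1] coprime_commute[THEN iffD1]]) (fact cpp cx assms(2,3))+
  show ?case
  proof (cases "p = 2")
    case True
    have "jsign (int p) D = kronecker_prime D p"
      unfolding True of_nat_numeral by (rule jsign_two[OF assms(2,3)])
    moreover have "delta_of (p * x) = delta_of x" unfolding True by (rule delta_of_two_mult[OF x])
    ultimately show ?thesis unfolding J IH kronecker_prime_mult_right[OF factor(1) x]
      by (simp only: mult.assoc)
  next
    case False
    then have "p > 2" using prime_ge_2_nat[OF factor(1)] by linarith
    then have op: "odd p" using prime_odd_nat[OF factor(1)] by blast
    have "jsign (int p) D = jsign D (int p) * (if int p mod 4 = 3 \<and> D mod 4 = 3 then -1 else 1)"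
      by (rule jsign_reciprocity[OF coprime_commute[THEN iffD1, OF cpp] _ assms(2) _ assms(3)])
        (use prime_gt_0_nat[OF factor(1)] op in simp_all)
    moreover have "(int p mod 4 = 3) = (p mod 4 = 3)" by presburger
    moreover have "delta_of x = 0 \<or> delta_of x = 1" by (simp add: delta_of_def)
    ultimately show ?thesis
      unfolding J IH kronecker_prime_mult_right[OF factor(1) x] kronecker_prime_jsign[OF factor(1) op cpp]
        delta_of_odd_prime_mult[OF x factor(1) op]
      by (cases "D mod 4 = 3"; cases "p mod 4 = 3"; elim disjE; simp only:; simp)
  qed
next
  case zero
  then show ?case by (elim less_irrefl[THEN notE])
qed

section \<open>The character of an eta-quotient\<close>

lemma ds12_minus:
  assumes "coprime h k" "k > 0"
  shows "ds12 (- h) k = - ds12 h k"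
proof -
  have "(\<Sum>r\<in>{1..k-1}. r * (- h * r div k)) = (\<Sum>r\<in>{1..k-1}. - (r * (h * r div k)) - r)"
  proof (rule sum.cong[OF refl])
    fix r assume "r \<in> {1..k-1}"
    then have "\<not> k dvd h * r" using not_dvd_mult_interval[OF assms(1)] by blast
    then show "r * (- h * r div k) = - (r * (h * r div k)) - r"
      using assms(2) by (simp add: zdiv_zminus1_eq_if dvd_eq_mod_eq_0 algebra_simps)
  qed
  also have "\<dots> = - (\<Sum>r\<in>{1..k-1}. r * (h * r div k)) - (\<Sum>r\<in>{1..k-1}. r)"
    by (simp only: sum_subtractf sum_negf)
  finally have S: "(\<Sum>r\<in>{1..k-1}. r * (- h * r div k)) = - (\<Sum>r\<in>{1..k-1}. r * (h * r div k)) - (\<Sum>r\<in>{1..k-1}. r)" .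
  have "2 * - h * (k - 1) * (2 * k - 1) - 12 * (- Y - X) - 3 * k * (k - 1) =
      - (2 * h * (k - 1) * (2 * k - 1) - 12 * Y - 3 * k * (k - 1))" if "2 * X = k * (k - 1)" for X Y
    using that by (simp add: algebra_simps)
  from this[OF sum_atLeastAtMost_int(1)[OF assms(2)]] show ?thesis unfolding ds12_def S .
qed

text \<open>Reciprocity moves the denominator from \<open>c\<close> to \<open>d\<close>, which can
  be kept prime to 6 as \<open>ds12_mod_3\<close> and \<open>ds12_mod_8\<close> require. The
  quotient is an integer because \<open>d\<close> divides \<open>c (b - c + ds12 c d)\<close> and is
  prime to \<open>c\<close>.\<close>

lemma Psi_eq_int:
  assumes det: "a * d - b * c = 1" and "c > 0" "d > 0"
  obtains z where "Psi (a, b, c, d) = of_int z" "d * z = b - c + ds12 c d"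
proof -
  have "coprime c d"
  proof (rule coprimeI)
    fix x assume "x dvd c" "x dvd d"
    then have "x dvd a * d - b * c" by (intro dvd_diff dvd_mult) auto
    then show "is_unit x" using det by simp
  qed
  note rec = ds12_reciprocity[OF this assms(2,3)]
  have "c * (b - c + ds12 c d) = d * (a + d - 3 * c - ds12 d c)"
    using rec det by (simp add: algebra_simps power2_eq_square)
  then have "d dvd c * (b - c + ds12 c d)" by simp
  then have "d dvd b - c + ds12 c d"
    using \<open>coprime c d\<close> by (simp add: coprime_commute coprime_dvd_mult_right_iff)
  then obtain z where z: "b - c + ds12 c d = d * z" by (elim dvdE)
  have cz: "c * z = a + d - 3 * c - ds12 d c"
  proof -
    have "d * (c * z) = d * (a + d - 3 * c - ds12 d c)"
      using \<open>c * (b - c + ds12 c d) = _\<close> unfolding z by (simp add: algebra_simps)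
    then show ?thesis using assms by simp
  qed
  have "12 * of_int c * dedekind_sum (- d) c = of_int (- ds12 d c)"
    using dedekind_sum_ds12[of "- d" c] ds12_minus[of d c] \<open>coprime c d\<close> assms(2)
    by (simp add: coprime_commute)
  then have "of_int c * Psi (a, b, c, d) = of_int (a + d - 3 * c - ds12 d c)"
    using assms(2) by (simp add: Psi_def field_simps)
  also have "\<dots> = of_int c * of_int z" unfolding cz[symmetric] by simp
  finally have "Psi (a, b, c, d) = of_int z" using assms(2) by simp
  from that[OF this z[symmetric]] show ?thesis .
qed

text \<open>For a sign \<open>x\<close> the number \<open>r (x - 1)\<close> is 0 or
  \<open>- 2 r\<close>, so modulo 4 it depends only on the parity of \<open>r\<close>. Thus a sum of
  Jacobi symbols with coefficients \<open>r n\<close> becomes a product with exponents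
  \<open>\<bar>r n\<bar>\<close>, the exponents that define \<open>\<varpi>\<close>.\<close>

lemma sum_sign_cong_4:
  fixes r x :: "'a \<Rightarrow> int"
  assumes "finite X" "\<And>n. n \<in> X \<Longrightarrow> x n = 1 \<or> x n = -1"
  shows "[(\<Sum>n\<in>X. r n * x n) = (\<Sum>n\<in>X. r n) + (\<Prod>n\<in>X. x n ^ nat \<bar>r n\<bar>) - 1] (mod 4)"
  using assms
proof (induction X)
  case (insert n X)
  define P where "P = (\<Prod>n\<in>X. x n ^ nat \<bar>r n\<bar>)"
  have "\<bar>P\<bar> = 1"
    unfolding P_def abs_prod
  proof (intro prod.neutral ballI)
    fix m assume "m \<in> X"
    then have "\<bar>x m\<bar> = 1" using insert(4)[of m] by auto
    then show "\<bar>x m ^ nat \<bar>r m\<bar>\<bar> = 1" by (simp add: power_abs)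
  qed
  then have P: "P = 1 \<or> P = -1" by linarith
  have IH: "[(\<Sum>n\<in>X. r n * x n) = (\<Sum>n\<in>X. r n) + P - 1] (mod 4)" using insert by (simp add: P_def)
  have x1: "x n = 1 \<or> x n = -1" using insert(4)[of n] by blast
  have "even (nat \<bar>r n\<bar>) = even (r n)" by (simp add: even_nat_iff)
  with x1 have pw: "x n ^ nat \<bar>r n\<bar> = (if even (r n) then 1 else x n)"
    by (elim disjE) (simp_all only: power_one minus_one_power_iff if_cancel)
  have "[r n * x n + (\<Sum>n\<in>X. r n * x n) = r n * x n + ((\<Sum>n\<in>X. r n) + P - 1)] (mod 4)"
    by (rule cong_add[OF cong_refl IH])
  moreover have "[r n * x n + ((\<Sum>n\<in>X. r n) + P - 1) = r n + (\<Sum>n\<in>X. r n) + x n ^ nat \<bar>r n\<bar> * P - 1] (mod 4)"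
  proof -
    have "u = 1 \<or> u = -1 \<Longrightarrow> p = 1 \<or> p = -1 \<Longrightarrow>
        4 dvd R * u + (s + p - 1) - (R + s + (if even R then 1 else u) * p - 1)" for u p R s :: int
      by (elim disjE; hypsubst; presburger)
    from this[OF x1 P] show ?thesis unfolding cong_iff_dvd_diff pw .
  qed
  ultimately show ?case
    unfolding sum.insert[OF insert(1,2)] prod.insert[OF insert(1,2)] P_def by (rule cong_trans)
qed simp

section \<open>Exponentials, and the explicit value of the character\<close>

lemma ee_add: "ee (x + y) = ee x * ee y"
  by (simp add: ee_def distrib_left exp_add)

lemma ee_of_int [simp]: "ee (of_int n) = 1"
proof -
  have "ee (of_int n) = exp (2 * of_int n * pi * \<i>)" by (simp add: ee_def mult_ac)
  then show ?thesis using exp_integer_2pi[of "of_int n"] by simp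
qed

lemma ee_cong_int:
  assumes "[x = y] (mod m)" "m > 0"
  shows "ee (of_int x / of_int m) = ee (of_int y / of_int m)"
proof -
  obtain t where "x = y + m * t" using assms(1) by (metis cong_iff_lin cong_sym)
  then have "of_int x / of_int m = of_int y / of_int m + (of_int t :: complex)"
    using assms(2) by (simp add: field_simps)
  then show ?thesis by (simp add: ee_add)
qed

lemma ee_half: "ee (1 / 2) = -1"
  by (simp add: ee_def)

text \<open>For \<open>D\<close> prime to 6 the exponent \<open>Psi\<close> is determined modulo 24 by \<open>D * Psi\<close> since \<open>D\<^sup>2 \<equiv> 1\<close>.\<close>
lemma eta_char_explicit:
  fixes r :: "nat \<Rightarrow> int" and N :: nat and A B c D :: int
  defines "M \<equiv> \<Sum>n\<in>{n. n dvd N}. int (N div n) * r n" and "w \<equiv> wt2 r N" and "v \<equiv> varpi r N"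
  assumes N: "N > 0" and sum0: "(\<Sum>n\<in>{n. n dvd N}. int n * r n) = 0"
    and det: "A * D - B * (int N * c) = 1" and c: "c > 0" and D: "D > 0" "coprime D 6"
  shows "eta_char r N (A, B, int N * c, D) 1 = ee (of_int (9 * w * (1 - D) - D * c * M) / 24) *
     of_int (jsign c D ^ nat \<bar>w\<bar> * (kronecker D v * (if D mod 4 = 3 \<and> delta_of v = 1 then -1 else 1)))"
proof -
  let ?S = "{n. n dvd N}"
  have finS: "finite ?S" using N by simp
  have co: "coprime D c" "coprime D (int N)"
  proof -
    have "coprime D (int N * c)"
    proof (rule coprimeI)
      fix x assume "x dvd D" "x dvd int N * c"
      then have "x dvd A * D - B * (int N * c)" by (metis dvd_diff dvd_mult)
      then show "is_unit x" using det by simp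
    qed
    then show "coprime D c" "coprime D (int N)" by auto
  qed
  have D2: "odd D" and D3: "\<not> 3 dvd D"
  proof -
    show "odd D"
    proof
      assume "even D" moreover have "even (6::int)" by simp
      ultimately have "is_unit (2::int)" using D(2) coprime_common_divisor by blast
      then show False by simp
    qed
    show "\<not> 3 dvd D"
    proof
      assume "3 dvd D" moreover have "(3::int) dvd 6" by simp
      ultimately have "is_unit (3::int)" using D(2) coprime_common_divisor by blast
      then show False by simp
    qed
  qed
  define x where "x = (\<lambda>n. c * int (N div n))"
  have npos: "n > 0" if "n \<in> ?S" for n using that N by (auto intro: Nat.gr0I)
  have divpos: "N div n > 0" if "n \<in> ?S" for n using that N by (auto elim!: dvdE)
  have xeq: "int N * c div int n = x n" "int n * x n = int N * c" if "n \<in> ?S" for n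
    using that npos[OF that] by (auto simp: x_def elim!: dvdE)
  have cox: "coprime (x n) D" "coprime (int (N div n)) D" if "n \<in> ?S" for n
  proof -
    have "int (N div n) dvd int N" using that by (auto elim!: dvdE)
    then show "coprime (int (N div n)) D" using co(2) by (meson coprime_commute coprime_divisors dvd_refl)
    then show "coprime (x n) D" using co(1) by (simp add: x_def coprime_commute)
  qed
  have "\<exists>z. Psi (A, B * int n, int N * c div int n, D) = of_int z \<and> D * z = B * int n - x n + ds12 (x n) D"
    if n: "n \<in> ?S" for n
  proof -
    have "A * D - B * int n * x n = 1" using det xeq(2)[OF n] by (simp add: mult.assoc)
    moreover have "x n > 0" using c divpos[OF n] by (simp add: x_def)
    ultimately show ?thesis using Psi_eq_int[of A D "B * int n" "x n"] D(1) xeq(1)[OF n] by metis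
  qed
  then obtain z where z: "\<And>n. n \<in> ?S \<Longrightarrow> Psi (A, B * int n, int N * c div int n, D) = of_int (z n)"
      "\<And>n. n \<in> ?S \<Longrightarrow> D * z n = B * int n - x n + ds12 (x n) D" by metis
  define Z where "Z = (\<Sum>n\<in>?S. r n * z n)"
  define P where "P = (\<Prod>n\<in>?S. jsign (x n) D ^ nat \<bar>r n\<bar>)"
  have char: "eta_char r N (A, B, int N * c, D) 1 = ee (of_int Z / 24)"
  proof -
    have "(\<Sum>n\<in>?S. of_int (r n) * Psi (A, B * int n, int N * c div int n, D)) = of_int Z"
      unfolding Z_def of_int_sum by (intro sum.cong) (auto simp: z(1))
    then show ?thesis unfolding eta_char_def case_prod_conv by (simp del: of_real_sum)
  qed
  \<comment> \<open>The terms with \<open>B\<close> cancel because the sum of \<open>n r_n\<close>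
    is 0, so only the bottom row of the matrix remains.\<close>
  have DZ: "D * Z = (\<Sum>n\<in>?S. r n * ds12 (x n) D) - c * M"
  proof -
    have "D * Z = (\<Sum>n\<in>?S. B * (int n * r n) - c * (int (N div n) * r n) + r n * ds12 (x n) D)"
      unfolding Z_def sum_distrib_left
    proof (intro sum.cong refl)
      fix n assume "n \<in> ?S"
      have "D * (r n * z n) = r n * (D * z n)" by simp
      also have "\<dots> = B * (int n * r n) - c * (int (N div n) * r n) + r n * ds12 (x n) D"
        unfolding z(2)[OF \<open>n \<in> ?S\<close>] x_def by (simp add: algebra_simps)
      finally show "D * (r n * z n) = B * (int n * r n) - c * (int (N div n) * r n) + r n * ds12 (x n) D" .
    qed
    then show ?thesis unfolding M_def
      by (simp only: sum.distrib sum_subtractf sum_distrib_left[symmetric] sum0)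
  qed
  have P1: "P = 1 \<or> P = -1"
  proof -
    have "\<bar>jsign h k\<bar> = 1" for h k using jsign_values[of h k] by auto
    then have "\<bar>P\<bar> = 1" unfolding P_def abs_prod by (simp add: power_abs)
    then show ?thesis by linarith
  qed
  have m3: "[D * Z = - (c * M)] (mod 3)"
  proof -
    have "3 dvd (\<Sum>n\<in>?S. r n * ds12 (x n) D)" using ds12_mod_3[OF D3] by (intro dvd_sum dvd_mult) auto
    then show ?thesis unfolding DZ cong_iff_dvd_diff by simp
  qed
  \<comment> \<open>The Jacobi symbols carry a factor 2, so a congruence modulo 4 for their weighted
    sum is enough here.\<close>
  have m8: "[D * Z = w * (D - 1) + 2 - 2 * P - c * M] (mod 8)"
  proof -
    have e1: "[(\<Sum>n\<in>?S. r n * ds12 (x n) D) = (\<Sum>n\<in>?S. r n * (D + 1 - 2 * jsign (x n) D))] (mod 8)"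
      by (intro cong_sum cong_mult cong_refl ds12_mod_8) (use D D2 cox in auto)
    have "(\<Sum>n\<in>?S. r n * (D + 1 - 2 * jsign (x n) D)) =
        (\<Sum>n\<in>?S. (D + 1) * r n - 2 * (r n * jsign (x n) D))"
      by (intro sum.cong) (auto simp: algebra_simps)
    then have e2: "(\<Sum>n\<in>?S. r n * (D + 1 - 2 * jsign (x n) D)) = (D + 1) * w - 2 * (\<Sum>n\<in>?S. r n * jsign (x n) D)"
      by (simp only: sum_subtractf sum_distrib_left w_def wt2_def)
    have e3: "[(\<Sum>n\<in>?S. r n * jsign (x n) D) = w + P - 1] (mod 4)"
      unfolding w_def wt2_def P_def by (rule sum_sign_cong_4[OF finS]) (use jsign_values in auto)
    have "8 dvd X - (Y - 2 * T) \<Longrightarrow> 4 dvd T - (w + P - 1) \<Longrightarrow> 8 dvd (X - c') - (Y - 2 * w + 2 - 2 * P - c')" for X Y T c' :: int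
      by presburger
    from this[OF e1[unfolded e2 cong_iff_dvd_diff] e3[unfolded cong_iff_dvd_diff], of "c * M"]
    show ?thesis unfolding DZ cong_iff_dvd_diff by (simp add: algebra_simps)
  qed
  have DD: "24 dvd D * D - 1"
  proof -
    have "D mod 3 = 1 \<or> D mod 3 = 2" using D3 by presburger
    moreover have "D * D mod 3 = (D mod 3) * (D mod 3) mod 3" by (simp add: mod_mult_eq)
    ultimately have "D * D mod 3 = 1" by (elim disjE) simp_all
    moreover have "D * D mod 8 = 1"
    proof -
      have "D mod 8 = 1 \<or> D mod 8 = 3 \<or> D mod 8 = 5 \<or> D mod 8 = 7" using D2 by presburger
      moreover have "D * D mod 8 = (D mod 8) * (D mod 8) mod 8" by (simp add: mod_mult_eq)
      ultimately show ?thesis by (elim disjE) simp_all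
    qed
    ultimately show ?thesis by presburger
  qed
  \<comment> \<open>Chinese remaindering: 9 is 0 modulo 3 and 1 modulo 8, while
    \<open>6 (1 - P)\<close> is 0 modulo 3 and agrees with \<open>2 (1 - P)\<close> modulo 8 because
    \<open>1 - P\<close> is even.\<close>
  have Zc: "[Z = 9 * w * (1 - D) - D * c * M + 6 * (1 - P)] (mod 24)"
  proof -
    obtain t where t: "D * D = 24 * t + 1" using DD by (metis add.commute diff_add_cancel dvdE)
    have "[Z = - D * c * M] (mod 3)"
    proof -
      from m3 have "[D * (D * Z) = D * (- (c * M))] (mod 3)" by (rule cong_scalar_left)
      moreover have "D * (D * Z) = Z + 3 * (8 * t * Z)" using t by (simp add: mult.assoc[symmetric]) (simp add: algebra_simps)
      ultimately have "[Z + 3 * (8 * t * Z) = - D * c * M] (mod 3)" by (simp add: mult.assoc)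
      moreover have "[Z + 3 * (8 * t * Z) = Z] (mod 3)" unfolding cong_iff_dvd_diff by simp
      ultimately show ?thesis using cong_sym cong_trans by blast
    qed
    have "[Z = w * (1 - D) + 2 * (1 - P) - D * c * M] (mod 8)"
    proof -
      from m8 have "[D * (D * Z) = D * (w * (D - 1) + 2 - 2 * P - c * M)] (mod 8)" by (rule cong_scalar_left)
      moreover have "D * (D * Z) = Z + 8 * (3 * t * Z)" using t by (simp add: mult.assoc[symmetric]) (simp add: algebra_simps)
      moreover have "D * (w * (D - 1) + 2 - 2 * P - c * M) =
          w * (D * D) - w * D + 2 * D * (1 - P) - D * c * M" by (simp add: algebra_simps)
      ultimately have "[Z + 8 * (3 * t * Z) = w * (24 * t + 1) - w * D + 2 * D * (1 - P) - D * c * M] (mod 8)"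
        unfolding t by simp
      moreover have "[w * (24 * t + 1) - w * D + 2 * D * (1 - P) - D * c * M = w * (1 - D) + 2 * (1 - P) - D * c * M] (mod 8)"
      proof -
        have "8 dvd 2 * (D - 1) * (1 - P)" using P1 D2 by (auto elim!: oddE)
        moreover have "w * (24 * t + 1) - w * D + 2 * D * (1 - P) - D * c * M - (w * (1 - D) + 2 * (1 - P) - D * c * M)
           = 8 * (3 * t * w) + 2 * (D - 1) * (1 - P)" by (simp add: algebra_simps)
        ultimately show ?thesis unfolding cong_iff_dvd_diff by simp
      qed
      ultimately have "[Z + 8 * (3 * t * Z) = w * (1 - D) + 2 * (1 - P) - D * c * M] (mod 8)" by (rule cong_trans)
      moreover have "[Z + 8 * (3 * t * Z) = Z] (mod 8)" unfolding cong_iff_dvd_diff by simp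
      ultimately show ?thesis using cong_sym cong_trans by blast
    qed
    have "24 dvd Z - (9 * W - X + 6 * (1 - P))"
      if "3 dvd Z + X" "8 dvd Z - (W + 2 * (1 - P) - X)" for X W :: int
    proof -
      let ?T = "Z - (9 * W - X + 6 * (1 - P))"
      have "3 dvd (Z + X) - 3 * (3 * W + 2 * (1 - P))" using that(1) by (rule dvd_diff) simp
      moreover have "(Z + X) - 3 * (3 * W + 2 * (1 - P)) = ?T" by simp
      moreover have "8 dvd 8 * W + 4 * (1 - P)" using P1 by auto
      then have "8 dvd (Z - (W + 2 * (1 - P) - X)) - (8 * W + 4 * (1 - P))"
        by (rule dvd_diff[OF that(2)])
      moreover have "(Z - (W + 2 * (1 - P) - X)) - (8 * W + 4 * (1 - P)) = ?T" by simp
      ultimately have "3 dvd ?T" "8 dvd ?T" by (simp_all only:)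
      moreover have "3 dvd T \<Longrightarrow> 8 dvd T \<Longrightarrow> 24 dvd T" for T :: int by presburger
      ultimately show ?thesis by blast
    qed
    from this[of "D * c * M" "w * (1 - D)"] \<open>[Z = - D * c * M] (mod 3)\<close>
      \<open>[Z = w * (1 - D) + 2 * (1 - P) - D * c * M] (mod 8)\<close>
    show ?thesis unfolding cong_iff_dvd_diff by (simp only: mult_minus_left diff_minus_eq_add mult.assoc)
  qed
  have "ee (of_int Z / 24) = ee (of_int (9 * w * (1 - D) - D * c * M + 6 * (1 - P)) / 24)"
    using ee_cong_int[OF Zc] by simp
  also have "\<dots> = ee (of_int (9 * w * (1 - D) - D * c * M) / 24) * ee (of_int (6 * (1 - P)) / 24)"
    by (simp only: ee_add[symmetric] add_divide_distrib[symmetric] of_int_add[symmetric])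
  also have "ee (of_int (6 * (1 - P)) / 24) = of_int P" using P1 ee_half ee_of_int[of 0] by auto
  finally have "eta_char r N (A, B, int N * c, D) 1 = ee (of_int (9 * w * (1 - D) - D * c * M) / 24) * of_int P"
    using char by simp
  moreover have "P = jsign c D ^ nat \<bar>w\<bar> * (kronecker D v * (if D mod 4 = 3 \<and> delta_of v = 1 then -1 else 1))"
  proof -
    have vint: "int v = (\<Prod>n\<in>?S. int (N div n) ^ nat \<bar>r n\<bar>)"
      unfolding v_def varpi_def by (simp only: of_nat_prod of_nat_power)
    have cv: "coprime (int (N div n) ^ nat \<bar>r n\<bar>) D" if "n \<in> ?S" for n
      using cox(2)[OF that] by (simp only: coprime_power_left_iff simp_thms)
    have "P = (\<Prod>n\<in>?S. jsign c D ^ nat \<bar>r n\<bar> * jsign (int (N div n)) D ^ nat \<bar>r n\<bar>)"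
      unfolding P_def x_def using co cox D D2
      by (intro prod.cong refl) (simp add: jsign_mult coprime_commute power_mult_distrib)
    also have "\<dots> = jsign c D ^ (\<Sum>n\<in>?S. nat \<bar>r n\<bar>) * (\<Prod>n\<in>?S. jsign (int (N div n) ^ nat \<bar>r n\<bar>) D)"
      using cox D D2 by (simp add: prod.distrib power_sum jsign_power)
    also have "(\<Prod>n\<in>?S. jsign (int (N div n) ^ nat \<bar>r n\<bar>) D) = jsign (int v) D"
      unfolding vint by (rule jsign_prod[symmetric, OF finS cv D(1) D2])
    also have "jsign (int v) D = kronecker D v * (if D mod 4 = 3 \<and> delta_of v = 1 then -1 else 1)"
    proof (rule jsign_kronecker[OF _ D(1) D2])
      have "(N div n) ^ nat \<bar>r n\<bar> > 0" if "n \<in> ?S" for n using divpos[OF that] by simp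
      then show "v > 0" unfolding v_def varpi_def by (rule prod_pos)
      show "coprime D (int v)" unfolding vint by (intro prod_coprime_right, subst coprime_commute, rule cv)
    qed
    \<comment> \<open>Only the parity of the exponent counts, and it is the parity of the sum of the
      \<open>r n\<close>, which is \<open>w\<close>.\<close>
    also have "jsign c D ^ (\<Sum>n\<in>?S. nat \<bar>r n\<bar>) = jsign c D ^ nat \<bar>w\<bar>"
    proof -
      have "even (\<Sum>n\<in>X. nat \<bar>r n\<bar>) = even (\<Sum>n\<in>X. r n)" if "finite X" for X
        using that by (induction X) (auto simp: even_nat_iff)
      then have "even (\<Sum>n\<in>?S. nat \<bar>r n\<bar>) = even (nat \<bar>w\<bar>)"
        using finS by (simp add: even_nat_iff w_def wt2_def)
      then show ?thesis using jsign_values[of c D] by (auto simp: minus_one_power_iff)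
    qed
    finally show ?thesis .
  qed
  ultimately show ?thesis by simp
qed

section \<open>The product expansion of an eta-quotient\<close>

lemma ee_0 [simp]: "ee 0 = 1"
  by (simp add: ee_def)

lemma ee_nonzero [simp]: "ee z \<noteq> 0"
  by (simp add: ee_def)

lemma ee_of_nat_mult: "ee (of_nat n * z) = ee z ^ n"
  by (simp add: ee_def exp_of_nat_mult[symmetric] mult_ac)

lemma ee_power_int: "ee z powi n = ee (of_int n * z)"
proof -
  have "exp (of_int n * (2 * of_real pi * \<i> * z)) = exp (2 * of_real pi * \<i> * z) powi n"
    by (simp add: exp_power_int)
  then show ?thesis by (simp add: ee_def mult_ac)
qed

lemma norm_ee: "norm (ee z) = exp (- 2 * pi * Im z)"
  by (simp add: ee_def)

lemma norm_ee_less_1: "z \<in> upper \<Longrightarrow> norm (ee z) < 1"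
  by (simp add: norm_ee upper_def)

lemma open_upper: "open upper"
  unfolding upper_def by (rule open_halfspace_Im_gt)

lemma convex_upper: "convex upper"
  unfolding upper_def by (rule convex_halfspace_Im_gt)

lemma ex_ee_eq:
  assumes "q \<noteq> 0" "norm q < 1" "h > 0"
  obtains \<tau> where "\<tau> \<in> upper" "ee (\<tau> / of_real h) = q"
proof -
  define \<tau> where "\<tau> = of_real h * Ln q / (2 * of_real pi * \<i>)"
  have "\<tau> = of_real (h / (2 * pi)) * (- \<i> * Ln q)" by (simp add: \<tau>_def field_simps)
  then have Im: "Im \<tau> = h / (2 * pi) * - ln (norm q)" using assms(1) by simp
  moreover have "ln (norm q) < 0" using assms by simp
  ultimately have "\<tau> \<in> upper" using assms(3) unfolding upper_def mem_Collect_eq Im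
    by (intro mult_pos_pos) auto
  moreover have "ee (\<tau> / of_real h) = q" using assms by (simp add: ee_def \<tau>_def)
  ultimately show ?thesis using that by blast
qed

lemma ex_ee_eq_1:
  assumes "q \<noteq> 0" "norm q < 1"
  obtains \<tau> where "\<tau> \<in> upper" "ee \<tau> = q"
  using ex_ee_eq[OF assms, of 1] by auto

text \<open>The point \<open>q = 0\<close> is excluded because \<open>ee\<close> never vanishes. The
  lowest coefficient not yet treated is therefore obtained as a limit at 0, after division by the
  corresponding power of \<open>q\<close>.\<close>

lemma powser_zero_unique:
  fixes d :: "nat \<Rightarrow> complex"
  assumes "\<And>q. q \<noteq> 0 \<Longrightarrow> norm q < 1 \<Longrightarrow> (\<lambda>n. d n * q ^ n) sums 0"
  shows "d n = 0"
proof (induction n rule: less_induct)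
  case (less n)
  have "(\<lambda>m. d (m + n) * q ^ m) sums 0" if q: "q \<noteq> 0" "norm q < 1" for q
  proof -
    have "(\<lambda>m. d (m + n) * q ^ (m + n)) sums (0 - (\<Sum>i<n. d i * q ^ i))"
      by (rule sums_split_initial_segment[OF assms[OF q]])
    then have "(\<lambda>m. d (m + n) * q ^ (m + n)) sums 0" using less by simp
    then have "(\<lambda>m. d (m + n) * q ^ (m + n) * inverse (q ^ n)) sums (0 * inverse (q ^ n))"
      by (rule sums_mult2)
    then show ?thesis using q by (simp add: power_add field_simps)
  qed
  then have "((\<lambda>_. 0) \<longlongrightarrow> d (0 + n)) (at (0::complex))"
    by (intro powser_limit_0_strong[of 1 "\<lambda>m. d (m + n)" "\<lambda>_. 0"]) auto
  then have "d (0 + n) = 0"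
    by (rule tendsto_unique[OF trivial_limit_at _ tendsto_const])
  then show ?case by simp
qed

lemma qseries_unique:
  assumes "\<And>\<tau>. \<tau> \<in> upper \<Longrightarrow> (\<lambda>n. c n * ee \<tau> ^ n) sums g \<tau>"
    and "\<And>\<tau>. \<tau> \<in> upper \<Longrightarrow> (\<lambda>n. c' n * ee \<tau> ^ n) sums g \<tau>"
  shows "c = c'"
proof
  fix n
  have "c n - c' n = 0"
  proof (rule powser_zero_unique)
    fix q :: complex assume "q \<noteq> 0" "norm q < 1"
    then obtain \<tau> where \<tau>: "\<tau> \<in> upper" "ee \<tau> = q" by (rule ex_ee_eq_1)
    from sums_diff[OF assms(1)[OF \<tau>(1)] assms(2)[OF \<tau>(1)]]
    show "(\<lambda>n. (c n - c' n) * q ^ n) sums 0" using \<tau>(2) by (simp add: algebra_simps)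
  qed
  then show "c n = c' n" by simp
qed

section \<open>The Euler product as a holomorphic function of q on the unit disc\<close>

definition euler_prod :: "complex \<Rightarrow> complex" where
  "euler_prod q = (\<Prod>n. 1 - q ^ Suc n)"

lemma norm_power_Suc_less_1: "norm (q::complex) < 1 \<Longrightarrow> norm (q ^ Suc n) < 1"
  using power_Suc_less_one[of "norm q" n] by (cases "q = 0") (simp_all only: norm_power zero_less_norm_iff, simp_all)

lemma euler_factor_nonzero:
  assumes "norm (q::complex) < 1"
  shows "1 - q ^ Suc n \<noteq> 0"
proof
  assume "1 - q ^ Suc n = 0"
  then have "norm (q ^ Suc n) = 1" by (metis norm_one right_minus_eq)
  then show False using norm_power_Suc_less_1[OF assms, of n] by simp
qed

lemma convergent_euler:
  assumes "norm (q::complex) < 1"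
  shows "convergent_prod (\<lambda>n. 1 - q ^ Suc n)"
proof -
  have "summable (\<lambda>n. norm q * norm q ^ n)"
    using assms by (intro summable_mult summable_geometric) simp
  then have "summable (\<lambda>n. norm ((1 - q ^ Suc n) - 1))" by (simp add: norm_mult norm_power)
  then show ?thesis
    using abs_convergent_prod_conv_summable abs_convergent_prod_imp_convergent_prod by blast
qed

lemma euler_prod_nonzero: "norm q < 1 \<Longrightarrow> euler_prod q \<noteq> 0"
  unfolding euler_prod_def by (rule prodinf_nonzero[OF convergent_euler euler_factor_nonzero])

lemma uniform_limit_euler_prod:
  assumes "\<rho> < 1" "0 \<le> \<rho>"
  shows "uniform_limit (cball 0 \<rho>) (\<lambda>n q. \<Prod>k<n. 1 - q ^ Suc k) euler_prod sequentially"
proof -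
  have "uniformly_convergent_on (cball 0 \<rho>) (\<lambda>n q. \<Prod>k<n. 1 - q ^ Suc k :: complex)"
  proof (rule uniformly_convergent_on_prod')
    show "uniformly_convergent_on (cball 0 \<rho>) (\<lambda>N x. \<Sum>n<N. norm (1 - x ^ Suc n - 1 :: complex))"
    proof (rule Weierstrass_m_test')
      fix n and x :: complex assume "x \<in> cball 0 \<rho>"
      then have "norm x \<le> \<rho>" by simp
      then have "norm x ^ Suc n \<le> \<rho> ^ Suc n" by (intro power_mono) auto
      then show "norm (norm (1 - x ^ Suc n - 1)) \<le> \<rho> ^ Suc n" by (simp add: norm_power norm_mult)
    next
      have "summable (\<lambda>n. \<rho> * \<rho> ^ n)" using assms by (intro summable_mult summable_geometric) simp
      then show "summable (\<lambda>n. \<rho> ^ Suc n)" by simp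
    qed
  qed (auto intro!: continuous_intros)
  then have ul: "uniform_limit (cball 0 \<rho>) (\<lambda>n q. \<Prod>k<n. 1 - q ^ Suc k :: complex)
      (\<lambda>q. lim (\<lambda>n. \<Prod>k<n. 1 - q ^ Suc k)) sequentially"
    by (simp only: uniformly_convergent_uniform_limit_iff)
  have "lim (\<lambda>n. \<Prod>k<n. 1 - q ^ Suc k) = euler_prod q" if "q \<in> cball 0 \<rho>" for q :: complex
  proof -
    have "norm q < 1" using that assms by simp
    then show ?thesis unfolding euler_prod_def
      by (intro prodinf_eq_lim'[symmetric] convergent_euler euler_factor_nonzero)
  qed
  then show ?thesis using ul uniform_limit_cong'[of "cball 0 \<rho>" "\<lambda>n q. \<Prod>k<n. 1 - q ^ Suc k"
        "\<lambda>n q. \<Prod>k<n. 1 - q ^ Suc k" "\<lambda>q. lim (\<lambda>n. \<Prod>k<n. 1 - q ^ Suc k)" euler_prod sequentially] by blast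
qed

lemma holomorphic_euler_prod: "euler_prod holomorphic_on ball 0 1"
proof (rule holomorphic_uniform_sequence[where f = "\<lambda>n q. \<Prod>k<n. 1 - q ^ Suc k"])
  fix x :: complex assume "x \<in> ball 0 1"
  then have x: "norm x < 1" by simp
  define d where "d = (1 - norm x) / 2"
  have sub: "cball x d \<subseteq> cball 0 (norm x + d)"
  proof
    fix y assume "y \<in> cball x d"
    then have "norm (y - x) \<le> d" by (simp add: dist_norm norm_minus_commute)
    then show "y \<in> cball 0 (norm x + d)" using norm_triangle_sub[of y x] by simp
  qed
  have "cball 0 (norm x + d) \<subseteq> (ball 0 1 :: complex set)" using x by (auto simp: d_def field_simps)
  moreover have "uniform_limit (cball x d) (\<lambda>n q. \<Prod>k<n. 1 - q ^ Suc k) euler_prod sequentially"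
    using x by (intro uniform_limit_on_subset[OF uniform_limit_euler_prod sub]) (auto simp: d_def field_simps)
  moreover have "d > 0" using x by (simp add: d_def)
  ultimately show "\<exists>d>0. cball x d \<subseteq> ball 0 1 \<and> uniform_limit (cball x d) (\<lambda>n q. \<Prod>k<n. 1 - q ^ Suc k) euler_prod sequentially"
    using sub by blast
qed (auto intro!: holomorphic_intros)

lemma euler_prod_0: "euler_prod 0 = 1"
  by (simp add: euler_prod_def)

text \<open>Only the factor \<open>1 - q\<close> has a nonzero derivative at 0, so every nonempty
  partial product has derivative -1 there; locally uniform convergence passes this on to the
  limit.\<close>

lemma has_field_derivative_euler_prod_0: "(euler_prod has_field_derivative -1) (at 0)"
proof -
  have d: "((\<lambda>q. \<Prod>k<Suc n. 1 - q ^ Suc k) has_field_derivative -1) (at (0::complex))" for n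
  proof (induction n)
    case 0
    show ?case by (auto intro!: derivative_eq_intros)
  next
    case (Suc n)
    have "((\<lambda>q. 1 - q ^ Suc (Suc n)) has_field_derivative 0) (at (0::complex))"
      by (auto intro!: derivative_eq_intros)
    from DERIV_mult[OF Suc this] show ?case by (simp add: power_0_left)
  qed
  have "uniform_limit (ball 0 (1/2)) (\<lambda>n q. \<Prod>k<n. 1 - q ^ Suc k) euler_prod sequentially"
    by (rule uniform_limit_on_subset[OF uniform_limit_euler_prod[of "1/2"]]) auto
  then have "((\<lambda>n. (deriv ^^ 1) (\<lambda>q. \<Prod>k<n. 1 - q ^ Suc k) 0) \<longlongrightarrow> (deriv ^^ 1) euler_prod 0) sequentially"
    by (rule higher_deriv_complex_uniform_limit) (auto intro!: always_eventually holomorphic_intros)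
  then have "(\<lambda>n. deriv (\<lambda>q. \<Prod>k<n. 1 - q ^ Suc k) 0) \<longlonglongrightarrow> deriv euler_prod 0" by simp
  \<comment> \<open>The shift skips the empty product, whose derivative is 0.\<close>
  then have "(\<lambda>n. deriv (\<lambda>q. \<Prod>k<Suc n. 1 - q ^ Suc k) 0) \<longlonglongrightarrow> deriv euler_prod 0"
    by (rule LIMSEQ_Suc)
  moreover have "deriv (\<lambda>q. \<Prod>k<Suc n. 1 - q ^ Suc k) (0::complex) = -1" for n
    using d by (rule DERIV_imp_deriv)
  ultimately have "(\<lambda>n. -1 :: complex) \<longlonglongrightarrow> deriv euler_prod 0" by (simp only:)
  then have "deriv euler_prod 0 = -1" using LIMSEQ_unique[OF _ tendsto_const] by blast
  moreover have "(euler_prod has_field_derivative deriv euler_prod 0) (at 0)"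
    by (rule holomorphic_derivI[OF holomorphic_euler_prod]) auto
  ultimately show ?thesis by simp
qed

definition eta_qfun :: "(nat \<Rightarrow> int) \<Rightarrow> nat \<Rightarrow> complex \<Rightarrow> complex" where
  "eta_qfun r N q = (\<Prod>n\<in>{n. n dvd N}. euler_prod (q ^ n) powi r n)"

lemma norm_power_less_1: "norm (q::complex) < 1 \<Longrightarrow> n > 0 \<Longrightarrow> norm (q ^ n) < 1"
  using norm_power_Suc_less_1[of q "n - 1"] by simp

text \<open>The fractional powers of \<open>q\<close> multiply to \<open>ee\<close> of
  \<open>\<tau> / 24\<close> times the sum of \<open>n r_n\<close>, which is 1. What is left extends
  holomorphically to \<open>q = 0\<close>.\<close>

lemma eta_quotient_eq_qfun:
  assumes N: "N > 0" and sum0: "(\<Sum>n\<in>{n. n dvd N}. int n * r n) = 0"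
  shows "eta_quotient r N \<tau> = eta_qfun r N (ee \<tau>)"
proof -
  let ?S = "{n. n dvd N}"
  have e: "eta (of_nat n * \<tau>) powi r n = ee (of_int (int n * r n) * (\<tau> / 24)) * euler_prod (ee \<tau> ^ n) powi r n" for n
    unfolding eta_def euler_prod_def power_int_mult_distrib ee_power_int ee_of_nat_mult
    by (simp add: mult_ac)
  have "eta_quotient r N \<tau> = (\<Prod>n\<in>?S. ee (of_int (int n * r n) * (\<tau> / 24))) * eta_qfun r N (ee \<tau>)"
    unfolding eta_quotient_def e eta_qfun_def prod.distrib ..
  also have "(\<Prod>n\<in>?S. ee (of_int (int n * r n) * (\<tau> / 24))) = ee (of_int (\<Sum>n\<in>?S. int n * r n) * (\<tau> / 24))"
  proof -
    have "(\<Prod>n\<in>X. ee (of_int (int n * r n) * (\<tau> / 24))) = ee (of_int (\<Sum>n\<in>X. int n * r n) * (\<tau> / 24))" if "finite X" for X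
      using that
    proof (induction X)
      case (insert n X)
      then show ?case
        by (simp only: sum.insert[OF insert(1,2)] prod.insert[OF insert(1,2)] of_int_add distrib_right ee_add)
    qed simp
    then show ?thesis using N by simp
  qed
  finally show ?thesis unfolding sum0 by simp
qed

lemma divisor_pos: "N > 0 \<Longrightarrow> n \<in> {n. n dvd N} \<Longrightarrow> n > (0::nat)"
  by (auto intro: Nat.gr0I)

lemma eta_qfun_nonzero: "N > 0 \<Longrightarrow> norm q < 1 \<Longrightarrow> eta_qfun r N q \<noteq> 0"
  using euler_prod_nonzero[OF norm_power_less_1[OF _ divisor_pos]] by (simp add: eta_qfun_def)

lemma holomorphic_eta_qfun:
  assumes "N > 0"
  shows "eta_qfun r N holomorphic_on ball 0 1"
  unfolding eta_qfun_def
proof (intro holomorphic_on_prod holomorphic_on_power_int)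
  fix n assume n: "n \<in> {n. n dvd N}"
  have n0: "n > 0" using divisor_pos[OF assms n] .
  have "(euler_prod \<circ> (\<lambda>q. q ^ n)) holomorphic_on ball 0 1"
  proof (rule holomorphic_on_compose_gen[OF _ holomorphic_euler_prod])
    show "(\<lambda>q. q ^ n) holomorphic_on ball 0 1" by (intro holomorphic_intros)
    show "(\<lambda>q. q ^ n) ` ball 0 1 \<subseteq> (ball 0 1 :: complex set)"
      using norm_power_less_1[OF _ n0] by auto
  qed
  then show "(\<lambda>q. euler_prod (q ^ n)) holomorphic_on ball 0 1" by (simp add: o_def)
  show "0 \<le> r n \<or> (\<forall>z\<in>ball 0 1. euler_prod (z ^ n) \<noteq> 0)"
    using euler_prod_nonzero[OF norm_power_less_1[OF _ n0]] by simp
qed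

text \<open>The factor for \<open>n\<close> starts with \<open>1 - r_n q^n\<close>, so
  \<open>n = 1\<close> alone contributes to the linear term.\<close>

lemma has_field_derivative_eta_qfun_0:
  assumes "N > 0"
  shows "(eta_qfun r N has_field_derivative - of_int (r 1)) (at 0)" "eta_qfun r N 0 = 1"
proof -
  have f0: "euler_prod (0 ^ n) powi r n = 1" if "n > 0" for n
    using that by (simp add: euler_prod_0 power_0_left)
  have fd: "((\<lambda>q. euler_prod (q ^ n) powi r n) has_field_derivative (if n = 1 then - of_int (r n) else 0)) (at 0)"
    if n: "n > 0" for n
  proof -
    have z: "0 ^ n = (0::complex)" using n by simp
    have "((\<lambda>q. q ^ n) has_field_derivative of_nat n * 0 ^ (n - 1)) (at (0::complex))"
      by (auto intro!: derivative_eq_intros)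
    moreover have "(euler_prod has_field_derivative -1) (at (0 ^ n))"
      unfolding z by (rule has_field_derivative_euler_prod_0)
    ultimately have "((\<lambda>q. euler_prod (q ^ n)) has_field_derivative -1 * (of_nat n * 0 ^ (n - 1))) (at 0)"
      using DERIV_chain2[of euler_prod "-1" "\<lambda>q. q ^ n"] by blast
    then have "((\<lambda>q. euler_prod (q ^ n) powi r n) has_field_derivative
        of_int (r n) * euler_prod (0 ^ n) powi (r n - 1) * (-1 * (of_nat n * 0 ^ (n - 1)))) (at 0)"
      by (rule DERIV_power_int) (simp add: z euler_prod_0)
    then show ?thesis using n unfolding z euler_prod_0 by (cases "n = 1") (simp_all add: power_0_left)
  qed
  have main: "((\<lambda>q. \<Prod>n\<in>X. euler_prod (q ^ n) powi r n) has_field_derivative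
      (\<Sum>n\<in>X. if n = 1 then - of_int (r n) else 0)) (at 0) \<and> (\<Prod>n\<in>X. euler_prod (0 ^ n) powi r n) = 1"
    if "finite X" "\<And>n. n \<in> X \<Longrightarrow> n > 0" for X
    using that
  proof (induction X)
    case (insert n X)
    have n: "n > 0" and IH: "((\<lambda>q. \<Prod>n\<in>X. euler_prod (q ^ n) powi r n) has_field_derivative
      (\<Sum>n\<in>X. if n = 1 then - of_int (r n) else 0)) (at 0)" "(\<Prod>n\<in>X. euler_prod (0 ^ n) powi r n) = 1"
      using insert by auto
    from DERIV_mult[OF fd[OF n] IH(1)]
    show ?case unfolding IH(2) f0[OF n] sum.insert[OF insert(1,2)] prod.insert[OF insert(1,2)]
      by (simp only: mult_1_right mult_1_left)
  qed simp
  have fin: "finite {n. n dvd N}" using assms by simp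
  note * = main[OF fin divisor_pos[OF assms]]
  show "eta_qfun r N 0 = 1" unfolding eta_qfun_def using * by blast
  have "(\<Sum>n\<in>{n. n dvd N}. if n = 1 then - of_int (r n) else 0 :: complex) = - of_int (r 1)"
    using fin by simp
  moreover have "eta_qfun r N = (\<lambda>q. \<Prod>n\<in>{n. n dvd N}. euler_prod (q ^ n) powi r n)"
    by (intro ext) (simp only: eta_qfun_def)
  ultimately show "(eta_qfun r N has_field_derivative - of_int (r 1)) (at 0)" using * by metis
qed

text \<open>The Taylor coefficients of \<open>eta_qfun\<close> at 0 satisfy the description that
  defines \<open>eta_coeff\<close>, and \<open>qseries_unique\<close> makes them the only
  solution.\<close>

lemma eta_coeff_expansion:
  assumes N: "N > 0" and sum0: "(\<Sum>n\<in>{n. n dvd N}. int n * r n) = 0"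
  shows "\<tau> \<in> upper \<Longrightarrow> (\<lambda>n. eta_coeff r N n * ee \<tau> ^ n) sums eta_quotient r N \<tau>"
    and "eta_coeff r N 0 = 1" and "eta_coeff r N 1 = - of_int (r 1)"
proof -
  define c where "c = (\<lambda>n. (deriv ^^ n) (eta_qfun r N) 0 / fact n)"
  have c: "(\<lambda>n. c n * ee \<tau> ^ n) sums eta_quotient r N \<tau>" if "\<tau> \<in> upper" for \<tau>
    using holomorphic_power_series[OF holomorphic_eta_qfun[OF N], of "ee \<tau>" r] norm_ee_less_1[OF that]
    unfolding eta_quotient_eq_qfun[OF N sum0] c_def by simp
  have eq: "eta_coeff r N = c"
    unfolding eta_coeff_def
  proof (rule the_equality)
    show "\<forall>\<tau>\<in>upper. (\<lambda>n. c n * ee \<tau> ^ n) sums eta_quotient r N \<tau>" using c by blast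
    fix c' assume "\<forall>\<tau>\<in>upper. (\<lambda>n. c' n * ee \<tau> ^ n) sums eta_quotient r N \<tau>"
    then show "c' = c" using c by (intro qseries_unique[of c' "eta_quotient r N" c]) auto
  qed
  show "\<tau> \<in> upper \<Longrightarrow> (\<lambda>n. eta_coeff r N n * ee \<tau> ^ n) sums eta_quotient r N \<tau>" using c eq by simp
  show "eta_coeff r N 0 = 1" "eta_coeff r N 1 = - of_int (r 1)"
    unfolding eq c_def using has_field_derivative_eta_qfun_0[OF N, of r] by (simp_all add: DERIV_imp_deriv)
qed

lemma eta_quotient_nonzero:
  assumes "N > 0" "(\<Sum>n\<in>{n. n dvd N}. int n * r n) = 0" "\<tau> \<in> upper"
  shows "eta_quotient r N \<tau> \<noteq> 0"
  using eta_quotient_eq_qfun[OF assms(1,2)] eta_qfun_nonzero[OF assms(1) norm_ee_less_1[OF assms(3)]] by simp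

section \<open>Fourier expansions on the upper half plane\<close>

text \<open>Both growth conditions at a cusp become statements about a holomorphic function
  \<open>S\<close> near 0. Its series converges on the whole disc because every
  \<open>q \<noteq> 0\<close> in the disc comes from a point of the upper half plane.\<close>

lemma qexp_series:
  assumes h: "h > 0" and s: "\<And>\<tau>. \<tau> \<in> upper \<Longrightarrow> (\<lambda>n. c n * ee (of_real ((of_nat n + \<kappa>) / h) * \<tau>)) sums g \<tau>"
  obtains S where "S holomorphic_on ball 0 1" "S 0 = c 0"
    "\<And>\<tau>. \<tau> \<in> upper \<Longrightarrow> g \<tau> = ee (of_real (\<kappa> / h) * \<tau>) * S (ee (\<tau> / of_real h))"
proof -
  have split: "ee (of_real ((of_nat n + \<kappa>) / h) * \<tau>) = ee (of_real (\<kappa> / h) * \<tau>) * ee (\<tau> / of_real h) ^ n" for n \<tau>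
  proof -
    have "of_real ((of_nat n + \<kappa>) / h) * \<tau> = of_real (\<kappa> / h) * \<tau> + of_nat n * (\<tau> / of_real h)"
      using h by (simp add: field_simps)
    then show ?thesis by (simp only: ee_add ee_of_nat_mult)
  qed
  have sums: "(\<lambda>n. c n * ee (\<tau> / of_real h) ^ n) sums (g \<tau> / ee (of_real (\<kappa> / h) * \<tau>))" if "\<tau> \<in> upper" for \<tau>
    using sums_divide[OF s[OF that], of "ee (of_real (\<kappa> / h) * \<tau>)"] unfolding split by simp
  define S where "S = (\<lambda>q. \<Sum>n. c n * q ^ n)"
  have S: "(\<lambda>n. c n * (q - 0) ^ n) sums S q" if "q \<in> ball 0 1" for q
  proof (cases "q = 0")
    case True
    show ?thesis unfolding S_def True diff_0_right by (rule summable_sums, rule summable_finite[of "{0}"]) auto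
  next
    case False
    obtain \<tau> where "\<tau> \<in> upper" "ee (\<tau> / of_real h) = q" using ex_ee_eq[OF False _ h] \<open>q \<in> ball 0 1\<close> by auto
    from sums[OF this(1)] this(2) show ?thesis unfolding S_def by (simp add: sums_summable summable_sums)
  qed
  have "S holomorphic_on ball 0 1" using S by (rule power_series_holomorphic)
  moreover have "S 0 = c 0" unfolding S_def by (rule powser_zero)
  moreover have "g \<tau> = ee (of_real (\<kappa> / h) * \<tau>) * S (ee (\<tau> / of_real h))" if "\<tau> \<in> upper" for \<tau>
    using sums_unique[OF sums[OF that]] unfolding S_def by (simp add: field_simps)
  ultimately show ?thesis using that by blast
qed

text \<open>The bound is needed above every height \<open>y\<close>, because
  \<open>\<tau> \<mapsto> (a' \<tau> + b') / d'\<close> scales heights by \<open>a' / d'\<close>,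
  which may be less than 1.\<close>

lemma qexp_nonneg_bounded:
  assumes "qexp_nonneg g" "y > 0"
  obtains B where "\<And>\<tau>. Im \<tau> \<ge> y \<Longrightarrow> norm (g \<tau>) \<le> B"
proof -
  obtain h \<kappa> :: real and c where h: "h > 0" "\<kappa> \<ge> 0"
    and s: "\<And>\<tau>. \<tau> \<in> upper \<Longrightarrow> (\<lambda>n. c n * ee (of_real ((of_nat n + \<kappa>) / h) * \<tau>)) sums g \<tau>"
    using assms(1) unfolding qexp_nonneg_def by blast
  obtain S where S: "S holomorphic_on ball 0 1"
    "\<And>\<tau>. \<tau> \<in> upper \<Longrightarrow> g \<tau> = ee (of_real (\<kappa> / h) * \<tau>) * S (ee (\<tau> / of_real h))"
    using qexp_series[OF h(1) s] by metis
  define \<rho> where "\<rho> = exp (- 2 * pi * y / h)"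
  have \<rho>: "\<rho> < 1" using assms(2) h by (simp add: \<rho>_def)
  have "continuous_on (cball 0 \<rho>) S"
    by (rule holomorphic_on_imp_continuous_on[OF holomorphic_on_subset[OF S(1)]]) (use \<rho> in auto)
  then have "compact (S ` cball 0 \<rho>)" by (rule compact_continuous_image) simp
  then obtain B where B: "\<And>q. q \<in> cball 0 \<rho> \<Longrightarrow> norm (S q) \<le> B"
    by (meson bounded_iff compact_imp_bounded imageI)
  have "norm (g \<tau>) \<le> B" if "Im \<tau> \<ge> y" for \<tau>
  proof -
    have u: "\<tau> \<in> upper" using that assms(2) by (simp add: upper_def)
    have "norm (ee (of_real (\<kappa> / h) * \<tau>)) \<le> 1"
      using that assms(2) h by (simp add: norm_ee zero_le_mult_iff)
    moreover have "norm (ee (\<tau> / of_real h)) \<le> \<rho>"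
      using that h by (simp add: norm_ee \<rho>_def divide_right_mono)
    then have "norm (S (ee (\<tau> / of_real h))) \<le> B" using B by simp
    ultimately have "norm (ee (of_real (\<kappa> / h) * \<tau>)) * norm (S (ee (\<tau> / of_real h))) \<le> 1 * B"
      by (intro mult_mono) auto
    then show ?thesis using S(2)[OF u] by (simp add: norm_mult)
  qed
  then show ?thesis using that by blast
qed

lemma qexp_pos_tendsto_0:
  assumes "qexp_pos g"
  shows "((\<lambda>y. g (\<i> * of_real y)) \<longlongrightarrow> 0) at_top"
proof -
  obtain h \<kappa> :: real and c where h: "h > 0" "\<kappa> \<ge> 0" and pos: "\<And>n. c n \<noteq> 0 \<Longrightarrow> of_nat n + \<kappa> > 0"
    and s: "\<And>\<tau>. \<tau> \<in> upper \<Longrightarrow> (\<lambda>n. c n * ee (of_real ((of_nat n + \<kappa>) / h) * \<tau>)) sums g \<tau>"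
    using assms(1) unfolding qexp_pos_def by blast
  obtain S where S: "S holomorphic_on ball 0 1" "S 0 = c 0"
    "\<And>\<tau>. \<tau> \<in> upper \<Longrightarrow> g \<tau> = ee (of_real (\<kappa> / h) * \<tau>) * S (ee (\<tau> / of_real h))"
    using qexp_series[OF h(1) s] by metis
  have ex: "((\<lambda>y. ee (of_real a * (\<i> * of_real y))) \<longlongrightarrow> 0) at_top" if "a > 0" for a
  proof (rule tendsto_norm_zero_cancel)
    have "((\<lambda>y. exp (- (2 * pi * a * y))) \<longlongrightarrow> 0) at_top"
      using that by (intro filterlim_compose[OF exp_at_bot] filterlim_uminus_at_bot_at_top[THEN filterlim_compose]
          filterlim_tendsto_pos_mult_at_top[OF tendsto_const] filterlim_ident) auto
    then show "((\<lambda>y. norm (ee (of_real a * (\<i> * of_real y)))) \<longlongrightarrow> 0) at_top"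
      by (simp add: norm_ee mult_ac)
  qed
  have q: "((\<lambda>y. ee (\<i> * of_real y / of_real h)) \<longlongrightarrow> 0) at_top"
    using ex[of "1 / h"] h(1) by simp
  have "isCont S 0"
    using S(1) holomorphic_on_imp_continuous_on continuous_on_eq_continuous_at open_ball centre_in_ball zero_less_one by blast
  then have Sl: "((\<lambda>y. S (ee (\<i> * of_real y / of_real h))) \<longlongrightarrow> c 0) at_top"
    using isCont_tendsto_compose[OF _ q] S(2) by metis
  have "((\<lambda>y. ee (of_real (\<kappa> / h) * (\<i> * of_real y)) * S (ee (\<i> * of_real y / of_real h))) \<longlongrightarrow> 0) at_top"
  proof (cases "\<kappa> > 0")
    case True
    then show ?thesis using tendsto_mult[OF ex[of "\<kappa> / h"] Sl] h by simp
  next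
    case False
    then have "\<kappa> = 0" "c 0 = 0" using h pos[of 0] by auto
    then show ?thesis using Sl by simp
  qed
  then show ?thesis
    by (rule Lim_transform_eventually)
       (auto intro!: eventually_mono[OF eventually_gt_at_top[of 0]] simp: S(3) upper_def)
qed

lemma periodic_int_mult:
  assumes "\<And>\<tau>. \<tau> \<in> upper \<Longrightarrow> g (\<tau> + of_real h) = g \<tau>" "\<tau> \<in> upper"
  shows "g (\<tau> + of_int m * of_real h) = g \<tau>"
proof -
  have nat: "g (\<tau> + of_nat n * of_real h) = g \<tau>" if "\<tau> \<in> upper" for \<tau> n
  proof (induction n)
    case (Suc n)
    have "\<tau> + of_nat n * of_real h \<in> upper" using that by (simp add: upper_def)
    from assms(1)[OF this] Suc show ?case by (simp add: algebra_simps)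
  qed simp
  show ?thesis
  proof (cases "m \<ge> 0")
    case True
    then show ?thesis using nat[OF assms(2), of "nat m"] by simp
  next
    case False
    have "\<tau> + of_int m * of_real h \<in> upper" using assms(2) by (simp add: upper_def)
    from nat[OF this, of "nat (- m)"] False show ?thesis by simp
  qed
qed

text \<open>The function of \<open>q\<close> is differentiable at each \<open>q\<^sub>0 \<noteq> 0\<close> because periodicity allows to use the
  branch \<open>Ln (q / q\<^sub>0) + Ln q\<^sub>0\<close> of the logarithm near \<open>q\<^sub>0\<close>.\<close>
lemma periodic_bounded_expansion:
  assumes h: "h > 0" and hol: "g holomorphic_on upper"
    and per: "\<And>\<tau>. \<tau> \<in> upper \<Longrightarrow> g (\<tau> + of_real h) = g \<tau>"
    and y: "y > 0" and bd: "\<And>\<tau>. Im \<tau> \<ge> y \<Longrightarrow> norm (g \<tau>) \<le> B"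
  shows "\<exists>c. \<forall>\<tau>\<in>upper. (\<lambda>n. c n * ee (\<tau> / of_real h) ^ n) sums g \<tau>"
proof -
  define T where "T = (\<lambda>w. of_real h * w / (2 * of_real pi * \<i>))"
  define P where "P = (\<lambda>q. g (T (Ln q)))"
  have ImT: "Im (T w) = - h * Re w / (2 * pi)" for w
  proof -
    have "T w = of_real (h / (2 * pi)) * (- \<i> * w)" by (simp add: T_def field_simps)
    then show ?thesis by simp
  qed
  have Tu: "T w \<in> upper" if "norm (exp w) < 1" for w
  proof -
    have "Re w < 0" using that by simp
    then show ?thesis unfolding upper_def mem_Collect_eq ImT using h by (simp add: divide_neg_pos mult_pos_neg)
  qed
  have eeT: "ee (T w / of_real h) = exp w" for w using h by (simp add: ee_def T_def)
  have Pg: "P (exp w) = g (T w)" if "norm (exp w) < 1" for w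
  proof -
    have "exp (Ln (exp w)) = exp w" by simp
    then obtain n where n: "Ln (exp w) = w + of_int (2 * n) * of_real pi * \<i>"
      unfolding exp_eq by auto
    have "T (Ln (exp w)) = T w + of_int n * of_real h"
      unfolding n T_def by (simp add: field_simps)
    then show ?thesis unfolding P_def using periodic_int_mult[of g h, OF per Tu[OF that]] by simp
  qed
  have "P field_differentiable at q0" if q0: "q0 \<in> ball 0 1 - {0}" for q0
  proof -
    define L where "L = (\<lambda>q. Ln (q / q0) + Ln q0)"
    have "L field_differentiable at q0"
      unfolding L_def using q0 by (intro derivative_intros field_differentiable_compose[of "\<lambda>q. q / q0" _ Ln, unfolded o_def] field_differentiable_at_Ln) (auto simp: complex_nonpos_Reals_iff)
    then have dT: "(\<lambda>q. T (L q)) field_differentiable at q0"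
      unfolding T_def by (intro derivative_intros) auto
    have "norm (exp (L q0)) < 1" using q0 by (simp add: L_def)
    then have "T (L q0) \<in> upper" by (rule Tu)
    then have "g field_differentiable at (T (L q0))"
      using hol open_upper holomorphic_on_imp_differentiable_at by blast
    then have d: "(\<lambda>q. g (T (L q))) field_differentiable at q0"
      using field_differentiable_compose[OF dT, of g] by (simp add: o_def)
    have exL: "exp (L q) = q" if "q \<noteq> 0" for q using that q0 by (simp add: L_def exp_add)
    have "\<forall>\<^sub>F q in nhds q0. q \<in> ball 0 1 - {0}"
      using q0 by (intro eventually_nhds_in_open) (auto intro: open_delete)
    then have ev: "\<forall>\<^sub>F q in nhds q0. g (T (L q)) = P q"
    proof eventually_elim
      case (elim q)
      then show ?case using Pg[of "L q"] exL[of q] by simp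
    qed
    obtain D where "((\<lambda>q. g (T (L q))) has_field_derivative D) (at q0)"
      using d unfolding field_differentiable_def ..
    then show ?thesis
      unfolding field_differentiable_def DERIV_cong_ev[OF refl ev refl] by (rule exI)
  qed
  then have holP: "P holomorphic_on (ball 0 1 - {0})"
    by (simp add: holomorphic_on_def field_differentiable_at_within)
  have "\<forall>\<^sub>F q in at 0. norm (P q) \<le> B"
  proof -
    have "\<forall>\<^sub>F q in at 0. norm q < exp (- 2 * pi * y / h) \<and> q \<noteq> (0::complex)"
      unfolding eventually_at by (intro exI[of _ "exp (- 2 * pi * y / h)"]) auto
    then show ?thesis
    proof eventually_elim
      case (elim q)
      then have "ln (norm q) < - 2 * pi * y / h"
        by (metis exp_less_cancel_iff exp_ln zero_less_norm_iff)
      then have "Im (T (Ln q)) \<ge> y"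
        unfolding ImT using elim h by (simp add: Re_Ln field_simps)
      then show ?case unfolding P_def by (rule bd)
    qed
  qed
  \<comment> \<open>Boundedness high up in the half plane makes the singularity at
    \<open>q = 0\<close> removable.\<close>
  then obtain G where G: "G holomorphic_on ball 0 1" "\<And>z. z \<in> ball 0 1 - {0} \<Longrightarrow> G z = P z"
    using holomorphic_on_extend_bounded[OF holP] by auto
  have "(\<lambda>n. (deriv ^^ n) G 0 / fact n * ee (\<tau> / of_real h) ^ n) sums g \<tau>" if \<tau>: "\<tau> \<in> upper" for \<tau>
  proof -
    define w where "w = 2 * of_real pi * \<i> * \<tau> / of_real h"
    have ew: "exp w = ee (\<tau> / of_real h)" unfolding w_def ee_def by (simp only: times_divide_eq_right)
    have "(2 * of_real pi * \<i> :: complex) \<noteq> 0" by simp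
    then have Tw: "T w = \<tau>" using h by (simp add: T_def w_def del: mult_eq_0_iff)
    have "\<tau> / of_real h \<in> upper" using \<tau> h unfolding upper_def by (simp add: Im_divide_of_real)
    then have n1: "norm (exp w) < 1" unfolding ew by (rule norm_ee_less_1)
    then have "G (exp w) = g \<tau>" using G(2)[of "exp w"] Pg[OF n1] Tw by simp
    then show ?thesis using holomorphic_power_series[OF G(1), of "exp w"] n1 by (simp add: ew)
  qed
  then show ?thesis by (intro exI[of _ "\<lambda>n. (deriv ^^ n) G 0 / fact n"]) blast
qed

section \<open>Cosets of the Hecke operator\<close>

lemma coprime_6_iff: "coprime (x::int) 6 \<longleftrightarrow> odd x \<and> \<not> 3 dvd x"
proof -
  have "coprime x 6 \<longleftrightarrow> coprime x 2 \<and> coprime x 3"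
    using coprime_mult_right_iff[of x 2 3] by simp
  moreover have "coprime x 3 \<longleftrightarrow> \<not> 3 dvd x"
  proof
    assume c: "coprime x 3"
    show "\<not> 3 dvd x"
    proof
      assume "3 dvd x"
      then have "is_unit (3::int)" using coprime_common_divisor[OF c, of 3] by simp
      then show False by simp
    qed
  next
    assume "\<not> 3 dvd x"
    then show "coprime x 3" using prime_imp_coprime[of "3::int" x] by (simp add: coprime_commute)
  qed
  ultimately show ?thesis by simp
qed

text \<open>Neither 2 nor 3 divides both \<open>x\<close> and \<open>y\<close>, so a suitable shift
  exists for each of them, and explicit small shifts serve both. Further multiples of
  \<open>6 y\<close> then give positivity.\<close>

lemma ex_shift_coprime_6:
  assumes "coprime x (y::int)" "y \<noteq> 0"
  obtains s where "x + s * y > 0" "coprime (x + s * y) 6"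
proof -
  have 2: "\<not> (even x \<and> even y)" using assms(1) by (metis coprime_common_divisor odd_one)
  have 3: "\<not> (3 dvd x \<and> 3 dvd y)"
  proof
    assume "3 dvd x \<and> 3 dvd y"
    then have "is_unit (3::int)" using coprime_common_divisor[OF assms(1), of 3] by simp
    then show False by simp
  qed
  have "\<exists>s0. odd (x + s0 * y) \<and> \<not> 3 dvd (x + s0 * y)"
  proof (cases "even x")
    case True
    then have oy: "odd y" using 2 by blast
    show ?thesis
    proof (cases "3 dvd x")
      case t: True
      then have "\<not> 3 dvd y" using 3 by blast
      then have "\<not> 3 dvd x + 1 * y" using t by (simp add: dvd_add_right_iff)
      moreover have "odd (x + 1 * y)" using True oy by simp
      ultimately show ?thesis by blast
    next
      case False
      then have "\<not> 3 dvd x + 3 * y" by presburger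
      moreover have "odd (x + 3 * y)" using True oy by simp
      ultimately show ?thesis by blast
    qed
  next
    case ox: False
    show ?thesis
    proof (cases "3 dvd x")
      case t: True
      then have "\<not> 3 dvd y" using 3 by blast
      then have "\<not> 3 dvd x + 4 * y" using t by presburger
      moreover have "odd (x + 4 * y)" using ox by simp
      ultimately show ?thesis by blast
    next
      case False
      then show ?thesis using ox by (intro exI[of _ 0]) simp
    qed
  qed
  then obtain s0 where s0: "odd (x + s0 * y)" "\<not> 3 dvd (x + s0 * y)" by blast
  \<comment> \<open>The sign of \<open>k\<close> makes
    \<open>k y = \<bar>z\<bar> \<bar>y\<bar> \<ge> \<bar>z\<bar>\<close>, so adding
    \<open>6 k y\<close> to \<open>z\<close> gives a positive number.\<close>
  define z k where "z = x + s0 * y" and "k = sgn y * \<bar>z\<bar>"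
  have ky: "k * y = \<bar>z\<bar> * \<bar>y\<bar>" unfolding k_def abs_sgn[of y] by (simp only: mult_ac)
  have z0: "\<bar>z\<bar> > 0" using s0 unfolding z_def[symmetric] by auto
  moreover have "1 \<le> \<bar>y\<bar>" using assms(2) by simp
  ultimately have "\<bar>z\<bar> \<le> k * y" unfolding ky by (simp add: mult_le_cancel_left1)
  then have pos: "z + 6 * (k * y) > 0" using z0 by linarith
  have eq: "x + (s0 + 6 * k) * y = z + 6 * (k * y)" by (simp add: z_def algebra_simps)
  have "odd (z + 6 * (k * y))" using s0(1) unfolding z_def[symmetric] by simp
  moreover have "\<not> 3 dvd z + 6 * (k * y)"
  proof -
    have "3 dvd 6 * (k * y)" by (rule dvd_mult2) simp
    then show ?thesis using s0(2) unfolding z_def[symmetric] by (simp add: dvd_add_left_iff)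
  qed
  ultimately show ?thesis using that[of "s0 + 6 * k"] pos unfolding eq coprime_6_iff by blast
qed

text \<open>Hermite reduction of \<open>\<beta> \<gamma>\<close>: the gcd of its first column
  becomes \<open>a'\<close>, the reduced column is completed to a unimodular
  \<open>\<gamma>'\<close> by Bezout, and \<open>\<gamma>'^-1 \<beta> \<gamma>\<close> is upper
  triangular. A common factor of \<open>a'\<close> and \<open>N\<close> would divide
  \<open>C\<close> and, being prime to \<open>a\<close>, also \<open>A\<close>, against
  \<open>det \<gamma> = 1\<close>.\<close>

lemma hecke_coset:
  fixes A B C D a b d N :: int
  assumes det: "A * D - B * C = 1" and N: "N dvd C" and a: "a > 0" and d: "d > 0" and aN: "coprime a N"
  obtains a' b' d' A' B' C' D' where "a' > 0" "a' * d' = a * d" "coprime a' N"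
    "A' * D' - B' * C' = 1" "N dvd C'"
    "a * A + b * C = A' * a'" "a * B + b * D = A' * b' + B' * d'" "d * C = C' * a'" "d * D = C' * b' + D' * d'"
proof -
  define x y z w where "x = a * A + b * C" and "y = a * B + b * D" and "z = d * C" and "w = d * D"
  define g where "g = gcd x z"
  have det2: "x * w - y * z = a * d"
  proof -
    have "x * w - y * z = a * d * (A * D - B * C)" by (simp add: x_def y_def z_def w_def algebra_simps)
    then show ?thesis using det by simp
  qed
  have "x \<noteq> 0 \<or> z \<noteq> 0" using det2 a d by (metis diff_self less_numeral_extra(3) mult_zero_left mult_zero_right mult_pos_pos)
  then have g: "g > 0" unfolding g_def by simp
  obtain A' C' where AC: "x = A' * g" "z = C' * g" "coprime A' C'"
    using gcd_coprime_exists[of x z] g unfolding g_def by auto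
  obtain u v where uv: "u * A' + v * C' = 1" using bezout_int[of A' C'] AC(3) by auto
  define b' d' where "b' = u * y + v * w" and "d' = A' * w - C' * y"
  have ad: "g * d' = a * d" unfolding d'_def det2[symmetric] AC by (simp add: algebra_simps)
  have cg: "coprime g N"
  proof (rule coprimeI)
    fix q assume q: "q dvd g" "q dvd N"
    have qC: "q dvd C" using q(2) N by (rule dvd_trans)
    have "q dvd x" using q(1) unfolding g_def by simp
    then have "q dvd a * A" using qC unfolding x_def by (simp add: dvd_add_left_iff)
    moreover have "coprime q a" using aN q(2) by (meson coprime_commute coprime_divisors dvd_refl)
    ultimately have "q dvd A" by (simp add: coprime_dvd_mult_right_iff)
    then have "q dvd A * D - B * C" using qC by simp
    then show "is_unit q" using det by simp
  qed
  have "N dvd C' * g" using N unfolding AC(2)[symmetric] z_def by simp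
  then have NC: "N dvd C'" using cg by (simp add: coprime_commute coprime_dvd_mult_left_iff)
  have e1: "A' * u - (- v) * C' = 1" using uv by (simp add: algebra_simps)
  have e2: "y = A' * b' + (- v) * d'"
  proof -
    have "A' * b' + (- v) * d' = (u * A' + v * C') * y" by (simp add: b'_def d'_def algebra_simps)
    then show ?thesis using uv by simp
  qed
  have e3: "w = C' * b' + u * d'"
  proof -
    have "C' * b' + u * d' = (u * A' + v * C') * w" by (simp add: b'_def d'_def algebra_simps)
    then show ?thesis using uv by simp
  qed
  show ?thesis
    by (rule that[OF g ad cg e1 NC AC(1)[unfolded x_def] e2[unfolded y_def] AC(2)[unfolded z_def] e3[unfolded w_def]])
qed

text \<open>The bottom row of \<open>\<gamma>' = \<beta> \<gamma> \<beta>'^-1\<close> with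
  denominators cleared. These relations are all that the comparison of characters uses about the two
  matrices.\<close>

lemma hecke_coset_relations:
  fixes a d a' d' b' C D C' D' :: int
  assumes "a > 0" "d > 0" "a' > 0" "a' * d' = a * d" "d * C = C' * a'" "d * D = C' * b' + D' * d'"
  shows "a * C' = d' * C" "a * D' = a' * D - b' * C" "d' > 0"
proof -
  show d': "d' > 0" using assms by (metis mult_pos_pos zero_less_mult_pos)
  have "a' * (a * C') = a * (d * C)" using assms(5) by (simp add: algebra_simps)
  also have "\<dots> = a' * (d' * C)" using assms(4) by (metis mult.assoc)
  finally show e: "a * C' = d' * C" using assms(3) by simp
  have "d' * (a * D') = a * (d * D) - a * C' * b'" using assms(6) by (simp add: algebra_simps)
  also have "\<dots> = d' * (a' * D - b' * C)"
    unfolding e mult.assoc[symmetric] assms(4)[symmetric] by (simp add: algebra_simps)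
  finally show "a * D' = a' * D - b' * C" using d' by simp
qed

text \<open>Replacing \<open>b'\<close> by \<open>b' + t d'\<close> replaces \<open>D'\<close> by \<open>D' - t C'\<close>.\<close>
lemma hecke_coset_normalised:
  fixes A B C D a b d N Q :: int
  assumes det: "A * D - B * C = 1" and N: "N dvd C" and a: "a > 0" and d: "d > 0" and aN: "coprime a N"
    and C: "C \<noteq> 0" and Q: "Q \<noteq> 0" "coprime (a * d) Q" "coprime D Q"
  obtains a' b' d' A' B' C' D' where "a' > 0" "d' > 0" "a' * d' = a * d" "coprime a' N"
    "A' * D' - B' * C' = 1" "N dvd C'"
    "a * A + b * C = A' * a'" "a * B + b * D = A' * b' + B' * d'" "d * C = C' * a'" "d * D = C' * b' + D' * d'"
    "Q dvd b'" "D' > 0" "coprime D' 6"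
proof -
  obtain a' b0 d' A' B0 C' D0 where h: "a' > 0" "a' * d' = a * d" "coprime a' N"
    "A' * D0 - B0 * C' = 1" "N dvd C'"
    "a * A + b * C = A' * a'" "a * B + b * D = A' * b0 + B0 * d'" "d * C = C' * a'" "d * D = C' * b0 + D0 * d'"
    by (rule hecke_coset[OF det N a d aN, of b])
  note rel = hecke_coset_relations[OF a d h(1,2,8,9)]
  have cQ: "coprime a' Q" "coprime d' Q" using Q(2) unfolding h(2)[symmetric] by simp_all
  \<comment> \<open>Solvable because \<open>d'\<close> divides \<open>a d\<close>, which is prime to
    \<open>Q\<close>.\<close>
  obtain t where t: "[d' * t = - b0] (mod Q)"
    using cong_solve_coprime_int[OF cQ(2)] by (metis cong_scalar_right mult.assoc mult_1)
  define b1 where "b1 = b0 + t * d'"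
  define D1 where "D1 = D0 - t * C'"
  have Qb1: "Q dvd b1" using t unfolding b1_def cong_iff_dvd_diff by (simp add: algebra_simps)
  have C': "C' \<noteq> 0" using rel(1,3) C a by auto
  have r1: "a * D1 = a' * D - b1 * C"
  proof -
    have "a * D1 = a * D0 - t * (a * C')" by (simp add: D1_def algebra_simps)
    then show ?thesis unfolding rel(1,2) b1_def by (simp add: algebra_simps)
  qed
  have "coprime D1 Q"
  proof (rule coprimeI)
    fix q assume q: "q dvd D1" "q dvd Q"
    have "q dvd a * D1 + b1 * C" using q Qb1 by (meson dvd_add dvd_mult dvd_mult2 dvd_trans)
    then have "q dvd a' * D" unfolding r1 by simp
    moreover have "coprime (a' * D) Q" using cQ(1) Q(3) by simp
    ultimately show "is_unit q" using q(2) coprime_common_divisor by blast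
  qed
  moreover have det1: "A' * D1 - (B0 - t * A') * C' = 1" using h(4) by (simp add: D1_def algebra_simps)
  have "coprime D1 C'"
  proof (rule coprimeI)
    fix q assume "q dvd D1" "q dvd C'"
    then have "q dvd A' * D1 - (B0 - t * A') * C'" by (meson dvd_diff dvd_mult)
    then show "is_unit q" unfolding det1 .
  qed
  \<comment> \<open>A second shift, by a multiple of \<open>Q\<close>, makes \<open>D'\<close>
    positive and prime to 6 while \<open>b'\<close> stays divisible by \<open>Q\<close>. It moves
    \<open>D1\<close> by multiples of \<open>Q C'\<close>, hence this coprimality.\<close>
  ultimately have "coprime D1 (Q * C')" by simp
  then obtain s where s: "D1 + s * (Q * C') > 0" "coprime (D1 + s * (Q * C')) 6"
    using ex_shift_coprime_6[of D1 "Q * C'"] Q(1) C' by auto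
  define b' B' D' where "b' = b1 - s * Q * d'" and "B' = B0 - t * A' + s * Q * A'" and "D' = D1 + s * (Q * C')"
  show ?thesis
  proof (rule that[OF h(1) rel(3) h(2,3) _ h(5,6) _ h(8)])
    show "A' * D' - B' * C' = 1" using det1 by (simp add: D'_def B'_def algebra_simps)
    show "a * B + b * D = A' * b' + B' * d'" using h(7) by (simp add: b'_def B'_def b1_def algebra_simps)
    show "d * D = C' * b' + D' * d'" using h(9) by (simp add: b'_def D'_def D1_def b1_def algebra_simps)
    show "Q dvd b'" using Qb1 by (simp add: b'_def)
    show "D' > 0" "coprime D' 6" using s by (simp_all add: D'_def)
  qed
qed

text \<open>Units modulo 24 have square 1: \<open>a^2 - 1\<close> is divisible by 8 for odd
  \<open>a\<close> and by 3 for \<open>a\<close> prime to 3. This removes \<open>a^2\<close> from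
  the exponent of the character.\<close>

lemma dvd_24_square:
  assumes "m dvd 24" "coprime a (m::int)"
  shows "m dvd a * a - 1"
proof -
  have 8: "8 dvd a * a - 1" if odd_a: "odd a"
  proof -
    obtain j where j: "a = 2 * j + 1" using odd_a by (elim oddE)
    have "even (j * (j + 1))" by simp
    then obtain k where "j * (j + 1) = 2 * k" by (elim evenE)
    then have "a * a - 1 = 8 * k" by (simp add: j algebra_simps)
    then show ?thesis by simp
  qed
  have 3: "3 dvd a * a - 1" if "\<not> 3 dvd a"
  proof -
    have "3 dvd a - 1 \<or> 3 dvd a + 1" using that by presburger
    then have "3 dvd (a - 1) * (a + 1)" by auto
    then show ?thesis by (simp add: algebra_simps)
  qed
  have odd: "odd a" if "even m" using assms(2) that by (metis coprime_common_divisor odd_one)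
  have n3: "\<not> 3 dvd a" if "3 dvd m"
  proof
    assume "3 dvd a"
    then have "is_unit (3::int)" using coprime_common_divisor[OF assms(2), of 3] that by simp
    then show False by simp
  qed
  have 24: "3 dvd T \<Longrightarrow> 8 dvd T \<Longrightarrow> 24 dvd T" for T :: int by presburger
  show ?thesis
  proof (cases "even m")
    case True
    show ?thesis
    proof (cases "3 dvd m")
      case t: True
      then have "24 dvd a * a - 1" using 24 3[OF n3] 8[OF odd] True by blast
      then show ?thesis using assms(1) by (rule dvd_trans[rotated])
    next
      case False
      then have "coprime m 3" using prime_imp_coprime[of "3::int" m] by (simp add: coprime_commute)
      moreover have "m dvd 3 * 8" using assms(1) by simp
      ultimately have "m dvd 8" by (simp only: coprime_dvd_mult_right_iff)
      then show ?thesis using 8[OF odd[OF True]] by (rule dvd_trans)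
    qed
  next
    case False
    then have "coprime m 2" by simp
    then have "coprime m (2 ^ 3)" by (simp only: coprime_power_right_iff simp_thms)
    then have "coprime m 8" by simp
    moreover have "m dvd 8 * 3" using assms(1) by simp
    ultimately have m3: "m dvd 3" by (simp only: coprime_dvd_mult_right_iff)
    show ?thesis
    proof (cases "3 dvd m")
      case True
      then show ?thesis using m3 3[OF n3] by (meson dvd_trans)
    next
      case False
      then have "coprime m 3" using prime_imp_coprime[of "3::int" m] by (simp add: coprime_commute)
      then have "is_unit m" using m3 by (meson coprime_common_divisor dvd_refl)
      then show ?thesis by (rule unit_imp_dvd)
    qed
  qed
qed

text \<open>\<open>(x - 1) (y - 1)\<close> is divisible by 4. Multiplicative relations between odd
  entries thereby become additive ones, as exponents of \<open>e(1/4)\<close> require.\<close>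

lemma odd_mult_cong_4:
  assumes "odd x" "odd (y::int)"
  shows "[x * y = x + y - 1] (mod 4)"
proof -
  obtain i j where "x = 2 * i + 1" "y = 2 * j + 1" using assms by (elim oddE)
  then have "x * y - (x + y - 1) = 4 * (i * j)" by (simp add: algebra_simps)
  then show ?thesis unfolding cong_iff_dvd_diff by simp
qed

section \<open>Arithmetic of the index l, and the comparison of characters\<close>

locale eta_hecke =
  fixes r :: "nat \<Rightarrow> int" and N l :: nat
  assumes N: "N > 0" and sum0: "(\<Sum>n\<in>{n. n dvd N}. int n * r n) = 0"
    and l: "l > 0" and l_cong: "[int l = 1] (mod m_f r N)"
    and l_square: "odd (wt2 r N) \<Longrightarrow> \<exists>t. l = t ^ 2"
    and l_sqfree: "\<And>p. prime p \<Longrightarrow> \<not> p dvd N \<Longrightarrow> \<not> p ^ 2 dvd l"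
    and l_odd: "odd l \<or> odd N"
begin

definition "w = wt2 r N"
definition "M = (\<Sum>n\<in>{n. n dvd N}. int (N div n) * r n)"
definition "v = varpi r N"
definition "\<delta> = delta_of v"
definition "m = m_f r N"

text \<open>Dictated by \<open>char_ratio\<close>: the symbol compensates the change of
  \<open>kronecker D v\<close>, the phase that of the factor of \<open>\<chi>\<close> depending on
  \<open>D\<close> modulo 4. The \<open>l\<close> inside the phase normalises
  \<open>\<psi> 1 = 1\<close>.\<close>

definition \<psi> :: "int \<Rightarrow> complex" where
  "\<psi> a = of_int (kronecker a v) * (if odd l then ee (of_real ((real_of_int w / 2 + real \<delta>) * of_int (int l - int l div a) / 4)) else 1)"

text \<open>As the sum of \<open>n r_n\<close> is 0, \<open>m\<close> equals
  \<open>24 / gcd(24, M)\<close>, so \<open>e(x M / 24)\<close> depends only on \<open>x\<close>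
  modulo \<open>m\<close>.\<close>

lemma m_pos: "m > 0" and m_dvd_24: "m dvd 24" and m_M: "24 dvd m * M"
proof -
  define g where "g = gcd 24 M"
  have m: "m = 24 div g" unfolding m_def m_f_def M_def g_def sum0 by simp
  have g: "g > 0" "g dvd 24" "g dvd M" by (simp_all add: g_def)
  then have mg: "m * g = 24" by (simp add: m)
  show "m > 0" using mg g(1) by (metis zero_less_mult_pos2 zero_less_numeral)
  show "m dvd 24" using mg by (metis dvd_triv_left)
  obtain k where "M = g * k" using g(3) by (elim dvdE)
  then have "m * M = 24 * k" using mg by (simp add: mult.assoc[symmetric])
  then show "24 dvd m * M" by simp
qed

lemma coprime_l_m: "coprime (int l) m"
  using l_cong unfolding m_def by (metis cong_imp_coprime cong_sym coprime_1_left)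

lemma finite_divisors: "finite {n. n dvd N}"
  using N by simp

lemma div_N: "n \<in> {n. n dvd N} \<Longrightarrow> N div n > 0 \<and> N div n dvd N"
  using N by (auto elim!: dvdE)

lemma coprime_varpi: "coprime x (int N) \<Longrightarrow> coprime x (int v)"
  unfolding v_def varpi_def of_nat_prod of_nat_power
proof (rule prod_coprime_right)
  fix n assume n: "n \<in> {n. n dvd N}" and x: "coprime x (int N)"
  have "int (N div n) dvd int N" using div_N[OF n] by (simp only: int_dvd_int_iff)
  then have "coprime x (int (N div n))" using x by (meson coprime_divisors dvd_refl)
  then show "coprime x (int (N div n) ^ nat \<bar>r n\<bar>)" by (simp only: coprime_power_right_iff simp_thms)
qed

lemma prime_dvd_varpi: "prime p \<Longrightarrow> p dvd v \<Longrightarrow> p dvd N"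
proof (rule ccontr)
  assume p: "prime p" "p dvd v" "\<not> p dvd N"
  then have "coprime p N" by (simp add: prime_imp_coprime)
  then have "coprime (int p) (int N)" by simp
  from coprime_varpi[OF this] have "coprime p v" by simp
  then show False using p(1,2) by (metis coprime_common_divisor dvd_refl not_prime_unit)
qed

lemma delta_values: "\<delta> = 0 \<or> \<delta> = 1"
  by (simp add: \<delta>_def delta_of_def)

text \<open>For even \<open>l\<close> the number \<open>N\<close> is odd, and \<open>m\<close> is
  odd because \<open>l \<equiv> 1\<close> modulo \<open>m\<close>; hence 4 divides \<open>M\<close>.
  On the other hand \<open>M \<equiv> w + P - 1\<close> modulo 4, where
  \<open>P = 1 - 2 \<delta>\<close> is the residue of the odd number \<open>\<varpi>\<close>. So 4
  divides \<open>2 k - 2 \<delta>\<close>.\<close>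

lemma weight_parity:
  assumes "even l" "w = 2 * k"
  shows "even (k + int \<delta>)"
proof -
  have oN: "odd N" using l_odd assms by blast
  have "odd m"
  proof
    assume "even m"
    then have "[int l = 1] (mod 2)" using l_cong unfolding m_def by (rule cong_dvd_modulus[rotated])
    then show False using assms(1) by (simp add: cong_def)
  qed
  then have "coprime m 2" by simp
  then have "coprime m (2 ^ 2)" by (simp only: coprime_power_right_iff simp_thms)
  then have "coprime 4 m" by (simp add: coprime_commute)
  moreover have "4 dvd m * M" using m_M by (rule dvd_trans[rotated]) simp
  ultimately have M4: "4 dvd M" by (simp only: coprime_dvd_mult_right_iff)
  define x where "x = (\<lambda>n. if N div n mod 4 = 1 then 1 else -1 :: int)"
  have odd_n: "odd (N div n)" if "n \<in> {n. n dvd N}" for n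
    using div_N[OF that] oN by (meson dvd_trans)
  have xn: "[int (N div n) = x n] (mod 4)" if "n \<in> {n. n dvd N}" for n
  proof -
    have "int (N div n) mod 4 = int (N div n mod 4)" by (simp add: zmod_int)
    moreover have "odd z \<Longrightarrow> z mod 4 = 1 \<or> z mod 4 = 3" for z :: nat by presburger
    then have "N div n mod 4 = 1 \<or> N div n mod 4 = 3" using odd_n[OF that] by blast
    ultimately show ?thesis unfolding cong_def x_def by (elim disjE) simp_all
  qed
  define P where "P = (\<Prod>n\<in>{n. n dvd N}. x n ^ nat \<bar>r n\<bar>)"
  have "[M = (\<Sum>n\<in>{n. n dvd N}. r n * x n)] (mod 4)"
  proof -
    have "M = (\<Sum>n\<in>{n. n dvd N}. r n * int (N div n))" unfolding M_def by (simp only: mult.commute)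
    moreover have "[(\<Sum>n\<in>{n. n dvd N}. r n * int (N div n)) = (\<Sum>n\<in>{n. n dvd N}. r n * x n)] (mod 4)"
      by (intro cong_sum cong_mult cong_refl xn)
    ultimately show ?thesis by simp
  qed
  moreover have "[(\<Sum>n\<in>{n. n dvd N}. r n * x n) = w + P - 1] (mod 4)"
    unfolding w_def wt2_def P_def by (rule sum_sign_cong_4[OF finite_divisors]) (auto simp: x_def)
  ultimately have MP: "[M = w + P - 1] (mod 4)" by (rule cong_trans)
  have P1: "P = 1 \<or> P = -1"
  proof -
    have "\<bar>x n\<bar> = 1" for n by (simp add: x_def)
    then have "\<bar>P\<bar> = 1" unfolding P_def abs_prod by (simp add: power_abs)
    then show ?thesis by linarith
  qed
  have "[int v = P] (mod 4)"
    unfolding v_def varpi_def of_nat_prod of_nat_power P_def by (intro cong_prod cong_pow xn)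
  moreover have "int v mod 4 = int (v mod 4)" by (simp add: zmod_int)
  ultimately have vP: "int (v mod 4) = P mod 4" by (simp add: cong_def)
  have "odd v"
  proof
    assume "even v"
    then have "even N" using prime_dvd_varpi[of 2] by simp
    then show False using oN by simp
  qed
  then have "\<delta> = (if v mod 4 = 1 then 0 else 1)"
    by (simp add: \<delta>_def delta_of_def not_dvd_imp_multiplicity_0)
  then have dP: "P = 1 - 2 * int \<delta>" using P1 vP by (elim disjE) simp_all
  have "4 dvd M - (2 * k + (1 - 2 * int \<delta>) - 1)" using MP unfolding dP assms(2) cong_iff_dvd_diff .
  moreover have "4 dvd M - (2 * k + (1 - 2 * e) - 1) \<Longrightarrow> 4 dvd M \<Longrightarrow> even (k + e)" for e :: int
    by presburger
  ultimately show ?thesis using M4 by blast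
qed

text \<open>For odd \<open>w\<close> the index \<open>l\<close> is a square, so a prime dividing
  \<open>a\<close> divides \<open>l\<close> twice, and then divides \<open>N\<close>.\<close>

lemma one_sided_index:
  assumes "odd w" "a dvd l" "coprime a N"
  shows "a = 1"
proof (rule ccontr)
  assume "a \<noteq> 1"
  then obtain p where p: "prime p" "p dvd a" by (metis prime_factor_nat)
  obtain t where t: "l = t ^ 2" using l_square assms(1) unfolding w_def by blast
  have "p dvd t ^ 2" using p(2) assms(2) t by (metis dvd_trans)
  then have "p dvd t" using p(1) prime_dvd_power by blast
  then have "p ^ 2 dvd l" unfolding t by (rule dvd_power_same)
  then have "p dvd N" using l_sqfree p(1) by blast
  then show False using p assms(3) by (metis coprime_common_divisor not_prime_unit)
qed

lemma odd_weight_odd_l: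
  assumes "odd w"
  shows "odd l"
proof
  assume e: "even l"
  then have "odd N" using l_odd by blast
  then have "coprime 2 N" by simp
  then show False using one_sided_index[OF assms e] by simp
qed

text \<open>The origin of \<open>k + \<delta>\<close> in the formula. The weight part is
  \<open>e(3 k (1 - D) / 4)\<close>, where 3 may be replaced by 1 because \<open>1 - D\<close> is
  even; the sign left by reciprocity is \<open>e(\<delta> (1 - D) / 4)\<close>.\<close>

lemma sign_factor_eq:
  assumes "odd D" "w = 2 * k"
  shows "ee (of_int (9 * w * (1 - D)) / 24) * of_int (if D mod 4 = 3 \<and> delta_of v = 1 then -1 else 1)
    = ee (of_int ((k + int \<delta>) * (1 - D)) / of_int 4)"
proof -
  obtain j where j: "D = 2 * j + 1" using assms(1) by (elim oddE)
  have e1: "ee (of_int (9 * w * (1 - D)) / 24) = ee (of_int (k * (1 - D)) / of_int 4)"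
  proof -
    have "of_int (9 * w * (1 - D)) / 24 = (of_int (3 * k * (1 - D)) / of_int 4 :: complex)"
      by (simp add: assms(2))
    moreover have "[3 * k * (1 - D) = k * (1 - D)] (mod 4)"
      unfolding cong_iff_dvd_diff j by (simp add: algebra_simps)
    ultimately show ?thesis using ee_cong_int[of _ _ 4] by (metis zero_less_numeral)
  qed
  have e2: "of_int (if D mod 4 = 3 \<and> delta_of v = 1 then -1 else 1) = ee (of_int (int \<delta> * (1 - D)) / of_int 4)"
  proof (cases "\<delta> = 1")
    case False
    then have "\<delta> = 0" using delta_values by blast
    then show ?thesis unfolding \<delta>_def by simp
  next
    case True
    have "D mod 4 = 1 \<or> D mod 4 = 3" using assms(1) by presburger
    then show ?thesis
    proof
      assume "D mod 4 = 1"
      then have "[int \<delta> * (1 - D) = 0] (mod 4)" unfolding True cong_iff_dvd_diff by simp presburger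
      then have "ee (of_int (int \<delta> * (1 - D)) / of_int 4) = ee (of_int 0 / of_int 4)" by (rule ee_cong_int) simp
      then show ?thesis using \<open>D mod 4 = 1\<close> by simp
    next
      assume "D mod 4 = 3"
      then have "[int \<delta> * (1 - D) = 2] (mod 4)" unfolding True cong_iff_dvd_diff by simp presburger
      then have "ee (of_int (int \<delta> * (1 - D)) / of_int 4) = ee (of_int 2 / of_int 4)" by (rule ee_cong_int) simp
      also have "\<dots> = -1" using ee_half by simp
      finally show ?thesis using \<open>D mod 4 = 3\<close> True unfolding \<delta>_def by simp
    qed
  qed
  show ?thesis unfolding e1 e2 ee_add[symmetric] by (simp add: algebra_simps add_divide_distrib[symmetric])
qed

text \<open>The shift moduli are chosen such that the correction terms involving \<open>b'\<close> vanish in the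
  explicit formula for the character.\<close>
lemma char_ratio:
  fixes a d a' d' b' A B c D A' B' c' D' :: int
  assumes a: "a > 0" "d > 0" "a * d = int l" "coprime a (int N)"
    and a': "a' > 0" "d' > 0" "a' * d' = int l" "coprime a' (int N)"
    and det: "A * D - B * (int N * c) = 1" "A' * D' - B' * (int N * c') = 1"
    and c: "c > 0" "odd c" "c' > 0"
    and D: "D > 0" "coprime D 6" "D' > 0" "coprime D' 6"
    and rel: "a * c' = d' * c" "a * D' = a' * D - b' * (int N * c)"
    and Q: "m dvd b'" "odd l \<Longrightarrow> 8 dvd b'"
  shows "\<psi> a * eta_char r N (A', B', int N * c', D') 1 = eta_char r N (A, B, int N * c, D) 1 * \<psi> a'"
proof -
  have coN: "coprime X (int N)" "coprime X Y" if "U * X - V * (int N * Y) = 1" for U X V Y :: int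
  proof -
    have "coprime X (int N * Y)"
    proof (rule coprimeI)
      fix q assume "q dvd X" "q dvd int N * Y"
      then have "q dvd U * X - V * (int N * Y)" by (meson dvd_diff dvd_mult)
      then show "is_unit q" unfolding that .
    qed
    then show "coprime X (int N)" "coprime X Y" by simp_all
  qed
  note cD = coN[OF det(1)] and cD' = coN[OF det(2)]
  have oD: "odd D" "odd D'" using D coprime_6_iff by auto
  \<comment> \<open>Multiplying the two relations gives \<open>a^2 D' c' = l D c\<close> up to a
    multiple of \<open>b'\<close>. Modulo \<open>m\<close> both \<open>a^2\<close> and
    \<open>l\<close> are 1 and \<open>b'\<close> is 0, and 24 divides \<open>m M\<close>.\<close>
  have e1: "ee (of_int (- (D' * c' * M)) / of_int 24) = ee (of_int (- (D * c * M)) / of_int 24)"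
  proof (rule ee_cong_int)
    have "coprime a m" using coprime_l_m unfolding a(3)[symmetric] by simp
    then have aa: "m dvd a * a - 1" by (rule dvd_24_square[OF m_dvd_24])
    have lm: "m dvd int l - 1" using l_cong unfolding m_def cong_iff_dvd_diff .
    have "(a * a) * (D' * c') = (a * D') * (a * c')" by (simp add: algebra_simps)
    also have "\<dots> = (a' * d') * (D * c) - b' * (d' * c * (int N * c))" unfolding rel by (simp add: algebra_simps)
    finally have *: "(a * a) * (D' * c') = int l * (D * c) - b' * (d' * c * (int N * c))" unfolding a'(3) .
    have "D' * c' - D * c = (int l - 1) * (D * c) - b' * (d' * c * (int N * c)) - (a * a - 1) * (D' * c')"
      using * by (simp add: algebra_simps)
    also have "m dvd \<dots>" by (rule dvd_diff[OF dvd_diff[OF dvd_mult2[OF lm] dvd_mult2[OF Q(1)]] dvd_mult2[OF aa]])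
    finally obtain k where k: "D' * c' - D * c = m * k" by (elim dvdE)
    have "- (D' * c' * M) - - (D * c * M) = - k * (m * M)"
    proof -
      have "- (D' * c' * M) - - (D * c * M) = - ((D' * c' - D * c) * M)" by (simp add: algebra_simps)
      then show ?thesis unfolding k by (simp add: algebra_simps)
    qed
    then show "[- (D' * c' * M) = - (D * c * M)] (mod 24)"
      unfolding cong_iff_dvd_diff using m_M by (simp only: dvd_mult)
  qed simp
  \<comment> \<open>\<open>a D'\<close> and \<open>a' D\<close> differ by a multiple of
    \<open>b' N\<close>, so they agree modulo the primes of \<open>\<varpi>\<close>. If 2 is one of
    these, \<open>l\<close> is odd and 8 divides \<open>b'\<close>.\<close>
  have kron: "kronecker a v * kronecker D' v = kronecker D v * kronecker a' v"
  proof -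
    have "kronecker (a * D') v = kronecker (a' * D) v"
    proof (rule kronecker_cong)
      fix p assume "prime p" "p dvd v"
      then have "int p dvd int N" using prime_dvd_varpi by simp
      then show "[a * D' = a' * D] (mod int p)" unfolding rel cong_iff_dvd_diff by simp
    next
      assume "even v"
      then have "even N" using prime_dvd_varpi[of 2] by simp
      then have "8 dvd b'" using Q(2) l_odd by blast
      then show "[a * D' = a' * D] (mod 8)" unfolding rel cong_iff_dvd_diff by simp
    qed
    then show ?thesis
      using kronecker_mult[OF coprime_varpi[OF a(4)] coprime_varpi[OF cD'(1)]]
        kronecker_mult[OF coprime_varpi[OF a'(4)] coprime_varpi[OF cD(1)]] by (simp add: mult.commute)
  qed
  define J J' where "J = jsign c D ^ nat \<bar>w\<bar>" and "J' = jsign c' D' ^ nat \<bar>w\<bar>"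
  define s s' :: int where "s = (if D mod 4 = 3 \<and> delta_of v = 1 then -1 else 1)"
    and "s' = (if D' mod 4 = 3 \<and> delta_of v = 1 then -1 else 1)"
  define E where "E = (\<lambda>a. if odd l then ee (of_real ((real_of_int w / 2 + real \<delta>) * of_int (int l - int l div a) / 4)) else 1)"
  have split: "ee (of_int (9 * w * (1 - X) - X * Y * M) / 24) = ee (of_int (9 * w * (1 - X)) / 24) * ee (of_int (- (X * Y * M)) / of_int 24)" for X Y
    unfolding ee_add[symmetric] by (simp add: diff_divide_distrib)
  have chi: "eta_char r N (A, B, int N * c, D) 1 = ee (of_int (9 * w * (1 - D)) / 24) * ee (of_int (- (D * c * M)) / of_int 24) * of_int (J * (kronecker D v * s))"
    using eta_char_explicit[OF N sum0 det(1) c(1) D(1,2)]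
    unfolding w_def[symmetric] M_def[symmetric] v_def[symmetric] split J_def s_def .
  have chi': "eta_char r N (A', B', int N * c', D') 1 = ee (of_int (9 * w * (1 - D')) / 24) * ee (of_int (- (D * c * M)) / of_int 24) * of_int (J' * (kronecker D' v * s'))"
    using eta_char_explicit[OF N sum0 det(2) c(3) D(3,4)]
    unfolding w_def[symmetric] M_def[symmetric] v_def[symmetric] split J'_def s'_def e1 .
  have key: "E a * (ee (of_int (9 * w * (1 - D')) / 24) * of_int J' * of_int s') =
      (ee (of_int (9 * w * (1 - D)) / 24) * of_int J * of_int s) * E a'"
  proof (cases "odd w")
    case True
    have nat1: "x = 1" if "x > 0" "x * y = int l" "coprime x (int N)" for x y :: int
    proof -
      have "nat x dvd l" using that(1,2) by (metis dvd_triv_left int_dvd_int_iff int_nat_eq less_imp_le)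
      moreover have "coprime (nat x) N" using that(1,3) by (metis coprime_int_iff int_nat_eq less_imp_le)
      ultimately have "nat x = 1" by (rule one_sided_index[OF True])
      then show ?thesis by simp
    qed
    have a1: "a = 1" "a' = 1" using nat1 a a' by blast+
    have ol: "odd l" using odd_weight_odd_l[OF True] .
    have dl: "d' = int l" using a1 a'(3) by simp
    have D8: "[D' = D] (mod 8)" using rel(2) Q(2)[OF ol] unfolding a1 cong_iff_dvd_diff by simp
    have "[9 * w * (1 - D') = 9 * w * (1 - D)] (mod 24)"
    proof -
      have "9 * w * (1 - D') - 9 * w * (1 - D) = 3 * (3 * w) * - (D' - D)" by (simp add: algebra_simps)
      moreover obtain k where "D' - D = 8 * k" using D8 unfolding cong_iff_dvd_diff by (elim dvdE)
      ultimately have "9 * w * (1 - D') - 9 * w * (1 - D) = 24 * (3 * w * - k)" by simp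
      then show ?thesis unfolding cong_iff_dvd_diff by (metis dvd_triv_left)
    qed
    from ee_cong_int[OF this] have ew: "ee (of_int (9 * w * (1 - D')) / 24) = ee (of_int (9 * w * (1 - D)) / 24)" by simp
    have D4: "D' mod 4 = D mod 4"
    proof -
      have "(4::int) dvd 8" by simp
      then show ?thesis using D8 cong_dvd_modulus unfolding cong_def[symmetric] by blast
    qed
    then have ss: "s' = s" by (simp add: s_def s'_def)
    obtain t where t: "l = t ^ 2" using l_square True unfolding w_def by blast
    have c't: "c' = int t * int t * c" using rel(1) unfolding a1 dl t by (simp add: power2_eq_square)
    have co: "coprime (int t) D'" "coprime c D'" using cD'(2) unfolding c't by (simp_all add: coprime_commute)
    have ct: "coprime (int t * int t) D'" using co(1) by simp
    \<comment> \<open>Here \<open>c' = t^2 c\<close>, and the square does not affect the symbol.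
      Flipping to modulus \<open>c\<close>, using \<open>D' \<equiv> D\<close> modulo
      \<open>c\<close> and modulo 4, and flipping back replaces \<open>D'\<close> by
      \<open>D\<close>; this is where odd \<open>c\<close> enters.\<close>
    have "jsign c' D' = jsign (int t) D' * jsign (int t) D' * jsign c D'"
      unfolding c't jsign_mult[OF ct co(2) D(3) oD(2)] jsign_mult[OF co(1) co(1) D(3) oD(2)] ..
    also have "jsign (int t) D' * jsign (int t) D' = 1" using jsign_values[of "int t" D'] by auto
    also have "1 * jsign c D' = jsign D' c * (if c mod 4 = 3 \<and> D' mod 4 = 3 then -1 else 1)"
      using jsign_reciprocity[OF co(2) c(1) D(3) c(2) oD(2)] by simp
    also have "jsign D' c = jsign D c"
      by (rule jsign_cong) (use rel(2) in \<open>simp add: a1 cong_iff_dvd_diff\<close>)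
    also have "jsign D c * (if c mod 4 = 3 \<and> D' mod 4 = 3 then -1 else 1) = jsign c D"
      unfolding D4 using jsign_reciprocity[of c D] cD(2) c D oD by (simp add: coprime_commute)
    finally have "J' = J" by (simp add: J_def J'_def)
    then show ?thesis unfolding ew ss a1 by (simp add: mult_ac)
  next
    case False
    then obtain k where k: "w = 2 * k" by (auto elim: evenE)
    have even_nat: "even (nat \<bar>w\<bar>)" using False by (simp add: even_nat_iff)
    have JJ: "J = 1" "J' = 1"
      unfolding J_def J'_def using jsign_values[of c D] jsign_values[of c' D'] even_nat by auto
    have sf: "ee (of_int (9 * w * (1 - D)) / 24) * of_int s = ee (of_int ((k + int \<delta>) * (1 - D)) / of_int 4)"
      "ee (of_int (9 * w * (1 - D')) / 24) * of_int s' = ee (of_int ((k + int \<delta>) * (1 - D')) / of_int 4)"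
      unfolding s_def s'_def using sign_factor_eq[OF oD(1) k] sign_factor_eq[OF oD(2) k] by blast+
    show ?thesis
    proof (cases "odd l")
      case True
      have div: "int l div a = d" "int l div a' = d'" using a a' by (metis nonzero_mult_div_cancel_left less_irrefl)+
      have Eeq: "E a = ee (of_int ((k + int \<delta>) * (int l - d)) / of_int 4)" "E a' = ee (of_int ((k + int \<delta>) * (int l - d')) / of_int 4)"
        unfolding E_def div using True k by simp_all
      have odds: "odd a" "odd d" "odd a'" "odd d'"
        using True a(3) a'(3) by (metis even_mult_iff even_of_nat)+
      \<comment> \<open>The additive form of \<open>a d = a' d'\<close>; the relation
        \<open>a D' \<equiv> a' D\<close> is treated likewise below, and their difference eliminates
        \<open>a\<close> and \<open>a'\<close>.\<close>
      have "[a + d - 1 = a' + d' - 1] (mod 4)"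
        using odd_mult_cong_4[OF odds(1,2)] odd_mult_cong_4[OF odds(3,4)] unfolding a(3) a'(3)
        by (meson cong_sym cong_trans)
      moreover have "[a + D' - 1 = a' + D - 1] (mod 4)"
      proof -
        have "4 dvd b'" using Q(2)[OF True] by (rule dvd_trans[rotated]) simp
        then have "[a * D' = a' * D] (mod 4)" unfolding rel cong_iff_dvd_diff by simp
        then show ?thesis using odd_mult_cong_4[OF odds(1) oD(2)] odd_mult_cong_4[OF odds(3) oD(1)]
          by (meson cong_sym cong_trans)
      qed
      ultimately have "4 dvd (a + d - 1) - (a' + d' - 1) - ((a + D' - 1) - (a' + D - 1))"
        unfolding cong_iff_dvd_diff by (rule dvd_diff)
      then have 4: "4 dvd (d + D) - (d' + D')" by (simp add: algebra_simps)
      \<comment> \<open>The phases involve \<open>D - D'\<close> with the opposite sign, which is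
        harmless modulo 4 because \<open>D - D'\<close> is even.\<close>
      have "4 dvd ((int l - d) + (1 - D')) - ((int l - d') + (1 - D))"
      proof -
        have "even (D - D')" using oD by simp
        then have "4 dvd 2 * (D - D')" by (elim evenE) simp
        then have "4 dvd 2 * (D - D') - ((d + D) - (d' + D'))" using 4 by (rule dvd_diff)
        then show ?thesis by (simp add: algebra_simps)
      qed
      then have "4 dvd (k + int \<delta>) * (((int l - d) + (1 - D')) - ((int l - d') + (1 - D)))" by (rule dvd_mult)
      then have "[(k + int \<delta>) * (int l - d) + (k + int \<delta>) * (1 - D') = (k + int \<delta>) * (1 - D) + (k + int \<delta>) * (int l - d')] (mod 4)"
        unfolding cong_iff_dvd_diff by (simp add: algebra_simps)
      from ee_cong_int[OF this]
      have "E a * ee (of_int ((k + int \<delta>) * (1 - D')) / of_int 4) = ee (of_int ((k + int \<delta>) * (1 - D)) / of_int 4) * E a'"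
        unfolding Eeq ee_add[symmetric] add_divide_distrib[symmetric] of_int_add by simp
      then show ?thesis using sf unfolding JJ by simp
    next
      case False
      then have ev: "even (k + int \<delta>)" using weight_parity[OF _ k] by simp
      have "ee (of_int ((k + int \<delta>) * (1 - X)) / of_int 4) = 1" if "odd X" for X
      proof -
        have "even (1 - X)" using that by simp
        then have "2 * 2 dvd (k + int \<delta>) * (1 - X)" using ev by (intro mult_dvd_mono)
        then have "[(k + int \<delta>) * (1 - X) = 0] (mod 4)" unfolding cong_iff_dvd_diff by simp
        from ee_cong_int[OF this] show ?thesis by simp
      qed
      then show ?thesis using sf oD False unfolding JJ E_def by simp
    qed
  qed
  have psiE: "\<psi> x = of_int (kronecker x v) * E x" for x by (simp only: \<psi>_def E_def)
  have "\<psi> a * eta_char r N (A', B', int N * c', D') 1 =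
     ee (of_int (- (D * c * M)) / of_int 24) * of_int (kronecker a v * kronecker D' v) *
     (E a * (ee (of_int (9 * w * (1 - D')) / 24) * of_int J' * of_int s'))"
    unfolding chi' psiE of_int_mult by (simp only: mult_ac)
  also have "\<dots> = eta_char r N (A, B, int N * c, D) 1 * \<psi> a'"
    unfolding key kron unfolding chi psiE of_int_mult by (simp only: mult_ac)
  finally show ?thesis .
qed

end

section \<open>Moebius transformations, square roots and triangular matrices\<close>

lemma denom_nonzero:
  fixes a b c d :: int
  assumes "a * d - b * c = 1" "\<tau> \<in> upper"
  shows "of_int c * \<tau> + of_int d \<noteq> (0 :: complex)"
proof
  assume *: "of_int c * \<tau> + of_int d = (0 :: complex)"
  then have "Im (of_int c * \<tau> + of_int d) = 0" by simp
  then have "of_int c * Im \<tau> = 0" by simp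
  then have "c = 0" using assms(2) by (simp add: upper_def)
  moreover from this * have "d = 0" by simp
  ultimately show False using assms(1) by simp
qed

lemma moeb_upper:
  fixes a b c d :: int
  assumes "a * d - b * c = 1" "\<tau> \<in> upper"
  shows "moeb (a, b, c, d) \<tau> \<in> upper"
proof -
  let ?w = "of_int c * \<tau> + of_int d :: complex"
  have "?w \<noteq> 0" by (rule denom_nonzero[OF assms])
  then have pos: "(Re ?w)\<^sup>2 + (Im ?w)\<^sup>2 > 0" by (metis complex_neq_0)
  have "of_int a * of_int d - of_int b * of_int c = (1::real)"
    using assms(1) by (metis of_int_1 of_int_diff of_int_mult)
  moreover have "Im (of_int a * \<tau> + of_int b) * Re ?w - Re (of_int a * \<tau> + of_int b) * Im ?w =
      (of_int a * of_int d - of_int b * of_int c) * Im \<tau>" by (simp add: algebra_simps)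
  ultimately have "Im (moeb (a, b, c, d) \<tau>) = Im \<tau> / ((Re ?w)\<^sup>2 + (Im ?w)\<^sup>2)"
    unfolding moeb_def case_prod_conv Im_divide by simp
  then show ?thesis using pos assms(2) unfolding upper_def by simp
qed

lemma moeb_mult:
  fixes a b c d a' b' c' d' :: int
  assumes "a' * d' - b' * c' = 1" "\<tau> \<in> upper"
  shows "moeb (a, b, c, d) (moeb (a', b', c', d') \<tau>) =
     moeb (a * a' + b * c', a * b' + b * d', c * a' + d * c', c * b' + d * d') \<tau>"
proof -
  let ?w = "of_int c' * \<tau> + of_int d' :: complex"
  have w: "?w \<noteq> 0" by (rule denom_nonzero[OF assms])
  have "moeb (a, b, c, d) (moeb (a', b', c', d') \<tau>) =
     (of_int a * ((of_int a' * \<tau> + of_int b') / ?w) + of_int b) / (of_int c * ((of_int a' * \<tau> + of_int b') / ?w) + of_int d)"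
    by (simp add: moeb_def)
  also have "\<dots> = (of_int a * (of_int a' * \<tau> + of_int b') + of_int b * ?w) / (of_int c * (of_int a' * \<tau> + of_int b') + of_int d * ?w)"
    using w by (simp add: add_divide_eq_iff divide_simps)
  also have "\<dots> = moeb (a * a' + b * c', a * b' + b * d', c * a' + d * c', c * b' + d * d') \<tau>"
    by (simp add: moeb_def algebra_simps)
  finally show ?thesis .
qed

text \<open>Positive scaling respects the principal branch. The automorphy factors of
  \<open>\<gamma>\<close> and \<open>\<gamma>'\<close> differ by the positive number
  \<open>a' / a\<close>, so passing between them creates no sign.\<close>

lemma csqrt_pos_mult:
  assumes "x > 0"
  shows "csqrt (of_real x * z) = of_real (sqrt x) * csqrt z"
proof (rule csqrt_unique)
  have "(of_real (sqrt x))\<^sup>2 = (of_real x :: complex)"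
    using assms by (metis less_imp_le of_real_power real_sqrt_pow2)
  then show "(of_real (sqrt x) * csqrt z)\<^sup>2 = of_real x * z" by (simp add: power_mult_distrib)
  show "0 < Re (of_real (sqrt x) * csqrt z) \<or> Re (of_real (sqrt x) * csqrt z) = 0 \<and> 0 \<le> Im (of_real (sqrt x) * csqrt z)"
    using csqrt_principal[of z] assms by auto
qed

lemma sqrt_power_int:
  assumes "x > 0"
  shows "sqrt x powi k = x powr (of_int k / 2)"
proof -
  have "sqrt x powi k = sqrt x powr of_int k" using assms by (simp add: powr_real_of_int')
  also have "\<dots> = x powr (of_int k / 2)" using assms by (simp add: powr_half_sqrt[symmetric] powr_powr)
  finally show ?thesis .
qed

lemma upper_affine:
  assumes "\<tau> \<in> upper" "a > 0" "d > (0::int)"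
  shows "(of_int a * \<tau> + of_int b) / of_int d \<in> upper"
proof -
  have "(of_int a * \<tau> + of_int b) / of_int d = of_real (of_int a / of_int d) * \<tau> + of_real (of_int b / of_int d)"
    by (simp add: add_divide_distrib)
  then show ?thesis using assms unfolding upper_def by simp
qed

text \<open>The relation \<open>\<beta> \<gamma> = \<gamma>' \<beta>'\<close> for \<open>\<beta> = (a, b; 0, d)\<close> and \<open>\<beta>' = (a', b'; 0, d')\<close>, on points and on
  automorphy factors.\<close>
lemma hecke_coset_action:
  fixes A B C D a b d a' b' d' A' B' C' D' :: int
  assumes det: "A * D - B * C = 1" and a: "a > 0" "d > 0" "a' > 0" "d' > 0" "a' * d' = a * d"
    and e: "a * A + b * C = A' * a'" "a * B + b * D = A' * b' + B' * d'" "d * C = C' * a'" "d * D = C' * b' + D' * d'"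
    and \<tau>: "\<tau> \<in> upper"
  shows "(of_int a * moeb (A, B, C, D) \<tau> + of_int b) / of_int d = moeb (A', B', C', D') ((of_int a' * \<tau> + of_int b') / of_int d')"
    and "csqrt (of_int C' * ((of_int a' * \<tau> + of_int b') / of_int d') + of_int D') =
       of_real (sqrt (of_int a' / of_int a)) * csqrt (of_int C * \<tau> + of_int D)"
proof -
  let ?z = "of_int C * \<tau> + of_int D :: complex" and ?s = "(of_int a' * \<tau> + of_int b') / of_int d' :: complex"
  have z: "?z \<noteq> 0" by (rule denom_nonzero[OF det \<tau>])
  have nz: "(of_int a :: complex) \<noteq> 0" "(of_int d :: complex) \<noteq> 0" "(of_int d' :: complex) \<noteq> 0" using a by simp_all
  have E: "of_int a * of_int A + of_int b * of_int C = (of_int A' * of_int a' :: complex)"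
    "of_int a * of_int B + of_int b * of_int D = (of_int A' * of_int b' + of_int B' * of_int d' :: complex)"
    "of_int d * of_int C = (of_int C' * of_int a' :: complex)"
    "of_int d * of_int D = (of_int C' * of_int b' + of_int D' * of_int d' :: complex)"
    "of_int a' * of_int d' = (of_int a * of_int d :: complex)"
    using e[THEN arg_cong[where f = complex_of_int]] a(5)[THEN arg_cong[where f = complex_of_int]] by simp_all
  have s: "of_int d' * ?s = of_int a' * \<tau> + of_int b'" using nz by simp
  have den: "of_int d' * (of_int C' * ?s + of_int D') = of_int d * ?z"
  proof -
    have "of_int d' * (of_int C' * ?s + of_int D') = of_int C' * (of_int d' * ?s) + of_int D' * of_int d'" by (simp only: algebra_simps)
    also have "\<dots> = (of_int C' * of_int a') * \<tau> + (of_int C' * of_int b' + of_int D' * of_int d')"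
      unfolding s by (simp only: algebra_simps)
    also have "\<dots> = of_int d * ?z" unfolding E(3,4)[symmetric] by (simp only: algebra_simps)
    finally show ?thesis .
  qed
  have num: "of_int d' * (of_int A' * ?s + of_int B') = of_int a * (of_int A * \<tau> + of_int B) + of_int b * ?z"
  proof -
    have "of_int d' * (of_int A' * ?s + of_int B') = of_int A' * (of_int d' * ?s) + of_int B' * of_int d'" by (simp only: algebra_simps)
    also have "\<dots> = (of_int A' * of_int a') * \<tau> + (of_int A' * of_int b' + of_int B' * of_int d')"
      unfolding s by (simp only: algebra_simps)
    also have "\<dots> = of_int a * (of_int A * \<tau> + of_int B) + of_int b * ?z"
      unfolding E(1,2)[symmetric] by (simp only: algebra_simps)
    finally show ?thesis .
  qed
  have "moeb (A', B', C', D') ?s = (of_int d' * (of_int A' * ?s + of_int B')) / (of_int d' * (of_int C' * ?s + of_int D'))"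
    unfolding moeb_def case_prod_conv mult_divide_mult_cancel_left[OF nz(3)] ..
  also have "\<dots> = (of_int a * moeb (A, B, C, D) \<tau> + of_int b) / of_int d"
    unfolding num den moeb_def case_prod_conv using z nz by (simp add: divide_simps)
  finally show "(of_int a * moeb (A, B, C, D) \<tau> + of_int b) / of_int d = moeb (A', B', C', D') ?s" ..
  have "of_int C' * ?s + of_int D' = of_real (of_int a' / of_int a) * ?z"
  proof -
    have "(of_int a * of_int d') * (of_int C' * ?s + of_int D') = of_int a * (of_int d * ?z)"
      using den by (simp only: mult.assoc)
    also have "\<dots> = of_int a' * of_int d' * ?z" unfolding E(5) by (simp only: mult.assoc)
    finally have "of_int d' * (of_int a * (of_int C' * ?s + of_int D')) = of_int d' * (of_int a' * ?z)"
      by (simp only: mult_ac)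
    then have "of_int a * (of_int C' * ?s + of_int D') = of_int a' * ?z" using nz(3) by simp
    then show ?thesis using nz(1) by (simp add: field_simps)
  qed
  then show "csqrt (of_int C' * ?s + of_int D') = of_real (sqrt (of_int a' / of_int a)) * csqrt ?z"
    using csqrt_pos_mult[of "of_int a' / of_int a" ?z] a by simp
qed

text \<open>If \<open>\<beta>1\<close> and \<open>\<beta>2\<close> lead to the same
  \<open>\<beta>'\<close>, then \<open>\<beta>1 \<beta>2^-1 = \<gamma>1 \<gamma>2^-1\<close> is
  integral and unimodular. This gives \<open>d1 = d2\<close> by mutual divisibility, and then
  \<open>d1\<close> divides \<open>b1 - b2\<close>.\<close>

lemma hecke_coset_inj:
  fixes A B C D a1 b1 d1 a2 b2 d2 a' b' d' :: int
  assumes pos: "a' > 0" "d' > 0" "d1 > 0" "d2 > 0" "a1 * d1 = a2 * d2"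
    and b: "0 \<le> b1" "b1 < d1" "0 \<le> b2" "b2 < d2"
    and det: "A1 * D1 - B1 * C1 = 1" "A2 * D2 - B2 * C2 = 1"
    and e1: "a1 * A + b1 * C = A1 * a'" "a1 * B + b1 * D = A1 * b' + B1 * d'" "d1 * C = C1 * a'" "d1 * D = C1 * b' + D1 * d'"
    and e2: "a2 * A + b2 * C = A2 * a'" "a2 * B + b2 * D = A2 * b' + B2 * d'" "d2 * C = C2 * a'" "d2 * D = C2 * b' + D2 * d'"
  shows "a1 = a2 \<and> b1 = b2"
proof -
  have i: "d2 * C1 = d1 * C2"
  proof -
    have "a' * (d2 * C1) = d2 * (d1 * C)" unfolding e1(3) by (simp only: mult_ac)
    also have "\<dots> = d1 * (d2 * C)" by (simp only: mult_ac)
    also have "\<dots> = a' * (d1 * C2)" unfolding e2(3) by (simp only: mult_ac)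
    finally show ?thesis using pos(1) by simp
  qed
  have ii: "d2 * D1 = d1 * D2"
  proof -
    have "d' * (d2 * D1) = d2 * (d1 * D) - d2 * C1 * b'" unfolding e1(4) by (simp add: algebra_simps)
    also have "\<dots> = d1 * (d2 * D) - d1 * C2 * b'" unfolding i by (simp only: mult_ac)
    also have "\<dots> = d' * (d1 * D2)" unfolding e2(4) by (simp add: algebra_simps)
    finally show ?thesis using pos(2) by simp
  qed
  have "d2 = A1 * (d2 * D1) - B1 * (d2 * C1)"
  proof -
    have "A1 * (d2 * D1) - B1 * (d2 * C1) = d2 * (A1 * D1 - B1 * C1)" by (simp add: algebra_simps)
    then show ?thesis using det(1) by simp
  qed
  then have 1: "d1 dvd d2" unfolding i ii by (metis dvd_diff dvd_mult dvd_triv_left)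
  have "d1 = A2 * (d1 * D2) - B2 * (d1 * C2)"
  proof -
    have "A2 * (d1 * D2) - B2 * (d1 * C2) = d1 * (A2 * D2 - B2 * C2)" by (simp add: algebra_simps)
    then show ?thesis using det(2) by simp
  qed
  then have 2: "d2 dvd d1" unfolding i[symmetric] ii[symmetric] by (metis dvd_diff dvd_mult dvd_triv_left)
  have dd: "d1 = d2" using 1 2 pos by (simp add: zdvd_antisym_nonneg)
  have aa: "a1 = a2" using pos dd by simp
  have iv: "d1 * (A1 - A2) = (b1 - b2) * C1"
  proof -
    have "a' * (A1 - A2) = (b1 - b2) * C" using e1(1) e2(1) aa by (simp add: algebra_simps)
    then have "a' * (d1 * (A1 - A2)) = (b1 - b2) * (d1 * C)" by (metis mult.assoc mult.commute)
    also have "\<dots> = a' * ((b1 - b2) * C1)" unfolding e1(3) by (simp only: mult_ac)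
    finally show ?thesis using pos(1) by simp
  qed
  have v: "d1 * (B1 - B2) = (b1 - b2) * D1"
  proof -
    have x: "d' * (B1 - B2) = (b1 - b2) * D - (A1 - A2) * b'" using e1(2) e2(2) aa by (simp add: algebra_simps)
    have "d' * (d1 * (B1 - B2)) = d1 * (d' * (B1 - B2))" by (simp only: mult_ac)
    also have "\<dots> = (b1 - b2) * (d1 * D) - (d1 * (A1 - A2)) * b'" unfolding x by (simp add: algebra_simps)
    also have "\<dots> = d' * ((b1 - b2) * D1)" unfolding iv e1(4) by (simp add: algebra_simps)
    finally show ?thesis using pos(2) by simp
  qed
  have "b1 - b2 = (b1 - b2) * (A1 * D1 - B1 * C1)" using det(1) by simp
  also have "\<dots> = A1 * ((b1 - b2) * D1) - B1 * ((b1 - b2) * C1)" by (simp add: algebra_simps)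
  also have "\<dots> = d1 * (A1 * (B1 - B2) - B1 * (A1 - A2))" unfolding iv[symmetric] v[symmetric] by (simp add: algebra_simps)
  finally have "d1 dvd b1 - b2" by simp
  moreover have "\<bar>b1 - b2\<bar> < d1" using b dd by linarith
  ultimately have "b1 = b2" by (metis abs_of_pos eq_iff_diff_eq_0 dvd_imp_le_int linorder_not_less pos(3))
  then show ?thesis using aa by simp
qed

section \<open>The image of f under the Hecke operator, and its invariance\<close>

locale eta_hecke_form = eta_hecke +
  assumes f_Mk: "on_upper (eta_quotient r N) \<in> Mk (wt2 r N) N (eta_char r N)"
begin

abbreviation f where "f \<equiv> eta_quotient r N"
abbreviation char1 where "char1 \<gamma> \<equiv> eta_char r N \<gamma> 1"

lemma f_nonzero: "\<tau> \<in> upper \<Longrightarrow> f \<tau> \<noteq> 0"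
  by (rule eta_quotient_nonzero[OF N sum0])

lemma f_add_int: "f (\<tau> + of_int n) = f \<tau>"
  unfolding eta_quotient_eq_qfun[OF N sum0] ee_add by simp

lemma f_holomorphic: "f holomorphic_on upper"
proof -
  have "on_upper f holomorphic_on upper" using f_Mk by (simp add: Mk_def modular_invariant_def)
  then show ?thesis by (rule holomorphic_transform) (simp add: on_upper_def)
qed

lemma f_transform:
  assumes "A * D - B * C = 1" "int N dvd C" "\<tau> \<in> upper"
  shows "f (moeb (A, B, C, D) \<tau>) = csqrt (of_int C * \<tau> + of_int D) powi w * char1 (A, B, C, D) * f \<tau>"
proof -
  let ?s = "csqrt (of_int C * \<tau> + of_int D)"
  have "(A, B, C, D) \<in> Gamma0 N" using assms by (simp add: Gamma0_def)
  then have "slash w (A, B, C, D) 1 (on_upper f) \<tau> = char1 (A, B, C, D) * on_upper f \<tau>"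
    using f_Mk assms(3) unfolding Mk_def modular_invariant_def w_def by blast
  then have "?s powi (- w) * f (moeb (A, B, C, D) \<tau>) = char1 (A, B, C, D) * f \<tau>"
    using moeb_upper[OF assms(1,3)] assms(3) by (simp add: slash_def on_upper_def)
  moreover have "?s \<noteq> 0" using denom_nonzero[OF assms(1,3)] by simp
  ultimately show ?thesis by (simp add: power_int_minus field_simps)
qed

definition idx :: "(int \<times> int) set" where
  "idx = (SIGMA a:{a. a > 0 \<and> a dvd int l \<and> coprime a (int N)}. {0..<int l div a})"

lemma finite_idx: "finite idx"
proof -
  have "finite {a. a > 0 \<and> a dvd int l \<and> coprime a (int N)}"
    by (rule finite_subset[of _ "{1..int l}"]) (use l in \<open>auto dest: zdvd_imp_le\<close>)
  then show ?thesis unfolding idx_def by (intro finite_SigmaI) auto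
qed

definition hterm :: "int \<Rightarrow> int \<Rightarrow> complex \<Rightarrow> complex" where
  "hterm a b \<tau> = \<psi> a * of_real (real_of_int a powr (real_of_int w / 2)) * f ((of_int a * \<tau> + of_int b) / of_int (int l div a))"

definition F :: "complex \<Rightarrow> complex" where
  "F \<tau> = (\<Sum>(a, b)\<in>idx. hterm a b \<tau>) / of_nat l"

lemma idx_cofactor:
  assumes "a > 0" "a dvd int l"
  shows "int l div a > 0" "a * (int l div a) = int l"
proof -
  show "a * (int l div a) = int l" using assms by simp
  then show "int l div a > 0" using assms(1) l by (metis of_nat_0_less_iff zero_less_mult_pos)
qed

lemma hterm_mod:
  assumes "a > 0" "a dvd int l"
  shows "hterm a (b mod (int l div a)) \<tau> = hterm a b \<tau>"
proof -
  let ?d = "int l div a"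
  have d: "(of_int ?d :: complex) \<noteq> 0" using idx_cofactor(1)[OF assms] by simp
  have "b = b mod ?d + ?d * (b div ?d)" by simp
  then have "(of_int b :: complex) = of_int (b mod ?d) + of_int ?d * of_int (b div ?d)"
    by (metis of_int_add of_int_mult)
  then have "(of_int a * \<tau> + of_int b) / of_int ?d = (of_int a * \<tau> + of_int (b mod ?d)) / of_int ?d + of_int (b div ?d)"
    using d by (simp add: field_simps)
  then show ?thesis unfolding hterm_def by (simp only: f_add_int)
qed

text \<open>Translation replaces \<open>b\<close> by \<open>b + a\<close>, which permutes the
  residues modulo \<open>l div a\<close>.\<close>

lemma F_add_1: "F (\<tau> + 1) = F \<tau>"
proof -
  have inner: "(\<Sum>b\<in>{0..<int l div a}. hterm a b (\<tau> + 1)) = (\<Sum>b\<in>{0..<int l div a}. hterm a b \<tau>)"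
    if a: "a > 0" "a dvd int l" for a
  proof -
    let ?d = "int l div a"
    have d: "?d > 0" by (rule idx_cofactor(1)[OF a])
    have "hterm a b (\<tau> + 1) = hterm a ((b + a) mod ?d) \<tau>" for b
      unfolding hterm_mod[OF a] unfolding hterm_def by (simp add: algebra_simps)
    moreover have "bij_betw (\<lambda>b. (b + a) mod ?d) {0..<?d} {0..<?d}"
    proof -
      have "inj_on (\<lambda>b. (b + a) mod ?d) {0..<?d}"
      proof (rule inj_onI)
        fix x y assume xy: "x \<in> {0..<?d}" "y \<in> {0..<?d}" "(x + a) mod ?d = (y + a) mod ?d"
        then have "[x + a = y + a] (mod ?d)" by (simp add: cong_def)
        then have "[x = y] (mod ?d)" by (simp add: cong_add_rcancel)
        then show "x = y" using xy by (simp add: cong_def)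
      qed
      moreover have "(\<lambda>b. (b + a) mod ?d) ` {0..<?d} \<subseteq> {0..<?d}" using d by auto
      ultimately show ?thesis unfolding bij_betw_def using endo_inj_surj by blast
    qed
    from sum.reindex_bij_betw[OF this, of "\<lambda>b. hterm a b \<tau>"]
    show ?thesis using calculation by (simp only:)
  qed
  have "(\<Sum>a\<in>{a. a > 0 \<and> a dvd int l \<and> coprime a (int N)}. \<Sum>b\<in>{0..<int l div a}. hterm a b (\<tau> + 1)) =
     (\<Sum>a\<in>{a. a > 0 \<and> a dvd int l \<and> coprime a (int N)}. \<Sum>b\<in>{0..<int l div a}. hterm a b \<tau>)"
    by (rule sum.cong[OF refl], rule inner) simp_all
  moreover have "(\<Sum>(a, b)\<in>idx. g a b) = (\<Sum>a\<in>{a. a > 0 \<and> a dvd int l \<and> coprime a (int N)}. \<Sum>b\<in>{0..<int l div a}. g a b)"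
    for g :: "int \<Rightarrow> int \<Rightarrow> complex"
  proof -
    have "finite {a. a > 0 \<and> a dvd int l \<and> coprime a (int N)}"
      by (rule finite_subset[of _ "{1..int l}"]) (use l in \<open>auto dest: zdvd_imp_le\<close>)
    then show ?thesis unfolding idx_def by (intro sum.Sigma[symmetric]) auto
  qed
  ultimately show ?thesis unfolding F_def by simp
qed

definition G :: "complex \<Rightarrow> complex" where
  "G \<tau> = F \<tau> / f \<tau>"

lemma G_add_int: "G (\<tau> + of_int n) = G \<tau>"
proof -
  have nat: "F (\<tau> + of_nat k) = F \<tau>" for \<tau> k
  proof (induction k)
    case (Suc k)
    then show ?case using F_add_1[of "\<tau> + of_nat k"] by (simp add: algebra_simps)
  qed simp
  have "F (\<tau> + of_int n) = F \<tau>"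
  proof (cases "n \<ge> 0")
    case True
    then show ?thesis using nat[of \<tau> "nat n"] by simp
  next
    case False
    then show ?thesis using nat[of "\<tau> + of_int n" "nat (- n)"] by simp
  qed
  then show ?thesis by (simp add: G_def f_add_int)
qed

text \<open>It must be prime to \<open>l\<close>, so that \<open>b'\<close> can be made divisible by
  it. For even \<open>l\<close> this excludes the factor 8, whose tasks are taken over by
  \<open>weight_parity\<close> and by the oddness of \<open>\<varpi>\<close>.\<close>

definition shift_modulus :: int where
  "shift_modulus = (if odd l then 8 * m else m)"

lemma shift_modulus:
  "shift_modulus \<noteq> 0" "coprime (int l) shift_modulus" "m dvd shift_modulus" "odd l \<Longrightarrow> 8 dvd shift_modulus"
  "coprime D 6 \<Longrightarrow> coprime D shift_modulus"
proof -
  show "shift_modulus \<noteq> 0" using m_pos by (simp add: shift_modulus_def)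
  show "m dvd shift_modulus" "odd l \<Longrightarrow> 8 dvd shift_modulus" by (simp_all add: shift_modulus_def)
  show "coprime (int l) shift_modulus"
  proof (cases "odd l")
    case True
    then have "coprime (int l) 2" by simp
    then have "coprime (int l) (2 ^ 3)" by (simp only: coprime_power_right_iff simp_thms)
    then show ?thesis using coprime_l_m True by (simp add: shift_modulus_def)
  qed (use coprime_l_m in \<open>simp add: shift_modulus_def\<close>)
  assume "coprime D 6"
  \<comment> \<open>\<open>8 m\<close> divides 192, and 6 is the least exponent for which the power
    of 6 is a multiple of 192.\<close>
  then have "coprime D (6 ^ 6)" by (simp only: coprime_power_right_iff simp_thms)
  moreover have "8 * m dvd 6 ^ 6"
  proof -
    have "8 * m dvd 8 * 24" using m_dvd_24 by (rule mult_dvd_mono[OF dvd_refl])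
    moreover have "8 * 24 dvd (6 ^ 6 :: int)" by simp
    ultimately show ?thesis by (rule dvd_trans)
  qed
  then have "shift_modulus dvd 6 ^ 6" unfolding shift_modulus_def by (metis dvd_mult_right)
  ultimately show "coprime D shift_modulus" by (meson coprime_divisors dvd_refl)
qed

text \<open>The relation \<open>\<beta> \<gamma> = \<gamma>' \<beta>'\<close> with
  \<open>\<gamma>'\<close> hidden: injectivity holds for every choice of \<open>\<gamma>'\<close>,
  while the analytic argument needs a particular one.\<close>

definition hrel :: "int \<Rightarrow> int \<Rightarrow> int \<Rightarrow> int \<Rightarrow> int \<times> int \<Rightarrow> int \<times> int \<Rightarrow> bool" where
  "hrel A B C D p p' \<longleftrightarrow> (case p of (a, b) \<Rightarrow> case p' of (a', b') \<Rightarrow> \<exists>A' B' C' D'. A' * D' - B' * C' = 1 \<and>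
     a * A + b * C = A' * a' \<and> a * B + b * D = A' * b' + B' * (int l div a') \<and>
     (int l div a) * C = C' * a' \<and> (int l div a) * D = C' * b' + D' * (int l div a'))"

text \<open>The comparison of characters uses a \<open>b'\<close> divisible by
  \<open>shift_modulus\<close>, the index set a reduced one. The difference is a translation,
  absorbed into \<open>\<gamma>'\<close>.\<close>

lemma hrel_mod:
  assumes "hrel A B C D p (a', b')"
  shows "hrel A B C D p (a', b' mod (int l div a'))"
proof -
  let ?d = "int l div a'"
  define t where "t = b' div ?d"
  have b: "b' mod ?d = b' - t * ?d" unfolding t_def by (simp add: minus_div_mult_eq_mod)
  obtain a b where p: "p = (a, b)" by (cases p)
  obtain A' B' C' D' where h: "A' * D' - B' * C' = 1" "a * A + b * C = A' * a'" "a * B + b * D = A' * b' + B' * ?d"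
     "(int l div a) * C = C' * a'" "(int l div a) * D = C' * b' + D' * ?d"
    using assms unfolding hrel_def p case_prod_conv by blast
  have "A' * (D' + t * C') - (B' + t * A') * C' = 1" using h(1) by (simp add: algebra_simps)
  moreover have "a * B + b * D = A' * (b' - t * ?d) + (B' + t * A') * ?d" using h(3) by (simp add: algebra_simps)
  moreover have "(int l div a) * D = C' * (b' - t * ?d) + (D' + t * C') * ?d" using h(5) by (simp add: algebra_simps)
  ultimately show ?thesis unfolding hrel_def p case_prod_conv b using h(2,4) by blast
qed

lemma hrel_inj:
  assumes "hrel A B C D p q" "hrel A B C D p' q" "p \<in> idx" "p' \<in> idx" "q \<in> idx"
  shows "p = p'"
proof -
  obtain a1 b1 a2 b2 a' b' where e: "p = (a1, b1)" "p' = (a2, b2)" "q = (a', b')" by (metis surj_pair)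
  have a: "a1 > 0" "a1 dvd int l" "a2 > 0" "a2 dvd int l" "a' > 0" "a' dvd int l"
    and b: "0 \<le> b1" "b1 < int l div a1" "0 \<le> b2" "b2 < int l div a2"
    using assms(3-5) unfolding e idx_def by auto
  obtain A1 B1 C1 D1 where h1: "A1 * D1 - B1 * C1 = 1" "a1 * A + b1 * C = A1 * a'" "a1 * B + b1 * D = A1 * b' + B1 * (int l div a')"
     "(int l div a1) * C = C1 * a'" "(int l div a1) * D = C1 * b' + D1 * (int l div a')"
    using assms(1) unfolding hrel_def e case_prod_conv by blast
  obtain A2 B2 C2 D2 where h2: "A2 * D2 - B2 * C2 = 1" "a2 * A + b2 * C = A2 * a'" "a2 * B + b2 * D = A2 * b' + B2 * (int l div a')"
     "(int l div a2) * C = C2 * a'" "(int l div a2) * D = C2 * b' + D2 * (int l div a')"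
    using assms(2) unfolding hrel_def e case_prod_conv by blast
  have ad: "a1 * (int l div a1) = a2 * (int l div a2)" using idx_cofactor(2)[OF a(1,2)] idx_cofactor(2)[OF a(3,4)] by simp
  show ?thesis
    using hecke_coset_inj[OF a(5) idx_cofactor(1)[OF a(5,6)] idx_cofactor(1)[OF a(1,2)] idx_cofactor(1)[OF a(3,4)]
      ad b h1(1) h2(1) h1(2-5) h2(2-5)] unfolding e by simp
qed

text \<open>The square roots contribute \<open>(a' / a)^k\<close>, which turns \<open>a^k\<close>
  into \<open>a'^k\<close>, and \<open>char_ratio\<close> exchanges \<open>\<psi> a\<close> for
  \<open>\<psi> a'\<close>. So a term goes to another term with the same factor as
  \<open>f\<close>.\<close>

lemma hterm_transform:
  assumes det: "A * D - B * (int N * c) = 1" and c: "c > 0" "odd c" and D: "D > 0" "coprime D 6"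
    and ab: "(a, b) \<in> idx" 
  shows "\<exists>q\<in>idx. hrel A B (int N * c) D (a, b) q \<and> (\<forall>\<tau>\<in>upper. hterm a b (moeb (A, B, int N * c, D) \<tau>) =
     csqrt (of_int (int N * c) * \<tau> + of_int D) powi w * char1 (A, B, int N * c, D) * hterm (fst q) (snd q) \<tau>)"
proof -
  let ?C = "int N * c" and ?d = "int l div a"
  have a: "a > 0" "a dvd int l" "coprime a (int N)" using ab by (auto simp: idx_def)
  note d = idx_cofactor[OF a(1,2)]
  have C: "?C > 0" using N c by simp
  have Qd: "coprime (a * ?d) shift_modulus" unfolding d(2) by (rule shift_modulus(2))
  have C0: "?C \<noteq> 0" using C by linarith
  obtain a' b' d' A' B' C' D' where h: "a' > 0" "d' > 0" "a' * d' = a * ?d" "coprime a' (int N)"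
    "A' * D' - B' * C' = 1" "int N dvd C'"
    "a * A + b * ?C = A' * a'" "a * B + b * D = A' * b' + B' * d'" "?d * ?C = C' * a'" "?d * D = C' * b' + D' * d'"
    "shift_modulus dvd b'" "D' > 0" "coprime D' 6"
    by (rule hecke_coset_normalised[OF det dvd_triv_left a(1) d(1) a(3) C0 shift_modulus(1) Qd shift_modulus(5)[OF D(2)]])
  have ad: "a' * d' = int l" using h(3) d(2) by simp
  have a': "a' dvd int l" using ad by (metis dvd_triv_left)
  have d': "d' = int l div a'" using ad h(1) by (metis less_irrefl nonzero_mult_div_cancel_left)
  obtain c' where c': "C' = int N * c'" using h(6) by (elim dvdE)
  note rel = hecke_coset_relations[OF a(1) d(1) h(1,3,9,10)]
  have rel1: "a * c' = d' * c"
  proof -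
    have "int N * (a * c') = int N * (d' * c)" using rel(1) unfolding c' by (simp only: mult_ac)
    then show ?thesis using N by simp
  qed
  have c'pos: "c' > 0"
  proof -
    have "a * c' > 0" unfolding rel1 using h(2) c(1) by simp
    then show ?thesis using a(1) by (metis zero_less_mult_pos)
  qed
  have ratio: "\<psi> a * char1 (A', B', C', D') = char1 (A, B, ?C, D) * \<psi> a'"
    unfolding c'
    by (rule char_ratio[OF a(1) d(1) d(2) a(3) h(1,2) ad h(4) det h(5)[unfolded c'] c c'pos D h(12,13) rel1 rel(2)
        dvd_trans[OF shift_modulus(3) h(11)] dvd_trans[OF shift_modulus(4) h(11)]])
  have main: "hterm a b (moeb (A, B, ?C, D) \<tau>) =
     csqrt (of_int ?C * \<tau> + of_int D) powi w * char1 (A, B, ?C, D) * hterm a' b' \<tau>" if \<tau>: "\<tau> \<in> upper" for \<tau>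
  proof -
    let ?s = "(of_int a' * \<tau> + of_int b') / of_int d'" and ?z = "csqrt (of_int ?C * \<tau> + of_int D)"
    note act = hecke_coset_action[OF det a(1) d(1) h(1,2,3,7-10) \<tau>]
    have "f ((of_int a * moeb (A, B, ?C, D) \<tau> + of_int b) / of_int ?d) = f (moeb (A', B', C', D') ?s)"
      unfolding act(1) ..
    also have "\<dots> = (of_real (sqrt (of_int a' / of_int a)) * ?z) powi w * char1 (A', B', C', D') * f ?s"
      unfolding f_transform[OF h(5,6) upper_affine[OF \<tau> h(1,2)]] act(2) ..
    also have "(of_real (sqrt (of_int a' / of_int a)) * ?z) powi w = of_real ((of_int a' / of_int a) powr (of_int w / 2)) * ?z powi w"
      unfolding power_int_mult_distrib of_real_power_int[symmetric] using a(1) h(1) by (simp add: sqrt_power_int)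
    finally have fe: "f ((of_int a * moeb (A, B, ?C, D) \<tau> + of_int b) / of_int ?d) =
      of_real ((of_int a' / of_int a) powr (of_int w / 2)) * ?z powi w * char1 (A', B', C', D') * f ?s" .
    have pw: "real_of_int a powr (of_int w / 2) * (of_int a' / of_int a) powr (of_int w / 2) = of_int a' powr (of_int w / 2)"
      using a(1) h(1) by (simp add: powr_mult[symmetric])
    have "hterm a b (moeb (A, B, ?C, D) \<tau>) =
      of_real (real_of_int a powr (of_int w / 2) * (of_int a' / of_int a) powr (of_int w / 2)) * ?z powi w * (\<psi> a * char1 (A', B', C', D')) * f ?s"
      unfolding hterm_def fe of_real_mult by (simp only: mult_ac)
    also have "\<dots> = ?z powi w * char1 (A, B, ?C, D) * hterm a' b' \<tau>"
      unfolding pw ratio hterm_def d' by (simp only: mult_ac)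
    finally show ?thesis .
  qed
  have "hrel A B ?C D (a, b) (a', b')"
    unfolding hrel_def case_prod_conv d'[symmetric] using h(5,7-10) by blast
  then have "hrel A B ?C D (a, b) (a', b' mod (int l div a'))" by (rule hrel_mod)
  moreover have "(a', b' mod (int l div a')) \<in> idx"
    using h(1,2,4) a' unfolding idx_def d' by auto
  ultimately show ?thesis
    using main hterm_mod[OF h(1) a'] by (intro bexI[of _ "(a', b' mod (int l div a'))"]) auto
qed

text \<open>The induced map on the finite index set is injective by \<open>hrel_inj\<close>, hence a
  permutation, and the common factor comes out of the sum.\<close>

lemma F_transform_good:
  assumes det: "A * D - B * (int N * c) = 1" and c: "c > 0" "odd c" and D: "D > 0" "coprime D 6" and \<tau>: "\<tau> \<in> upper"
  shows "F (moeb (A, B, int N * c, D) \<tau>) = csqrt (of_int (int N * c) * \<tau> + of_int D) powi w * char1 (A, B, int N * c, D) * F \<tau>"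
proof -
  let ?X = "csqrt (of_int (int N * c) * \<tau> + of_int D) powi w * char1 (A, B, int N * c, D)"
  have "\<forall>p\<in>idx. \<exists>q. q \<in> idx \<and> hrel A B (int N * c) D p q \<and>
      hterm (fst p) (snd p) (moeb (A, B, int N * c, D) \<tau>) = ?X * hterm (fst q) (snd q) \<tau>"
  proof
    fix p assume p: "p \<in> idx"
    from hterm_transform[OF det c D, of "fst p" "snd p"] p \<tau>
    show "\<exists>q. q \<in> idx \<and> hrel A B (int N * c) D p q \<and>
      hterm (fst p) (snd p) (moeb (A, B, int N * c, D) \<tau>) = ?X * hterm (fst q) (snd q) \<tau>"
      unfolding prod.collapse by blast
  qed
  from bchoice[OF this] obtain \<pi> where \<pi>: "\<And>p. p \<in> idx \<Longrightarrow> \<pi> p \<in> idx"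
    "\<And>p. p \<in> idx \<Longrightarrow> hrel A B (int N * c) D p (\<pi> p)"
    "\<And>p. p \<in> idx \<Longrightarrow> hterm (fst p) (snd p) (moeb (A, B, int N * c, D) \<tau>) = ?X * hterm (fst (\<pi> p)) (snd (\<pi> p)) \<tau>"
    by blast
  have "inj_on \<pi> idx"
  proof (rule inj_onI)
    fix x y assume xy: "x \<in> idx" "y \<in> idx" "\<pi> x = \<pi> y"
    show "x = y" by (rule hrel_inj[OF \<pi>(2)[OF xy(1)] \<pi>(2)[OF xy(2), folded xy(3)] xy(1,2) \<pi>(1)[OF xy(1)]])
  qed
  moreover have "\<pi> ` idx \<subseteq> idx" using \<pi>(1) by blast
  ultimately have bij: "bij_betw \<pi> idx idx" unfolding bij_betw_def using endo_inj_surj[OF finite_idx] by blast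
  have "(\<Sum>p\<in>idx. hterm (fst p) (snd p) (moeb (A, B, int N * c, D) \<tau>)) = (\<Sum>p\<in>idx. ?X * hterm (fst (\<pi> p)) (snd (\<pi> p)) \<tau>)"
    by (intro sum.cong refl \<pi>(3))
  also have "\<dots> = (\<Sum>p\<in>idx. ?X * hterm (fst p) (snd p) \<tau>)"
    by (rule sum.reindex_bij_betw[OF bij])
  also have "\<dots> = ?X * (\<Sum>p\<in>idx. hterm (fst p) (snd p) \<tau>)" by (rule sum_distrib_left[symmetric])
  finally show ?thesis unfolding F_def case_prod_beta by simp
qed

lemma G_good:
  assumes "A * D - B * (int N * c) = 1" "c > 0" "odd c" "D > 0" "coprime D 6" "\<tau> \<in> upper"
  shows "G (moeb (A, B, int N * c, D) \<tau>) = G \<tau>"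
proof -
  let ?X = "csqrt (of_int (int N * c) * \<tau> + of_int D) powi w * char1 (A, B, int N * c, D)"
  have fe: "f (moeb (A, B, int N * c, D) \<tau>) = ?X * f \<tau>"
    by (rule f_transform[OF assms(1) dvd_triv_left assms(6)])
  have "f (moeb (A, B, int N * c, D) \<tau>) \<noteq> 0" using f_nonzero moeb_upper[OF assms(1,6)] by blast
  then have "?X \<noteq> 0" unfolding fe by auto
  then show ?thesis unfolding G_def F_transform_good[OF assms] fe by (rule mult_divide_mult_cancel_left)
qed

text \<open>The matrix with \<open>c = D = 1\<close> meets the conditions of \<open>G_good\<close>.
  Its powers provide the freedom to change \<open>c\<close> in the general case.\<close>

lemma G_lower:
  assumes "\<tau> \<in> upper"
  shows "G (moeb (1, 0, int N * int n, 1) \<tau>) = G \<tau>"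
proof (induction n)
  case 0
  show ?case by (simp add: moeb_def)
next
  case (Suc n)
  have u: "moeb (1, 0, int N * int n, 1) \<tau> \<in> upper" using moeb_upper[of 1 1 0] assms by simp
  have "moeb (1, 0, int N * 1, 1) (moeb (1, 0, int N * int n, 1) \<tau>) = moeb (1, 0, int N * int (Suc n), 1) \<tau>"
    using moeb_mult[of 1 1 0 "int N * int n" \<tau> 1 0 "int N * 1" 1] assms by (simp add: algebra_simps)
  moreover have "G (moeb (1, 0, int N * 1, 1) (moeb (1, 0, int N * int n, 1) \<tau>)) = G (moeb (1, 0, int N * int n, 1) \<tau>)"
    by (rule G_good[OF _ _ _ _ _ u]) simp_all
  ultimately show ?case using Suc by simp
qed

text \<open>A translation on the right makes \<open>D\<close> positive and prime to 6; a lower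
  unipotent factor on the right then makes \<open>c\<close> positive and odd. \<open>G\<close> is
  invariant under both corrections.\<close>

lemma G_invariant:
  assumes det: "A * D - B * C = 1" and NC: "int N dvd C" and \<tau>: "\<tau> \<in> upper"
  shows "G (moeb (A, B, C, D) \<tau>) = G \<tau>"
proof (cases "C = 0")
  case True
  then have "A * D = 1" using det by simp
  then have "A = 1 \<and> D = 1 \<or> A = -1 \<and> D = -1" by (simp only: zmult_eq_1_iff)
  then have "moeb (A, B, C, D) \<tau> = \<tau> + of_int (B * D)" using True by (auto simp: moeb_def)
  then show ?thesis by (simp only: G_add_int)
next
  case False
  obtain c where c: "C = int N * c" using NC by (elim dvdE)
  have c0: "c \<noteq> 0" using False c by auto
  have "coprime D C"
  proof (rule coprimeI)
    fix q assume "q dvd D" "q dvd C"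
    then have "q dvd A * D - B * C" by (meson dvd_diff dvd_mult)
    then show "is_unit q" unfolding det .
  qed
  then obtain j where j: "D + j * C > 0" "coprime (D + j * C) 6" using ex_shift_coprime_6 False by blast
  define D1 B1 where "D1 = D + j * C" and "B1 = B + j * A"
  have det1: "A * D1 - B1 * (int N * c) = 1" using det unfolding D1_def B1_def c by (simp add: algebra_simps)
  have G1: "G (moeb (A, B1, int N * c, D1) \<sigma>) = G \<sigma>" if \<sigma>: "\<sigma> \<in> upper" for \<sigma>
  proof -
    \<comment> \<open>\<open>n\<close> is at least \<open>2 \<bar>c\<bar>\<close>, so that
      \<open>c + n D1\<close> is positive, and odd exactly when \<open>c\<close> is even, so that
      this sum is odd.\<close>
    define n where "n = nat (2 * \<bar>c\<bar> + (if even c then 1 else 0))"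
    have n: "int n = 2 * \<bar>c\<bar> + (if even c then 1 else 0)" by (simp add: n_def)
    define c2 where "c2 = c + int n * D1"
    have oD: "odd D1" using j(2) coprime_6_iff unfolding D1_def by blast
    have c2odd: "odd c2" unfolding c2_def using n oD by (cases "even c") auto
    have c2pos: "c2 > 0"
    proof -
      have "int n * 1 \<le> int n * D1" using j(1) unfolding D1_def by (intro mult_left_mono) auto
      moreover have "int n \<ge> 2 * \<bar>c\<bar>" using n by simp
      ultimately show ?thesis unfolding c2_def using c0 by linarith
    qed
    define \<rho> where "\<rho> = moeb (1, 0, - (int N * int n), 1) \<sigma>"
    have \<rho>: "\<rho> \<in> upper" unfolding \<rho>_def using moeb_upper[of 1 1 0] \<sigma> by simp
    have V: "moeb (1, 0, int N * int n, 1) \<rho> = \<sigma>"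
      unfolding \<rho>_def using moeb_mult[of 1 1 0 "- (int N * int n)" \<sigma> 1 0 "int N * int n" 1] \<sigma> by (simp add: moeb_def)
    have det2: "(A + B1 * (int N * int n)) * D1 - B1 * (int N * c2) = 1"
      using det1 unfolding c2_def by (simp add: algebra_simps)
    have "moeb (A, B1, int N * c, D1) \<sigma> = moeb (A + B1 * (int N * int n), B1, int N * c2, D1) \<rho>"
      using moeb_mult[of 1 1 0 "int N * int n" \<rho> A B1 "int N * c" D1] \<rho> unfolding V c2_def by (simp add: algebra_simps)
    then have "G (moeb (A, B1, int N * c, D1) \<sigma>) = G \<rho>"
      using G_good[OF det2 c2pos c2odd _ _ \<rho>] j unfolding D1_def by simp
    also have "\<dots> = G \<sigma>" using G_lower[OF \<rho>, of n] unfolding V by simp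
    finally show ?thesis .
  qed
  have \<tau>': "\<tau> + of_int (- j) \<in> upper" using \<tau> by (simp add: upper_def)
  have "moeb (A, B, C, D) \<tau> = moeb (A, B1, int N * c, D1) (\<tau> + of_int (- j))"
    unfolding moeb_def case_prod_conv B1_def D1_def c by (simp add: algebra_simps)
  then show ?thesis using G1[OF \<tau>'] G_add_int[of \<tau> "- j"] by (simp only:)
qed

end

section \<open>Behaviour at the cusps\<close>

lemma csqrt_affine_holomorphic:
  fixes A B C D :: int
  assumes det: "A * D - B * C = 1"
  shows "(\<lambda>\<tau>. csqrt (of_int C * \<tau> + of_int D)) holomorphic_on upper"
proof (cases "C = 0")
  case True
  then show ?thesis by simp
next
  case False
  have "of_int C * \<tau> + of_int D \<notin> \<real>\<^sub>\<le>\<^sub>0" if "\<tau> \<in> upper" for \<tau>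
    using that False by (simp add: complex_nonpos_Reals_iff upper_def)
  then show ?thesis by (intro holomorphic_on_csqrt' holomorphic_intros)
qed

lemma slash_holomorphic:
  assumes det: "A * D - B * C = 1" and g: "g holomorphic_on upper"
  shows "slash k (A, B, C, D) 1 g holomorphic_on upper"
proof -
  have "(g \<circ> moeb (A, B, C, D)) holomorphic_on upper"
  proof (rule holomorphic_on_compose_gen[OF _ g])
    show "moeb (A, B, C, D) holomorphic_on upper"
      unfolding moeb_def case_prod_conv using denom_nonzero[OF det] by (intro holomorphic_intros) auto
    show "moeb (A, B, C, D) ` upper \<subseteq> upper" using moeb_upper[OF det] by blast
  qed
  moreover have "(\<lambda>\<tau>. csqrt (of_int C * \<tau> + of_int D) powi (- k)) holomorphic_on upper"
    using denom_nonzero[OF det] by (intro holomorphic_on_power_int csqrt_affine_holomorphic[OF det]) auto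
  ultimately have "(\<lambda>\<tau>. csqrt (of_int C * \<tau> + of_int D) powi (- k) * (g \<circ> moeb (A, B, C, D)) \<tau>) holomorphic_on upper"
    by (rule holomorphic_on_mult[rotated])
  then show ?thesis by (rule holomorphic_transform) (simp add: slash_def)
qed

lemma Psi_Rats: "Psi \<gamma> \<in> \<rat>"
proof -
  have s: "sawtooth x \<in> \<rat>" if "x \<in> \<rat>" for x
    using that by (simp add: sawtooth_def)
  have "dedekind_sum h k \<in> \<rat>" for h k
    unfolding dedekind_sum_def by (intro Rats_sum Rats_mult s Rats_divide Rats_of_int)
  then show ?thesis unfolding Psi_def by (cases \<gamma>) simp
qed

text \<open>The exponent of the character is rational. At a cusp this makes some multiple of the
  translation by \<open>N\<close> act trivially.\<close>

lemma eta_char_root_of_unity: "\<exists>n>0. eta_char r N \<gamma> 1 ^ n = 1"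
proof -
  obtain A B C D where \<gamma>: "\<gamma> = (A, B, C, D)" by (metis prod_cases4)
  define q where "q = (1 / 24) * (\<Sum>n\<in>{n. n dvd N}. of_int (r n) * Psi (A, B * int n, C div int n, D))"
  have "q \<in> \<rat>" unfolding q_def by (intro Rats_mult Rats_sum Psi_Rats Rats_of_int Rats_divide) simp_all
  then obtain a b :: int where ab: "b > 0" "q = of_int a / of_int b" by (rule Rats_cases')
  have "eta_char r N \<gamma> 1 ^ nat b = ee (of_nat (nat b) * of_real q)"
    unfolding ee_of_nat_mult \<gamma> eta_char_def case_prod_conv q_def by simp
  also have "of_nat (nat b) * of_real q = (of_int a :: complex)" using ab by simp
  finally have "eta_char r N \<gamma> 1 ^ nat b = 1" by simp
  moreover have "nat b > 0" using ab by simp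
  ultimately show ?thesis by blast
qed

context eta_hecke_form
begin

lemma hterm_holomorphic:
  assumes "(a, b) \<in> idx"
  shows "hterm a b holomorphic_on upper"
proof -
  have a: "a > 0" "a dvd int l" using assms by (auto simp: idx_def)
  have "(f \<circ> (\<lambda>\<tau>. (of_int a * \<tau> + of_int b) / of_int (int l div a))) holomorphic_on upper"
    by (rule holomorphic_on_compose_gen[OF _ f_holomorphic])
       (use upper_affine[OF _ a(1) idx_cofactor(1)[OF a]] idx_cofactor(1)[OF a] in \<open>auto intro!: holomorphic_intros\<close>)
  then have "(\<lambda>\<tau>. f ((of_int a * \<tau> + of_int b) / of_int (int l div a))) holomorphic_on upper" by (simp add: o_def)
  then have "(\<lambda>\<tau>. hterm a b \<tau>) holomorphic_on upper" unfolding hterm_def by (intro holomorphic_on_mult holomorphic_on_const)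
  then show ?thesis .
qed

lemma F_holomorphic: "F holomorphic_on upper"
proof -
  have "(\<lambda>\<tau>. (\<Sum>p\<in>idx. hterm (fst p) (snd p) \<tau>) / of_nat l) holomorphic_on upper"
    using l by (intro holomorphic_on_divide holomorphic_on_sum holomorphic_on_const hterm_holomorphic) auto
  then show ?thesis by (rule holomorphic_transform) (simp add: F_def case_prod_beta)
qed

lemma on_upper_F_holomorphic: "on_upper F holomorphic_on upper"
  by (rule holomorphic_transform[OF F_holomorphic]) (simp add: on_upper_def)

lemma slash_f_nonzero:
  assumes "A * D - B * C = 1" "\<tau> \<in> upper"
  shows "slash w (A, B, C, D) 1 (on_upper f) \<tau> \<noteq> 0"
  using denom_nonzero[OF assms] f_nonzero[OF moeb_upper[OF assms]] moeb_upper[OF assms]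
  by (simp add: slash_def on_upper_def)

lemma slash_F_eq:
  assumes "A * D - B * C = 1" "\<tau> \<in> upper"
  shows "slash w (A, B, C, D) 1 (on_upper F) \<tau> = slash w (A, B, C, D) 1 (on_upper f) \<tau> * G (moeb (A, B, C, D) \<tau>)"
  using f_nonzero[OF moeb_upper[OF assms]] moeb_upper[OF assms]
  by (simp add: slash_def on_upper_def G_def)

text \<open>Each term of \<open>F\<close> slashed by \<open>\<sigma>\<close> is a constant times a
  slash of \<open>f\<close> at some cusp, evaluated at a point whose height is scaled by
  \<open>a' / d'\<close>. The expansions of \<open>f\<close> at all cusps bound these.\<close>

lemma F_bounded_at_cusp:
  assumes det: "A * D - B * C = 1"
  shows "\<exists>K. \<forall>\<tau>. Im \<tau> \<ge> 1 \<longrightarrow> norm (slash w (A, B, C, D) 1 (on_upper F) \<tau>) \<le> K"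
proof -
  have "\<forall>p\<in>idx. \<exists>K. \<forall>\<tau>. Im \<tau> \<ge> 1 \<longrightarrow>
      norm (csqrt (of_int C * \<tau> + of_int D) powi (- w) * hterm (fst p) (snd p) (moeb (A, B, C, D) \<tau>)) \<le> K"
  proof
    fix p assume p: "p \<in> idx"
    obtain a b where ab: "p = (a, b)" by (cases p)
    have a: "a > 0" "a dvd int l" using p by (auto simp: ab idx_def)
    let ?d = "int l div a"
    note d = idx_cofactor[OF a]
    have c1: "coprime a 1" by simp
    \<comment> \<open>The coset relation is taken at level 1, because \<open>\<sigma>\<close> ranges
      over the full modular group.\<close>
    obtain a' b' d' A' B' C' D' where h: "a' > 0" "a' * d' = a * ?d" "coprime a' 1"
      "A' * D' - B' * C' = 1" "1 dvd C'"
      "a * A + b * C = A' * a'" "a * B + b * D = A' * b' + B' * d'" "?d * C = C' * a'" "?d * D = C' * b' + D' * d'"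
      by (rule hecke_coset[OF det one_dvd a(1) d(1) c1])
    have d': "d' > 0" by (rule hecke_coset_relations(3)[OF a(1) d(1) h(1,2,8,9)])
    have "(A', B', C', D') \<in> Gamma0 1" using h(4) by (simp add: Gamma0_def)
    then have q: "qexp_nonneg (slash w (A', B', C', D') 1 (on_upper f))"
      using f_Mk unfolding Mk_def w_def by blast
    have pos: "of_int a' / of_int d' > (0::real)" using h(1) d' by simp
    obtain K where K: "\<And>s. Im s \<ge> of_int a' / of_int d' \<Longrightarrow> norm (slash w (A', B', C', D') 1 (on_upper f) s) \<le> K"
      using qexp_nonneg_bounded[OF q pos] by blast
    define x where "x = sqrt (of_int a' / of_int a)"
    have x: "x > 0" using h(1) a(1) by (simp add: x_def)
    define c where "c = \<psi> a * of_real (real_of_int a powr (real_of_int w / 2)) * of_real x powi w"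
    have "norm (csqrt (of_int C * \<tau> + of_int D) powi (- w) * hterm a b (moeb (A, B, C, D) \<tau>)) \<le> norm c * K"
      if \<tau>1: "Im \<tau> \<ge> 1" for \<tau>
    proof -
      have \<tau>: "\<tau> \<in> upper" using \<tau>1 by (simp add: upper_def)
      let ?s = "(of_int a' * \<tau> + of_int b') / of_int d'" and ?z = "csqrt (of_int C * \<tau> + of_int D)"
      note act = hecke_coset_action[OF det a(1) d(1) h(1) d' h(2,6-9) \<tau>]
      have s: "?s \<in> upper" by (rule upper_affine[OF \<tau> h(1) d'])
      have "?s = of_real (of_int a' / of_int d') * \<tau> + of_real (of_int b' / of_int d')"
        by (simp add: add_divide_distrib)
      then have "Im ?s = of_int a' / of_int d' * Im \<tau>" by simp
      also have "\<dots> \<ge> of_int a' / of_int d' * 1"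
        using h(1) d' by (intro mult_left_mono \<tau>1) simp
      finally have Ims: "Im ?s \<ge> of_int a' / of_int d'" by simp
      have "slash w (A', B', C', D') 1 (on_upper f) ?s = (of_real x * ?z) powi (- w) * f (moeb (A', B', C', D') ?s)"
        using moeb_upper[OF h(4) s] act(2) by (simp add: slash_def on_upper_def x_def)
      moreover have "of_real x powi w * (of_real x * ?z) powi (- w) = ?z powi (- w)"
        using x by (simp add: power_int_mult_distrib power_int_minus)
      ultimately have "?z powi (- w) * f (moeb (A', B', C', D') ?s) = of_real x powi w * slash w (A', B', C', D') 1 (on_upper f) ?s"
        by (simp add: mult.assoc[symmetric])
      then have "?z powi (- w) * hterm a b (moeb (A, B, C, D) \<tau>) = c * slash w (A', B', C', D') 1 (on_upper f) ?s"
        unfolding hterm_def act(1) c_def by (metis (no_types, lifting) mult.assoc mult.left_commute)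
      then show ?thesis using K[OF Ims] by (simp add: norm_mult mult_left_mono)
    qed
    then show "\<exists>K. \<forall>\<tau>. Im \<tau> \<ge> 1 \<longrightarrow>
      norm (csqrt (of_int C * \<tau> + of_int D) powi (- w) * hterm (fst p) (snd p) (moeb (A, B, C, D) \<tau>)) \<le> K"
      unfolding ab fst_conv snd_conv by blast
  qed
  from bchoice[OF this] obtain K where K: "\<And>p \<tau>. p \<in> idx \<Longrightarrow> Im \<tau> \<ge> 1 \<Longrightarrow>
      norm (csqrt (of_int C * \<tau> + of_int D) powi (- w) * hterm (fst p) (snd p) (moeb (A, B, C, D) \<tau>)) \<le> K p" by blast
  have "norm (slash w (A, B, C, D) 1 (on_upper F) \<tau>) \<le> (\<Sum>p\<in>idx. K p) / real l" if \<tau>1: "Im \<tau> \<ge> 1" for \<tau>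
  proof -
    have \<tau>: "\<tau> \<in> upper" using \<tau>1 by (simp add: upper_def)
    have "slash w (A, B, C, D) 1 (on_upper F) \<tau> =
       (\<Sum>p\<in>idx. csqrt (of_int C * \<tau> + of_int D) powi (- w) * hterm (fst p) (snd p) (moeb (A, B, C, D) \<tau>)) / of_nat l"
      using moeb_upper[OF det \<tau>] by (simp add: slash_def on_upper_def F_def case_prod_beta sum_distrib_left)
    also have "norm \<dots> \<le> (\<Sum>p\<in>idx. K p) / real l"
      unfolding norm_divide norm_of_nat by (intro divide_right_mono sum_norm_le K \<tau>1) auto
    finally show ?thesis .
  qed
  then show ?thesis by blast
qed

text \<open>Conjugating the translation by \<open>N\<close> with \<open>\<sigma>\<close> gives an
  element of \<open>\<Gamma>0(N)\<close>, so \<open>f\<close> slashed by \<open>\<sigma>\<close> is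
  multiplied by a root of unity under this translation. \<open>F\<close> inherits the same factor
  since \<open>G\<close> is invariant, and a suitable multiple of \<open>N\<close> is a
  period.\<close>

lemma F_periodic_at_cusp:
  assumes det: "A * D - B * C = 1"
  shows "\<exists>h::nat. h > 0 \<and> (\<forall>\<tau>\<in>upper. slash w (A, B, C, D) 1 (on_upper F) (\<tau> + of_nat h) = slash w (A, B, C, D) 1 (on_upper F) \<tau>)"
proof -
  define S where "S = slash w (A, B, C, D) 1 (on_upper f)"
  define n where "n = int N"
  \<comment> \<open>The entries of \<open>\<sigma> (1, n; 0, 1) \<sigma>^-1\<close>.\<close>
  define \<gamma>1 \<gamma>2 \<gamma>3 \<gamma>4 where "\<gamma>1 = 1 - n * A * C" and "\<gamma>2 = n * A * A" and "\<gamma>3 = n * (- C * C)" and "\<gamma>4 = 1 + n * A * C"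
  have det\<gamma>: "\<gamma>1 * \<gamma>4 - \<gamma>2 * \<gamma>3 = 1" by (simp add: \<gamma>1_def \<gamma>2_def \<gamma>3_def \<gamma>4_def algebra_simps)
  have N\<gamma>: "int N dvd \<gamma>3" by (simp add: \<gamma>3_def n_def)
  let ?\<gamma> = "(\<gamma>1, \<gamma>2, \<gamma>3, \<gamma>4)" and ?\<sigma> = "(A, B, C, D)"
  have e: "\<gamma>1 * A + \<gamma>2 * C = A" "\<gamma>3 * A + \<gamma>4 * C = C" by (simp_all add: \<gamma>1_def \<gamma>2_def \<gamma>3_def \<gamma>4_def algebra_simps)
  have e': "\<gamma>1 * B + \<gamma>2 * D = B + n * A" "\<gamma>3 * B + \<gamma>4 * D = D + n * C"
  proof -
    have "\<gamma>1 * B + \<gamma>2 * D = B + n * A * (A * D - B * C)" by (simp add: \<gamma>1_def \<gamma>2_def algebra_simps)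
    then show "\<gamma>1 * B + \<gamma>2 * D = B + n * A" using det by simp
    have "\<gamma>3 * B + \<gamma>4 * D = D + n * C * (A * D - B * C)" by (simp add: \<gamma>3_def \<gamma>4_def algebra_simps)
    then show "\<gamma>3 * B + \<gamma>4 * D = D + n * C" using det by simp
  qed
  have shift: "moeb ?\<sigma> (\<tau> + of_nat N) = moeb ?\<gamma> (moeb ?\<sigma> \<tau>)" if "\<tau> \<in> upper" for \<tau>
    unfolding moeb_mult[OF det that] e e' by (simp add: moeb_def n_def algebra_simps)
  have up: "\<tau> + of_nat k \<in> upper" if "\<tau> \<in> upper" for \<tau> k using that by (simp add: upper_def)
  have S0: "S \<tau> \<noteq> 0" if "\<tau> \<in> upper" for \<tau> unfolding S_def by (rule slash_f_nonzero[OF det that])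
  have ratio: "S (\<tau> + of_nat N) / S \<tau> \<in> {char1 ?\<gamma>, - char1 ?\<gamma>}" if \<tau>: "\<tau> \<in> upper" for \<tau>
  proof -
    let ?j = "of_int C * \<tau> + of_int D :: complex" and ?jN = "of_int C * (\<tau> + of_nat N) + of_int D :: complex"
      and ?jg = "of_int \<gamma>3 * moeb ?\<sigma> \<tau> + of_int \<gamma>4 :: complex"
    have j0: "?j \<noteq> 0" "?jN \<noteq> 0" by (rule denom_nonzero[OF det \<tau>], rule denom_nonzero[OF det up[OF \<tau>]])
    \<comment> \<open>The cocycle identity holds for \<open>c \<tau> + d\<close>, hence for its
      square roots up to the sign \<open>u\<close>.\<close>
    define u where "u = csqrt ?jg * csqrt ?j / csqrt ?jN"
    have mj: "moeb ?\<sigma> \<tau> * ?j = of_int A * \<tau> + of_int B" using j0 by (simp add: moeb_def)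
    have "?jg * ?j = of_int \<gamma>3 * (moeb ?\<sigma> \<tau> * ?j) + of_int \<gamma>4 * ?j" by (simp only: distrib_right mult.assoc)
    also have "\<dots> = of_int \<gamma>3 * (of_int A * \<tau> + of_int B) + of_int \<gamma>4 * ?j" unfolding mj ..
    also have "\<dots> = of_int (\<gamma>3 * A + \<gamma>4 * C) * \<tau> + of_int (\<gamma>3 * B + \<gamma>4 * D)" by (simp add: algebra_simps)
    also have "\<dots> = ?jN" unfolding e e' by (simp add: n_def algebra_simps)
    finally have "u\<^sup>2 = 1" unfolding u_def using j0 by (simp add: power_mult_distrib power_divide)
    then have u: "u = 1 \<or> u = -1" by (simp add: power2_eq_1_iff)
    have fu: "moeb ?\<sigma> \<tau> \<in> upper" "moeb ?\<sigma> (\<tau> + of_nat N) \<in> upper"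
      by (rule moeb_upper[OF det \<tau>], rule moeb_upper[OF det up[OF \<tau>]])
    have "f (moeb ?\<sigma> (\<tau> + of_nat N)) = csqrt ?jg powi w * char1 ?\<gamma> * f (moeb ?\<sigma> \<tau>)"
      unfolding shift[OF \<tau>] by (rule f_transform[OF det\<gamma> N\<gamma> fu(1)])
    then have "S (\<tau> + of_nat N) = csqrt ?jN powi (- w) * (csqrt ?jg powi w * char1 ?\<gamma> * f (moeb ?\<sigma> \<tau>))"
      using fu unfolding S_def slash_def on_upper_def by simp
    moreover have "S \<tau> = csqrt ?j powi (- w) * f (moeb ?\<sigma> \<tau>)"
      using fu unfolding S_def slash_def on_upper_def by simp
    ultimately have "S (\<tau> + of_nat N) = u powi w * char1 ?\<gamma> * S \<tau>"
      unfolding u_def power_int_mult_distrib power_int_divide_distrib using j0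
      by (simp add: power_int_minus field_simps)
    then have "S (\<tau> + of_nat N) / S \<tau> = u powi w * char1 ?\<gamma>" using S0[OF \<tau>] by simp
    moreover have "u powi w = 1 \<or> u powi w = -1" using u by (elim disjE) (simp_all add: power_int_minus_left)
    ultimately show ?thesis by auto
  qed
  \<comment> \<open>The sign might vary with \<open>\<tau>\<close>, but a continuous function with
    finitely many values on a connected set is constant.\<close>
  have "(\<lambda>\<tau>. S (\<tau> + of_nat N) / S \<tau>) constant_on upper"
  proof (rule continuous_finite_range_constant)
    show "connected upper" by (rule convex_connected[OF convex_upper])
    have "on_upper f holomorphic_on upper"
      by (rule holomorphic_transform[OF f_holomorphic]) (simp add: on_upper_def)
    then have hS: "S holomorphic_on upper" unfolding S_def by (rule slash_holomorphic[OF det])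
    have "(S \<circ> (\<lambda>\<tau>. \<tau> + of_nat N)) holomorphic_on upper"
      by (rule holomorphic_on_compose_gen[OF _ hS]) (auto intro!: holomorphic_intros up)
    then have "(\<lambda>\<tau>. S (\<tau> + of_nat N) / S \<tau>) holomorphic_on upper"
      using S0 hS by (intro holomorphic_on_divide) (auto simp: o_def)
    then show "continuous_on upper (\<lambda>\<tau>. S (\<tau> + of_nat N) / S \<tau>)" by (rule holomorphic_on_imp_continuous_on)
    have "(\<lambda>\<tau>. S (\<tau> + of_nat N) / S \<tau>) ` upper \<subseteq> {char1 ?\<gamma>, - char1 ?\<gamma>}" using ratio by blast
    then show "finite ((\<lambda>\<tau>. S (\<tau> + of_nat N) / S \<tau>) ` upper)" by (rule finite_subset) simp
  qed
  then obtain \<kappa> where \<kappa>: "\<And>\<tau>. \<tau> \<in> upper \<Longrightarrow> S (\<tau> + of_nat N) / S \<tau> = \<kappa>"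
    unfolding constant_on_def by blast
  have i: "\<i> \<in> upper" by (simp add: upper_def)
  have \<kappa>v: "\<kappa> = char1 ?\<gamma> \<or> \<kappa> = - char1 ?\<gamma>" using ratio[OF i] \<kappa>[OF i] by auto
  obtain k where k: "k > 0" "char1 ?\<gamma> ^ k = 1" using eta_char_root_of_unity by blast
  \<comment> \<open>Doubling the exponent removes the undetermined sign.\<close>
  have "(char1 ?\<gamma> ^ k) ^ 2 = 1" using k(2) by simp
  then have \<kappa>1: "\<kappa> ^ (k * 2) = 1" using \<kappa>v by (auto simp: power_mult[symmetric])
  define T where "T = slash w ?\<sigma> 1 (on_upper F)"
  have T1: "T (\<tau> + of_nat N) = \<kappa> * T \<tau>" if \<tau>: "\<tau> \<in> upper" for \<tau>
  proof -
    have "T (\<tau> + of_nat N) = S (\<tau> + of_nat N) * G (moeb ?\<gamma> (moeb ?\<sigma> \<tau>))"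
      unfolding T_def S_def slash_F_eq[OF det up[OF \<tau>]] shift[OF \<tau>] ..
    also have "\<dots> = \<kappa> * S \<tau> * G (moeb ?\<sigma> \<tau>)"
      using \<kappa>[OF \<tau>] S0[OF \<tau>] G_invariant[OF det\<gamma> N\<gamma> moeb_upper[OF det \<tau>]] by (simp add: field_simps)
    also have "\<dots> = \<kappa> * T \<tau>" unfolding T_def S_def slash_F_eq[OF det \<tau>] by simp
    finally show ?thesis .
  qed
  have Tj: "T (\<tau> + of_nat (j * N)) = \<kappa> ^ j * T \<tau>" if \<tau>: "\<tau> \<in> upper" for \<tau> j
  proof (induction j)
    case (Suc j)
    have "T (\<tau> + of_nat (Suc j * N)) = T (\<tau> + of_nat (j * N) + of_nat N)" by (simp add: algebra_simps)
    then show ?case using T1[OF up[OF \<tau>, of "j * N"]] Suc by simp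
  qed simp
  have "T (\<tau> + of_nat (k * 2 * N)) = T \<tau>" if "\<tau> \<in> upper" for \<tau>
    unfolding Tj[OF that] \<kappa>1 by simp
  moreover have "k * 2 * N > 0" using k N by simp
  ultimately show ?thesis unfolding T_def by blast
qed

lemma F_in_Mk: "on_upper F \<in> Mk w N (eta_char r N)"
proof -
  have "modular_invariant w N (eta_char r N) (on_upper F)"
    unfolding modular_invariant_def
  proof (intro conjI ballI allI impI)
    show "on_upper F holomorphic_on upper" by (rule on_upper_F_holomorphic)
    show "on_upper F \<tau> = 0" if "\<tau> \<notin> upper" for \<tau> using that by (simp add: on_upper_def)
    fix \<gamma> :: mat2 and \<epsilon> :: int and \<tau> assume \<gamma>: "\<gamma> \<in> Gamma0 N" and \<epsilon>: "\<epsilon> \<in> {1, -1}" and \<tau>: "\<tau> \<in> upper"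
    obtain A B C D where g: "\<gamma> = (A, B, C, D)" by (metis prod_cases4)
    have det: "A * D - B * C = 1" and NC: "int N dvd C" using \<gamma> by (auto simp: g Gamma0_def)
    have u: "moeb (A, B, C, D) \<tau> \<in> upper" by (rule moeb_upper[OF det \<tau>])
    have "F (moeb (A, B, C, D) \<tau>) = G \<tau> * f (moeb (A, B, C, D) \<tau>)"
      using G_invariant[OF det NC \<tau>] f_nonzero[OF u] by (simp add: G_def field_simps)
    also have "\<dots> = csqrt (of_int C * \<tau> + of_int D) powi w * char1 (A, B, C, D) * (G \<tau> * f \<tau>)"
      unfolding f_transform[OF det NC \<tau>] by (simp only: mult_ac)
    also have "G \<tau> * f \<tau> = F \<tau>" using f_nonzero[OF \<tau>] by (simp add: G_def)
    finally have Fe: "F (moeb (A, B, C, D) \<tau>) = csqrt (of_int C * \<tau> + of_int D) powi w * char1 (A, B, C, D) * F \<tau>" .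
    have "csqrt (of_int C * \<tau> + of_int D) \<noteq> 0" using denom_nonzero[OF det \<tau>] by simp
    then have "slash w \<gamma> \<epsilon> (on_upper F) \<tau> = of_int \<epsilon> powi (- w) * char1 (A, B, C, D) * F \<tau>"
      using u unfolding g slash_def on_upper_def case_prod_conv power_int_mult_distrib
      by (simp add: Fe power_int_minus)
    also have "of_int \<epsilon> powi (- w) * char1 (A, B, C, D) = eta_char r N \<gamma> \<epsilon>"
      by (simp add: g eta_char_def w_def)
    also have "F \<tau> = on_upper F \<tau>" using \<tau> by (simp add: on_upper_def)
    finally show "slash w \<gamma> \<epsilon> (on_upper F) \<tau> = eta_char r N \<gamma> \<epsilon> * on_upper F \<tau>" .
  qed
  moreover have "qexp_nonneg (slash w \<sigma> 1 (on_upper F))" if "\<sigma> \<in> Gamma0 1" for \<sigma>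
  proof -
    obtain A B C D where g: "\<sigma> = (A, B, C, D)" by (metis prod_cases4)
    have det: "A * D - B * C = 1" using that by (auto simp: g Gamma0_def)
    obtain K where K: "\<And>\<tau>. Im \<tau> \<ge> 1 \<Longrightarrow> norm (slash w (A, B, C, D) 1 (on_upper F) \<tau>) \<le> K"
      using F_bounded_at_cusp[OF det] by blast
    obtain h :: nat where h: "h > 0" and per: "\<And>\<tau>. \<tau> \<in> upper \<Longrightarrow> slash w (A, B, C, D) 1 (on_upper F) (\<tau> + of_nat h) = slash w (A, B, C, D) 1 (on_upper F) \<tau>"
      using F_periodic_at_cusp[OF det] by blast
    have hr: "real h > 0" using h by simp
    have per': "slash w (A, B, C, D) 1 (on_upper F) (\<tau> + of_real (real h)) = slash w (A, B, C, D) 1 (on_upper F) \<tau>" if "\<tau> \<in> upper" for \<tau>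
      using per[OF that] by simp
    obtain c where c: "\<And>\<tau>. \<tau> \<in> upper \<Longrightarrow> (\<lambda>n. c n * ee (\<tau> / of_real (real h)) ^ n) sums slash w (A, B, C, D) 1 (on_upper F) \<tau>"
      using periodic_bounded_expansion[OF hr slash_holomorphic[OF det on_upper_F_holomorphic] per' zero_less_one K] by blast
    have "ee (of_real ((of_nat n + 0) / real h) * \<tau>) = ee (\<tau> / of_real (real h)) ^ n" for n \<tau>
      unfolding ee_of_nat_mult[symmetric] by simp
    \<comment> \<open>The shift \<open>\<kappa>\<close> is 0: the width was enlarged until the
      function became strictly periodic.\<close>
    then show ?thesis unfolding qexp_nonneg_def g using hr c
      by (intro exI[of _ "real h"] exI[of _ 0] exI[of _ c]) (simp only: order_refl simp_thms, blast)
  qed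
  ultimately show ?thesis unfolding Mk_def by blast
qed

end

section \<open>Comparison of coefficients\<close>

lemma kronecker_1_left: "kronecker 1 n = 1"
  unfolding kronecker_def
proof (rule prod.neutral, rule ballI)
  fix p assume "p \<in> prime_factors n"
  then have p: "prime p" by auto
  have "kronecker_prime 1 p = 1"
  proof (cases "p = 2")
    case False
    have "\<not> [1 = 0] (mod int p)" using prime_gt_1_nat[OF p] by (simp add: cong_def)
    moreover have "QuadRes (int p) 1" unfolding QuadRes_def by (rule exI[of _ 1]) simp
    ultimately show ?thesis using False by (simp add: kronecker_prime_def Legendre_def)
  qed (simp add: kronecker_prime_def)
  then show "kronecker_prime 1 p ^ multiplicity p n = 1" by simp
qed

lemma ee_of_real_eq_1: "ee (of_real x) = 1 \<Longrightarrow> x \<in> \<int>"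
proof -
  assume "ee (of_real x) = 1"
  then have "exp (2 * of_real pi * \<i> * of_real x) = 1" by (simp add: ee_def)
  then obtain n where "Im (2 * of_real pi * \<i> * of_real x) = of_int (2 * n) * pi" unfolding exp_eq_1 by blast
  then have "x = of_int n" by simp
  then show ?thesis by simp
qed

lemma sum_roots_of_unity:
  assumes "d > 0"
  shows "(\<Sum>b<d. ee (of_nat b / of_nat d) ^ n) = (if d dvd n then of_nat d else 0)"
proof -
  define z where "z = ee (of_real (real n / real d))"
  have z: "ee (of_nat b / of_nat d) ^ n = z ^ b" for b
    unfolding z_def ee_of_nat_mult[symmetric] by (simp add: mult.commute)
  have zd: "z ^ d = 1"
  proof -
    have "z ^ d = ee (of_int (int n))" unfolding z_def ee_of_nat_mult[symmetric] using assms by simp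
    then show ?thesis by (simp only: ee_of_int)
  qed
  show ?thesis
  proof (cases "d dvd n")
    case True
    then obtain k where "n = d * k" by (elim dvdE)
    then have "z = ee (of_int (int k))" unfolding z_def using assms by simp
    then have "z = 1" by (simp only: ee_of_int)
    then show ?thesis unfolding z using True by simp
  next
    case False
    have "z \<noteq> 1"
    proof
      assume "z = 1"
      then have "real n / real d \<in> \<int>" unfolding z_def by (rule ee_of_real_eq_1)
      then obtain k where k: "real n / real d = of_int k" by (elim Ints_cases)
      then have "real_of_int (int n) = real_of_int (int d * k)" using assms by (simp add: field_simps)
      then have "int n = int d * k" by (simp only: of_int_eq_iff)
      then have "d dvd n" by (metis dvd_triv_left int_dvd_int_iff)
      then show False using False by simp
    qed
    then show ?thesis unfolding z sum_gp_strict using zd False by simp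
  qed
qed

lemma span_singleton_functions:
  assumes "cdim V = 1" "g1 \<in> V" "g2 \<in> V" "g1 \<noteq> (\<lambda>_. 0)"
  shows "\<exists>c. \<forall>x. g2 x = c * g1 x"
proof -
  interpret vs: vector_space "\<lambda>c (f :: complex \<Rightarrow> complex) x. c * f x"
    by unfold_locales (auto simp: algebra_simps)
  obtain B where B: "B \<subseteq> V" "V \<subseteq> vs.span B" "card B = vs.dim V" using vs.basis_exists[of V] by metis
  then have "card B = 1" using assms(1) by (simp add: cdim_def)
  then obtain b where b: "B = {b}" by (rule card_1_singletonE)
  have "g1 \<in> vs.span {b}" "g2 \<in> vs.span {b}" using assms B b by auto
  then obtain c1 c2 where c: "g1 = (\<lambda>x. c1 * b x)" "g2 = (\<lambda>x. c2 * b x)"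
    unfolding vs.span_singleton by blast
  have "c1 \<noteq> 0" using assms(4) c(1) by auto
  then have "\<forall>x. g2 x = (c2 / c1) * g1 x" unfolding c by simp
  then show ?thesis by blast
qed

context eta_hecke_form
begin

lemma psi_1: "\<psi> 1 = 1"
  by (simp add: \<psi>_def kronecker_1_left)

text \<open>Along the imaginary axis \<open>f\<close> tends to \<open>eta_qfun\<close> at 0, which
  is 1, whereas positive exponents would force the limit 0.\<close>

lemma f_not_cusp: "on_upper f \<notin> Sk w N (eta_char r N)"
proof
  assume "on_upper f \<in> Sk w N (eta_char r N)"
  moreover have "(1, 0, 0, 1) \<in> Gamma0 1" by (simp add: Gamma0_def)
  ultimately have "qexp_pos (slash w (1, 0, 0, 1) 1 (on_upper f))" unfolding Sk_def by blast
  then have lim0: "((\<lambda>y. slash w (1, 0, 0, 1) 1 (on_upper f) (\<i> * of_real y)) \<longlongrightarrow> 0) at_top"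
    by (rule qexp_pos_tendsto_0)
  have "((\<lambda>y. ee (\<i> * of_real y)) \<longlongrightarrow> 0) at_top"
  proof (rule tendsto_norm_zero_cancel)
    have "((\<lambda>y. exp (- (2 * pi * y))) \<longlongrightarrow> 0) at_top"
      by (intro filterlim_compose[OF exp_at_bot] filterlim_uminus_at_bot_at_top[THEN filterlim_compose]
          filterlim_tendsto_pos_mult_at_top[OF tendsto_const] filterlim_ident) auto
    then show "((\<lambda>y. norm (ee (\<i> * of_real y))) \<longlongrightarrow> 0) at_top" by (simp add: norm_ee)
  qed
  moreover have "isCont (eta_qfun r N) 0"
    using has_field_derivative_eta_qfun_0(1)[OF N] by (rule DERIV_isCont)
  ultimately have "((\<lambda>y. eta_qfun r N (ee (\<i> * of_real y))) \<longlongrightarrow> 1) at_top"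
    using isCont_tendsto_compose[of 0 "eta_qfun r N"] has_field_derivative_eta_qfun_0(2)[OF N] by metis
  moreover have "\<forall>\<^sub>F y in at_top. eta_qfun r N (ee (\<i> * of_real y)) = slash w (1, 0, 0, 1) 1 (on_upper f) (\<i> * of_real y)"
    by (rule eventually_mono[OF eventually_gt_at_top[of 0]])
       (simp add: slash_def moeb_def on_upper_def upper_def eta_quotient_eq_qfun[OF N sum0])
  ultimately have "((\<lambda>y. slash w (1, 0, 0, 1) 1 (on_upper f) (\<i> * of_real y)) \<longlongrightarrow> 1) at_top"
    by (rule Lim_transform_eventually)
  from tendsto_unique[OF trivial_limit_at_top_linorder this lim0] show False by simp
qed

definition divs :: "nat set" where
  "divs = {a. a dvd l \<and> coprime a N}"

lemma finite_divs: "finite divs"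
  unfolding divs_def using l by simp

lemma divs_cofactor:
  assumes "a \<in> divs"
  shows "a > 0" "l div a > 0" "a * (l div a) = l"
proof -
  show e: "a * (l div a) = l" using assms by (simp add: divs_def)
  show "a > 0" "l div a > 0" using e l by (metis bot_nat_0.not_eq_extremum mult_0 mult_0_right)+
qed

lemma F_eq_sum_divs:
  "F \<tau> = (\<Sum>a\<in>divs. \<psi> (int a) * of_real (real a powr (of_int w / 2)) *
     (\<Sum>b<l div a. f ((of_nat a * \<tau> + of_nat b) / of_nat (l div a)))) / of_nat l"
proof -
  define X where "X = {a. a > 0 \<and> a dvd int l \<and> coprime a (int N)}"
  have X: "X = int ` divs"
  proof
    show "X \<subseteq> int ` divs"
    proof
      fix x assume x: "x \<in> X"
      then have "x = int (nat x)" "nat x \<in> divs"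
        unfolding X_def divs_def by (auto simp: nat_dvd_iff) (metis coprime_int_iff int_nat_eq less_imp_le)
      then show "x \<in> int ` divs" by blast
    qed
    show "int ` divs \<subseteq> X" using divs_cofactor(1) unfolding X_def divs_def by auto
  qed
  have "(\<Sum>(a, b)\<in>idx. hterm a b \<tau>) = (\<Sum>a\<in>X. \<Sum>b\<in>{0..<int l div a}. hterm a b \<tau>)"
    unfolding idx_def X_def[symmetric] by (rule sum.Sigma[symmetric]) (use finite_divs X in auto)
  also have "\<dots> = (\<Sum>a\<in>divs. \<Sum>b\<in>{0..<int l div int a}. hterm (int a) b \<tau>)"
    unfolding X by (subst sum.reindex) auto
  also have "\<dots> = (\<Sum>a\<in>divs. \<Sum>b<l div a. hterm (int a) (int b) \<tau>)"
  proof (rule sum.cong[OF refl])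
    fix a assume "a \<in> divs"
    have "{0..<int l div int a} = int ` {..<l div a}"
      unfolding lessThan_atLeast0 image_int_atLeastLessThan by (simp add: zdiv_int)
    then show "(\<Sum>b\<in>{0..<int l div int a}. hterm (int a) b \<tau>) = (\<Sum>b<l div a. hterm (int a) (int b) \<tau>)"
      by (simp add: sum.reindex)
  qed
  also have "\<dots> = (\<Sum>a\<in>divs. \<psi> (int a) * of_real (real a powr (of_int w / 2)) *
     (\<Sum>b<l div a. f ((of_nat a * \<tau> + of_nat b) / of_nat (l div a))))"
    unfolding hterm_def zdiv_int[symmetric] sum_distrib_left by simp
  finally show ?thesis unfolding F_def by simp
qed

abbreviation "cf \<equiv> eta_coeff r N"

text \<open>Summing over \<open>b\<close> keeps the exponents \<open>n = d k\<close>, and there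
  \<open>ee (a \<tau> / d) ^ (d k)\<close> equals \<open>ee \<tau> ^ (a k)\<close>. The series is
  thus thinned out by \<open>d\<close> and then spread by \<open>a\<close>.\<close>

lemma section_sums:
  assumes a: "a > 0" and d: "d > 0" and \<tau>: "\<tau> \<in> upper"
  shows "(\<lambda>j. (if a dvd j then of_nat d * cf (d * (j div a)) else 0) * ee \<tau> ^ j) sums
     (\<Sum>b<d. f ((of_nat a * \<tau> + of_nat b) / of_nat d))"
proof -
  define p where "p = ee (of_nat a * \<tau> / of_nat d)"
  have up: "(of_nat a * \<tau> + of_nat b) / of_nat d \<in> upper" for b
    using upper_affine[OF \<tau>, of "int a" "int d" "int b"] a d by simp
  have pd: "p ^ (d * k) = ee \<tau> ^ (a * k)" for k
  proof -
    have "p ^ (d * k) = ee (of_nat (d * k) * (of_nat a * \<tau> / of_nat d))" unfolding p_def ee_of_nat_mult ..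
    also have "of_nat (d * k) * (of_nat a * \<tau> / of_nat d) = of_nat (a * k) * \<tau>" using d by simp
    finally show ?thesis unfolding ee_of_nat_mult .
  qed
  have t: "(\<Sum>b<d. cf n * ee ((of_nat a * \<tau> + of_nat b) / of_nat d) ^ n) = (if d dvd n then of_nat d * cf n * p ^ n else 0)" for n
  proof -
    have "ee ((of_nat a * \<tau> + of_nat b) / of_nat d) ^ n = p ^ n * ee (of_nat b / of_nat d) ^ n" for b
      unfolding add_divide_distrib ee_add power_mult_distrib p_def ..
    then have "(\<Sum>b<d. cf n * ee ((of_nat a * \<tau> + of_nat b) / of_nat d) ^ n) = cf n * (p ^ n * (\<Sum>b<d. ee (of_nat b / of_nat d) ^ n))"
      by (simp only: sum_distrib_left)
    then show ?thesis unfolding sum_roots_of_unity[OF d] by simp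
  qed
  have "(\<lambda>n. \<Sum>b<d. cf n * ee ((of_nat a * \<tau> + of_nat b) / of_nat d) ^ n) sums (\<Sum>b<d. f ((of_nat a * \<tau> + of_nat b) / of_nat d))"
    by (intro sums_sum eta_coeff_expansion(1)[OF N sum0] up)
  then have s1: "(\<lambda>n. if d dvd n then of_nat d * cf n * p ^ n else 0) sums (\<Sum>b<d. f ((of_nat a * \<tau> + of_nat b) / of_nat d))"
    unfolding t .
  have sm: "strict_mono ((*) k)" if "k > 0" for k :: nat using that by (simp add: strict_mono_def)
  have "(if d dvd n then of_nat d * cf n * p ^ n else 0) = 0" if "n \<notin> range ((*) d)" for n
    using that by (auto simp: dvd_def)
  from sums_mono_reindex[THEN iffD2, OF sm[OF d] this s1]
  have "(\<lambda>k. of_nat d * cf (d * k) * p ^ (d * k)) sums (\<Sum>b<d. f ((of_nat a * \<tau> + of_nat b) / of_nat d))"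
    by simp
  then have s2: "(\<lambda>k. of_nat d * cf (d * k) * ee \<tau> ^ (a * k)) sums (\<Sum>b<d. f ((of_nat a * \<tau> + of_nat b) / of_nat d))"
    unfolding pd .
  let ?h = "\<lambda>j. (if a dvd j then of_nat d * cf (d * (j div a)) else 0) * ee \<tau> ^ j"
  have z: "?h j = 0" if "j \<notin> range ((*) a)" for j using that by (auto simp: dvd_def)
  have "(\<lambda>k. ?h (a * k)) sums (\<Sum>b<d. f ((of_nat a * \<tau> + of_nat b) / of_nat d))" using s2 a by simp
  moreover have "(\<lambda>k. ?h (a * k)) sums c \<longleftrightarrow> ?h sums c" for c
    by (rule sums_mono_reindex[OF sm[OF a], of ?h]) (rule z)
  ultimately show ?thesis by blast
qed

lemma coeff_formula:
  assumes dim: "cdim (Mk w N (eta_char r N)) = 1"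
  shows "cf l = - of_int (r 1) * (\<Sum>a\<in>divs. \<psi> (int a) * of_real (real a powr (of_int w / 2 - 1)))"
proof -
  have i: "\<i> \<in> upper" by (simp add: upper_def)
  have "on_upper f \<in> Mk w N (eta_char r N)" using f_Mk unfolding w_def .
  moreover have "on_upper f \<i> \<noteq> 0" using f_nonzero[OF i] i by (simp add: on_upper_def)
  then have "on_upper f \<noteq> (\<lambda>_. 0)" by auto
  ultimately obtain \<Lambda> where \<Lambda>: "\<And>x. on_upper F x = \<Lambda> * on_upper f x"
    using span_singleton_functions[OF dim _ F_in_Mk, of "on_upper f"] by blast
  define C where "C = (\<lambda>j. (\<Sum>a\<in>divs. \<psi> (int a) * of_real (real a powr (of_int w / 2)) *
     (if a dvd j then of_nat (l div a) * cf (l div a * (j div a)) else 0)) / of_nat l)"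
  have "C = (\<lambda>j. \<Lambda> * cf j)"
  proof (rule qseries_unique[where g = F])
    fix \<tau> assume \<tau>: "\<tau> \<in> upper"
    have "(\<lambda>j. (\<Sum>a\<in>divs. \<psi> (int a) * of_real (real a powr (of_int w / 2)) *
        ((if a dvd j then of_nat (l div a) * cf (l div a * (j div a)) else 0) * ee \<tau> ^ j)) / of_nat l) sums F \<tau>"
      unfolding F_eq_sum_divs
      by (intro sums_divide sums_sum sums_mult section_sums \<tau> divs_cofactor)
    then show "(\<lambda>j. C j * ee \<tau> ^ j) sums F \<tau>"
      unfolding C_def by (simp add: sum_distrib_right mult.assoc)
    have "F \<tau> = \<Lambda> * f \<tau>" using \<Lambda>[of \<tau>] \<tau> by (simp add: on_upper_def)
    then show "(\<lambda>j. \<Lambda> * cf j * ee \<tau> ^ j) sums F \<tau>"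
      using sums_mult[OF eta_coeff_expansion(1)[OF N sum0 \<tau>], of \<Lambda>] by (simp add: mult.assoc)
  qed
  then have eq: "C j = \<Lambda> * cf j" for j by (rule fun_cong)
  have c: "cf 0 = 1" "cf 1 = - of_int (r 1)" using eta_coeff_expansion(2,3)[OF N sum0] by blast+
  \<comment> \<open>As \<open>cf 0 = 1\<close>, the constant term is the eigenvalue; the factor
    \<open>(l div a) / l = 1 / a\<close> lowers the exponent to \<open>k - 1\<close>.\<close>
  have C0: "C 0 = (\<Sum>a\<in>divs. \<psi> (int a) * of_real (real a powr (of_int w / 2 - 1)))"
    unfolding C_def sum_divide_distrib
  proof (rule sum.cong[OF refl])
    fix a assume a: "a \<in> divs"
    note d = divs_cofactor[OF a]
    have "real l = real a * real (l div a)" using d(3) by (metis of_nat_mult)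
    then have l': "(of_nat l :: complex) = of_nat a * of_nat (l div a)" using d(3) by (metis of_nat_mult)
    have "real a powr (of_int w / 2 - 1) = real a powr (of_int w / 2) / real a"
      using d(1) by (simp add: powr_diff)
    then show "\<psi> (int a) * of_real (real a powr (of_int w / 2)) *
        (if a dvd 0 then of_nat (l div a) * cf (l div a * (0 div a)) else 0) / of_nat l =
        \<psi> (int a) * of_real (real a powr (of_int w / 2 - 1))"
      using d c(1) by (simp add: l')
  qed
  \<comment> \<open>The coefficient of \<open>q\<close> receives a contribution from
    \<open>a = 1\<close> only, where the factor \<open>l\<close> cancels the normalisation of
    \<open>F\<close>.\<close>
  have C1: "C 1 = cf l"
  proof -
    have "1 \<in> divs" by (simp add: divs_def)
    have "(\<Sum>a\<in>divs. \<psi> (int a) * of_real (real a powr (of_int w / 2)) *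
     (if a dvd 1 then of_nat (l div a) * cf (l div a * (1 div a)) else 0)) =
     (\<Sum>a\<in>divs. if a = 1 then of_nat l * cf l else 0)"
      by (intro sum.cong refl) (auto simp: psi_1)
    also have "\<dots> = of_nat l * cf l" using finite_divs \<open>1 \<in> divs\<close> by simp
    finally show ?thesis unfolding C_def using l by simp
  qed
  have "\<Lambda> = C 0" using eq[of 0] c(1) by simp
  moreover have "cf l = \<Lambda> * - of_int (r 1)" using eq[of 1] C1 c(2) by simp
  ultimately show ?thesis unfolding C0 by simp
qed

end

theorem theorem9p20:
  fixes r :: "nat \<Rightarrow> int" and N l :: nat
  defines "k \<equiv> real_of_int (wt2 r N) / 2"
  defines "\<delta> \<equiv> delta_of (varpi r N)"
  assumes r0: "r 0 = 0"
    and fin: "finite {n. r n \<noteq> 0}"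
    and level: "N = Lcm {n. r n \<noteq> 0}"
    and adm: "weakly_admissible r N"
    and sum0: "(\<Sum>n\<in>{n. n dvd N}. int n * r n) = 0"
    and lL: "l \<in> L_f r N"
    and sqfree: "\<forall>p. prime p \<longrightarrow> \<not> p dvd N \<longrightarrow> \<not> p ^ 2 dvd l"
    and odd: "odd l \<or> odd N"
  shows "(even l \<and> odd N \<longrightarrow>
            eta_coeff r N l = - of_int (r 1) *
              (\<Sum>a\<in>{a. a dvd l \<and> coprime a N}.
                 of_int (kronecker (int a) (varpi r N)) * of_real (real a powr (k - 1))))
       \<and> (odd l \<longrightarrow>
            eta_coeff r N l = - of_int (r 1) *
              (\<Sum>a\<in>{a. a dvd l \<and> coprime a N}.
                 of_int (kronecker (int a) (varpi r N)) * of_real (real a powr (k - 1)) *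
                 ee (of_real ((k + real \<delta>) * (real l - real (l div a)) / 4))))
       \<and> (rad l dvd rad N \<longrightarrow> eta_coeff r N l = - of_int (r 1))"
proof -
  have N: "N > 0"
  proof -
    have "0 \<notin> {n. r n \<noteq> 0}" using r0 by simp
    then have "Lcm {n. r n \<noteq> 0} \<noteq> 0" using fin by (simp only: Lcm_0_iff not_False_eq_True)
    then show ?thesis using level by simp
  qed
  note delta = \<delta>_def
  interpret eta_hecke_form r N l
  proof unfold_locales
    show "on_upper (eta_quotient r N) \<in> Mk (wt2 r N) N (eta_char r N)"
      using adm unfolding weakly_admissible_def Let_def by blast
  qed (use N sum0 lL sqfree odd in \<open>auto simp: L_f_def\<close>)
  have "cdim (Mk w N (eta_char r N)) = 1"
    using adm f_not_cusp unfolding weakly_admissible_def Let_def w_def by blast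
  from coeff_formula[OF this]
  have main: "eta_coeff r N l = - of_int (r 1) * (\<Sum>a\<in>{a. a dvd l \<and> coprime a N}. \<psi> (int a) * of_real (real a powr (k - 1)))"
    unfolding divs_def k_def w_def .
  show ?thesis
  proof (intro conjI impI)
    assume "even l \<and> odd N"
    then have "\<psi> (int a) = of_int (kronecker (int a) (varpi r N))" for a by (simp add: \<psi>_def v_def)
    then show "eta_coeff r N l = - of_int (r 1) *
              (\<Sum>a\<in>{a. a dvd l \<and> coprime a N}.
                 of_int (kronecker (int a) (varpi r N)) * of_real (real a powr (k - 1)))"
      using main by (simp only:)
  next
    assume "odd l"
    then have "\<psi> (int a) * of_real (real a powr (k - 1)) = of_int (kronecker (int a) (varpi r N)) * of_real (real a powr (k - 1)) *
                 ee (of_real ((k + real \<delta>) * (real l - real (l div a)) / 4))" for a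
      unfolding \<psi>_def v_def k_def delta eta_hecke.\<delta>_def[OF eta_hecke_axioms] w_def zdiv_int[symmetric] by simp
    then show "eta_coeff r N l = - of_int (r 1) *
              (\<Sum>a\<in>{a. a dvd l \<and> coprime a N}.
                 of_int (kronecker (int a) (varpi r N)) * of_real (real a powr (k - 1)) *
                 ee (of_real ((k + real \<delta>) * (real l - real (l div a)) / 4)))"
      using main by (simp only:)
  next
    assume rad: "rad l dvd rad N"
    have "a = 1" if "a dvd l" "coprime a N" for a
    proof (rule ccontr)
      assume "a \<noteq> 1"
      then obtain p where p: "prime p" "p dvd a" by (metis prime_factor_nat)
      have "p \<in> prime_factors l" using p that(1) l by (auto simp: in_prime_factors_iff intro: dvd_trans)
      then have "p dvd rad l" unfolding rad_def by (intro dvd_prodI) auto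
      then have "p dvd \<Prod>(prime_factors N)" using rad unfolding rad_def by (rule dvd_trans)
      then obtain q where "q \<in> prime_factors N" "p dvd q" using p(1) by (auto simp: prime_dvd_prod_iff)
      then have "p dvd N" by (auto simp: in_prime_factors_iff intro: dvd_trans)
      then show False using p that(2) by (metis coprime_common_divisor not_prime_unit)
    qed
    then have "{a. a dvd l \<and> coprime a N} = {1}" by auto
    then show "eta_coeff r N l = - of_int (r 1)" using main psi_1 by simp
  qed
qed

end
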